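(* Let $1<p\le\infty$ and $1/p+1/q=1$. The topology $\kappa(L^p,L^q)$ on $L^p$ is generated by the family of seminorms $$L^p\to\mathbb{R}_+,\quad f\mapsto p_{g,h}(f)=\|h*(gf)\|_p,\qquad g\in\mathcal{C}_0,\ h\in L^1.$$
   Context: $L^p=L^p(\mathbb{R}^n)$ (complex-valued), $\mathcal{C}_0$ is the space of continuous functions on $\mathbb{R}^n$ vanishing at infinity, and $*$ is convolution on $\mathbb{R}^n$. $\kappa(E,F)$ denotes the topology on $E$ of uniform convergence on absolutely convex compact subsets of $F$; here $L^p$ and $L^q$ are paired by $\langle f,g\rangle=\int fg$ and compactness in $L^q$ is with respect to the norm topology. The space $L^p$ with $\kappa(L^p,L^q)$ is denoted $L^p_c$. *)

theory Defs
  imports "HOL-Analysis.Analysis" "HOL-Probability.Essential_Supremum"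
begin

definition ae_eq :: "(real^'n \<Rightarrow> complex) \<Rightarrow> (real^'n \<Rightarrow> complex) \<Rightarrow> bool" where
  "ae_eq f g \<longleftrightarrow> f \<in> borel_measurable lborel \<and> g \<in> borel_measurable lborel \<and>
     (AE x in lborel. f x = g x)"

lemma part_equivp_ae_eq: "part_equivp ae_eq"
proof (rule part_equivpI)
  show "\<exists>f. ae_eq f (f :: real^'n \<Rightarrow> complex)"
    by (rule exI[of _ "\<lambda>_. 0"]) (simp add: ae_eq_def)
  show "symp (ae_eq :: (real^'n \<Rightarrow> complex) \<Rightarrow> _)"
    by (rule sympI) (auto simp: ae_eq_def)
  show "transp (ae_eq :: (real^'n \<Rightarrow> complex) \<Rightarrow> _)"
  proof (rule transpI)
    fix f g h :: "real^'n \<Rightarrow> complex"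
    assume "ae_eq f g" "ae_eq g h"
    then have "AE x in lborel. f x = g x" "AE x in lborel. g x = h x"
      by (auto simp: ae_eq_def)
    then have "AE x in lborel. f x = h x"
      by eventually_elim simp
    with \<open>ae_eq f g\<close> \<open>ae_eq g h\<close> show "ae_eq f h"
      by (simp add: ae_eq_def)
  qed
qed

text \<open>Classes, modulo equality almost everywhere, of measurable functions. Borel representatives
  suffice, because every Lebesgue measurable function agrees almost everywhere with a Borel one.\<close>

quotient_type (overloaded) 'n L0 = "real^'n \<Rightarrow> complex" / partial: ae_eq
  morphisms rep_L0 class_L0
  by (rule part_equivp_ae_eq)

instantiation L0 :: (finite) comm_ring
begin

lift_definition zero_L0 :: "'a L0" is "\<lambda>_. 0"
  by (simp add: ae_eq_def)

lift_definition plus_L0 :: "'a L0 \<Rightarrow> 'a L0 \<Rightarrow> 'a L0" is "\<lambda>f g x. f x + g x"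
  unfolding ae_eq_def by (auto elim!: eventually_elim2)

lift_definition minus_L0 :: "'a L0 \<Rightarrow> 'a L0 \<Rightarrow> 'a L0" is "\<lambda>f g x. f x - g x"
  unfolding ae_eq_def by (auto elim!: eventually_elim2)

lift_definition uminus_L0 :: "'a L0 \<Rightarrow> 'a L0" is "\<lambda>f x. - f x"
  unfolding ae_eq_def by (auto elim!: eventually_mono)

lift_definition times_L0 :: "'a L0 \<Rightarrow> 'a L0 \<Rightarrow> 'a L0" is "\<lambda>f g x. f x * g x"
  unfolding ae_eq_def by (auto elim!: eventually_elim2)

instance
  by standard (transfer; auto simp: ae_eq_def algebra_simps)+

end

lift_definition scaleC_L0 :: "complex \<Rightarrow> 'n::finite L0 \<Rightarrow> 'n L0" (infixr "*\<^sub>C" 75)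
  is "\<lambda>c f x. c * f x"
  unfolding ae_eq_def by (auto elim!: eventually_mono)

lift_definition pairing :: "'n::finite L0 \<Rightarrow> 'n L0 \<Rightarrow> complex"
  is "\<lambda>f g. LINT x|lborel. f x * g x"
  unfolding ae_eq_def
  by (intro integral_cong_AE) (auto elim!: eventually_elim2)

lemma AE_lborel_reflect:
  fixes x :: "'a::euclidean_space"
  assumes "AE y in lborel. P y"
  shows "AE y in lborel. P (x - y)"
proof -
  from assms obtain N where N: "N \<in> null_sets lborel" "{y. \<not> P y} \<subseteq> N"
    by (auto simp: eventually_ae_filter)
  have [measurable]: "N \<in> sets borel"
    using N by auto
  have "AE y in lborel. y \<notin> N"
    using N(1) by (rule AE_not_in)
  moreover have "lborel = distr lborel borel (\<lambda>y. x - y)"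
    using lborel_affine[of "- 1" x] by (simp add: density_1)
  ultimately have "AE y in distr lborel borel (\<lambda>y. x - y). y \<notin> N"
    by metis
  then have "AE y in lborel. x - y \<notin> N"
    by (subst (asm) AE_distr_iff) auto
  then show ?thesis
    using N(2) by (auto elim!: eventually_mono)
qed

lift_definition conv :: "'n::finite L0 \<Rightarrow> 'n L0 \<Rightarrow> 'n L0"
  is "\<lambda>h f x. LINT y|lborel. h y * f (x - y)"
proof -
  fix h h' f f' :: "real^'n \<Rightarrow> complex"
  assume "ae_eq h h'" "ae_eq f f'"
  then have [measurable]: "h \<in> borel_measurable borel" "h' \<in> borel_measurable borel"
      "f \<in> borel_measurable borel" "f' \<in> borel_measurable borel"
    and AE: "AE y in lborel. h y = h' y" "AE y in lborel. f y = f' y"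
    by (auto simp: ae_eq_def)
  have "(LINT y|lborel. h y * f (x - y)) = (LINT y|lborel. h' y * f' (x - y))" for x
  proof (rule integral_cong_AE)
    show "AE y in lborel. h y * f (x - y) = h' y * f' (x - y)"
      using AE(1) AE_lborel_reflect[OF AE(2), of x] by eventually_elim simp
  qed measurable
  then show "ae_eq (\<lambda>x. LINT y|lborel. h y * f (x - y)) (\<lambda>x. LINT y|lborel. h' y * f' (x - y))"
    by (simp add: ae_eq_def)
qed

lift_definition eLp_norm :: "ennreal \<Rightarrow> 'n::finite L0 \<Rightarrow> ennreal"
  is "\<lambda>p f. if p = \<infinity> then esssup lborel (\<lambda>x. ennreal (cmod (f x)))
       else let I = \<integral>\<^sup>+ x. ennreal (cmod (f x) powr enn2real p) \<partial>lborel
            in if I = \<infinity> then \<infinity> else ennreal (enn2real I powr (1 / enn2real p))"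
proof -
  fix p :: ennreal and f g :: "real^'n \<Rightarrow> complex"
  assume fg: "ae_eq f g"
  then have [measurable]: "f \<in> borel_measurable borel" "g \<in> borel_measurable borel"
    and AE: "AE x in lborel. f x = g x"
    by (auto simp: ae_eq_def)
  have "esssup lborel (\<lambda>x. ennreal (cmod (f x))) = esssup lborel (\<lambda>x. ennreal (cmod (g x)))"
    using AE by (intro esssup_AE_cong) (auto elim!: eventually_mono)
  moreover have "(\<integral>\<^sup>+ x. ennreal (cmod (f x) powr enn2real p) \<partial>lborel) =
      (\<integral>\<^sup>+ x. ennreal (cmod (g x) powr enn2real p) \<partial>lborel)"
    using AE by (intro nn_integral_cong_AE) (auto elim!: eventually_mono)
  ultimately show "?thesis p f g"
    by simp
qed

definition Lp :: "ennreal \<Rightarrow> 'n::finite L0 set" where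
  "Lp p = {f. eLp_norm p f < \<infinity>}"

definition Lp_norm :: "ennreal \<Rightarrow> 'n::finite L0 \<Rightarrow> real" where
  "Lp_norm p f = enn2real (eLp_norm p f)"

definition Lp_topology :: "ennreal \<Rightarrow> 'n::finite L0 topology" where
  "Lp_topology p = Metric_space.mtopology (Lp p) (\<lambda>f g. Lp_norm p (f - g))"

definition C0 :: "(real^'n \<Rightarrow> complex) set" where
  "C0 = {g. continuous_on UNIV g \<and> (g \<longlongrightarrow> 0) at_infinity}"

definition seminorm_on :: "'n::finite L0 set \<Rightarrow> ('n L0 \<Rightarrow> real) \<Rightarrow> bool" where
  "seminorm_on V s \<longleftrightarrow>
     (\<forall>f\<in>V. 0 \<le> s f) \<and>
     (\<forall>f\<in>V. \<forall>g\<in>V. s (f + g) \<le> s f + s g) \<and>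
     (\<forall>c. \<forall>f\<in>V. s (c *\<^sub>C f) = cmod c * s f)"

definition seminorm_topology :: "'a::ab_group_add set \<Rightarrow> ('a \<Rightarrow> real) set \<Rightarrow> 'a topology" where
  "seminorm_topology V S =
     topology_generated_by (insert V {{y \<in> V. s (y - x) < e} |s x e. s \<in> S \<and> x \<in> V \<and> 0 < e})"

definition abs_convex :: "'n::finite L0 set \<Rightarrow> bool" where
  "abs_convex K \<longleftrightarrow>
     (\<forall>f\<in>K. \<forall>g\<in>K. \<forall>a b. cmod a + cmod b \<le> 1 \<longrightarrow> a *\<^sub>C f + b *\<^sub>C g \<in> K)"

text \<open>The empty set has to be excluded, since the supremum of the empty set of reals is
  unspecified.\<close>

definition kappa :: "ennreal \<Rightarrow> ennreal \<Rightarrow> 'n::finite L0 topology" where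
  "kappa p q = seminorm_topology (Lp p)
     {\<lambda>f. SUP k\<in>K. cmod (pairing f k) |K.
        K \<noteq> {} \<and> abs_convex K \<and> compactin (Lp_topology q) K}"

end

theory Submission
  imports Defs
begin

text \<open>Write \<open>e\<^sub>j\<close> for a mollifier, an even approximate identity in \<open>L\<^sup>1\<close>. Both families of seminorms
dominate each other one by one, which is all that equality of the two topologies needs
(\<open>seminorm_topology_mono\<close>). As \<open>p > 1\<close>, the conjugate exponent \<open>q\<close> is finite; this is used for the
completeness of \<open>L\<^sup>q\<close>, for the smallness of tails and for the convergence of mollifications.

\<^bold>\<open>Every convolution seminorm is a polar seminorm.\<close> Duality gives
\<open>\<parallel>h * (g f)\<parallel>\<^sub>p = sup \<bar>\<langle>h * (g f), \<phi>\<rangle>\<bar> = sup \<bar>\<langle>f, g (h' * \<phi>)\<rangle>\<bar>\<close> with \<open>h'(x) = h(-x)\<close> and \<open>\<phi>\<close> in the unit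
ball of \<open>L\<^sup>q\<close>. The set of all \<open>g (h' * \<phi>)\<close> is absolutely convex, and it is relatively compact
(\<open>relcompact_conv_mult\<close>): up to a small error in operator norm one may cut \<open>g\<close> off to a ball and
replace \<open>h'\<close> by \<open>e\<^sub>j * h'\<close>, and then the functions in question are uniformly bounded and uniformly
Lipschitz on a ball, so that finitely many step functions approximate all of them. The closure of
the set is the compact set sought for (\<open>conv_mult_seminorm_le_polar\<close>).

\<^bold>\<open>Every polar seminorm is dominated by a convolution seminorm.\<close> This amounts to factoring a compact
set \<open>K\<close> through \<open>g\<close> and \<open>h\<close>, in the spirit of Cohen's theorem. The factor \<open>g\<close> is explicit: the
elements of \<open>K\<close> have uniformly small tails, hence there is a continuous weight that tends to infinity
so slowly that multiplication by it keeps \<open>K\<close> relatively compact, and \<open>g\<close> is its reciprocal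
(\<open>C0_factorisation\<close>). For the factor \<open>h\<close> (\<open>Cohen_domination\<close>) only the estimate
\<open>\<bar>\<langle>u, k\<rangle>\<bar> \<le> M \<parallel>h * u\<parallel>\<^sub>p\<close> is required, not an actual factorisation. Put
\<open>A\<^sub>n u = 3/4 u + 1/4 E\<^sub>n * u\<close> with a mollifier \<open>E\<^sub>n\<close> that is chosen after \<open>E\<^sub>0, \<dots>, E\<^sub>n\<^sub>-\<^sub>1\<close>. The product
\<open>\<Phi>\<^sub>n = A\<^sub>0 \<dots> A\<^sub>n\<^sub>-\<^sub>1\<close> has the form \<open>(3/4)\<^sup>n u + H\<^sub>n * u\<close> and satisfies \<open>\<parallel>u\<parallel> \<le> 2\<^sup>n \<parallel>\<Phi>\<^sub>n u\<parallel>\<close>. If \<open>E\<^sub>n\<close> fixes the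
elements of \<open>K\<close> up to \<open>4\<^sup>-\<^sup>n\<close>, then \<open>\<bar>\<langle>u, k\<rangle>\<bar> \<le> M \<parallel>\<Phi>\<^sub>n u\<parallel>\<close> follows by induction with \<open>M\<close> independent of
\<open>n\<close>; if it also fixes \<open>H\<^sub>n\<close> up to \<open>2\<^sup>-\<^sup>n\<close> in \<open>L\<^sup>1\<close>, the \<open>H\<^sub>n\<close> converge to some \<open>h\<close> in \<open>L\<^sup>1\<close>, and the
estimate passes to the limit because \<open>(3/4)\<^sup>n\<close> tends to \<open>0\<close>.

The tools are the classical facts on \<open>L\<^sup>p\<close>: the inequalities of Hoelder, Minkowski and Young,
duality, completeness, and convergence of mollifications. They are proved for functions, in terms of
the predicate \<open>Lp_le\<close>, and then carried over to classes modulo equality almost everywhere.\<close>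

section \<open>Hoelder and Minkowski inequalities\<close>

text \<open>Used with bounds that are perturbed by \<open>e > 0\<close> in order to keep them away from \<open>0\<close>, where they could
not be divided by.\<close>

lemma ennreal_le_of_approx:
  fixes X :: ennreal
  assumes "\<And>e::real. 0 < e \<Longrightarrow> X \<le> ennreal (\<phi> e)" and "(\<phi> \<longlongrightarrow> c) (at_right 0)"
  shows "X \<le> ennreal c"
proof (rule tendsto_lowerbound)
  show "((\<lambda>e. ennreal (\<phi> e)) \<longlongrightarrow> ennreal c) (at_right 0)"
    using assms(2) by (rule tendsto_ennrealI)
  show "\<forall>\<^sub>F e in at_right 0. X \<le> ennreal (\<phi> e)"
    using assms(1) by (auto simp: eventually_at_filter)
qed simp

text \<open>The common last step of the inequalities of Hoelder and Minkowski: a pointwise convexity estimate is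
integrated.\<close>

lemma nn_integral_weighted_bound:
  fixes u v w :: "'a \<Rightarrow> real"
  assumes [measurable]: "u \<in> borel_measurable M" "v \<in> borel_measurable M"
    and nonneg: "\<And>x. 0 \<le> u x" "\<And>x. 0 \<le> v x" "0 \<le> c" "0 \<le> d" "0 \<le> U" "0 \<le> V"
    and le: "\<And>x. w x \<le> c * u x + d * v x"
    and U: "(\<integral>\<^sup>+x. ennreal (u x) \<partial>M) \<le> ennreal U" and V: "(\<integral>\<^sup>+x. ennreal (v x) \<partial>M) \<le> ennreal V"
  shows "(\<integral>\<^sup>+x. ennreal (w x) \<partial>M) \<le> ennreal (c * U + d * V)"
proof -
  have "(\<integral>\<^sup>+x. ennreal (w x) \<partial>M) \<le> (\<integral>\<^sup>+x. ennreal c * ennreal (u x) + ennreal d * ennreal (v x) \<partial>M)"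
  proof (rule nn_integral_mono)
    show "ennreal (w x) \<le> ennreal c * ennreal (u x) + ennreal d * ennreal (v x)" for x
      using ennreal_leI[OF le, of x] nonneg by (simp add: ennreal_plus ennreal_mult)
  qed
  also have "\<dots> = ennreal c * (\<integral>\<^sup>+x. ennreal (u x) \<partial>M) + ennreal d * (\<integral>\<^sup>+x. ennreal (v x) \<partial>M)"
    by (simp add: nn_integral_add nn_integral_cmult)
  also have "\<dots> \<le> ennreal c * ennreal U + ennreal d * ennreal V"
    by (intro add_mono mult_left_mono U V) auto
  finally show ?thesis using nonneg by (simp add: ennreal_plus ennreal_mult)
qed

text \<open>Young's inequality is applied to \<open>a / A\<close> and \<open>b / B\<close> and integrated; \<open>A\<close> and \<open>B\<close> are perturbed since
they may be \<open>0\<close>.\<close>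

lemma nn_integral_Hoelder:
  fixes a b :: "'a \<Rightarrow> real"
  assumes [measurable]: "a \<in> borel_measurable M" "b \<in> borel_measurable M"
    and nonneg: "\<And>x. 0 \<le> a x" "\<And>x. 0 \<le> b x" "0 \<le> A" "0 \<le> B"
    and r: "1 < r" "1 < s" "1/r + 1/s = 1"
    and A: "(\<integral>\<^sup>+x. ennreal (a x powr r) \<partial>M) \<le> ennreal (A powr r)"
    and B: "(\<integral>\<^sup>+x. ennreal (b x powr s) \<partial>M) \<le> ennreal (B powr s)"
  shows "(\<integral>\<^sup>+x. ennreal (a x * b x) \<partial>M) \<le> ennreal (A * B)"
proof (rule ennreal_le_of_approx)
  show "((\<lambda>e. (A + e) * (B + e)) \<longlongrightarrow> A * B) (at_right 0)"
    by (auto intro!: tendsto_eq_intros)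
  fix e :: real assume "0 < e"
  define A' B' where "A' = A + e" and "B' = B + e"
  have pos: "0 < A'" "0 < B'" using \<open>0 < e\<close> nonneg by (auto simp: A'_def B'_def)
  have A': "(\<integral>\<^sup>+x. ennreal (a x powr r) \<partial>M) \<le> ennreal (A' powr r)"
    by (rule order_trans[OF A])
      (use nonneg \<open>0 < e\<close> r in \<open>auto simp: A'_def intro!: ennreal_leI powr_mono2\<close>)
  have B': "(\<integral>\<^sup>+x. ennreal (b x powr s) \<partial>M) \<le> ennreal (B' powr s)"
    by (rule order_trans[OF B])
      (use nonneg \<open>0 < e\<close> r in \<open>auto simp: B'_def intro!: ennreal_leI powr_mono2\<close>)
  \<comment> \<open>The weights undo the normalisation of \<open>a / A'\<close> and \<open>b / B'\<close> in Young's inequality.\<close>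
  define cA cB where "cA = A' * B' / (r * A' powr r)" and "cB = A' * B' / (s * B' powr s)"
  have cpos: "0 \<le> cA" "0 \<le> cB" using pos r by (auto simp: cA_def cB_def)
  have pt: "a x * b x \<le> cA * a x powr r + cB * b x powr s" for x
  proof -
    have "(a x / A') * (b x / B') \<le> (a x / A') powr r / r + (b x / B') powr s / s"
      using nonneg pos r by (intro Youngs_inequality) auto
    also have "\<dots> = a x powr r / (r * A' powr r) + b x powr s / (s * B' powr s)"
      using nonneg pos by (simp add: powr_divide mult.commute)
    finally have "A' * B' * ((a x / A') * (b x / B')) \<le> 
        A' * B' * (a x powr r / (r * A' powr r) + b x powr s / (s * B' powr s))"
      using pos by (intro mult_left_mono) auto
    moreover have "A' * B' * ((a x / A') * (b x / B')) = a x * b x"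
      using pos by (simp add: field_simps)
    ultimately show ?thesis by (simp add: cA_def cB_def distrib_left)
  qed
  have "(\<integral>\<^sup>+x. ennreal (a x * b x) \<partial>M) \<le> ennreal (cA * A' powr r + cB * B' powr s)"
    by (rule nn_integral_weighted_bound[OF _ _ _ _ cpos _ _ pt A' B']) auto
  also have "cA * A' powr r + cB * B' powr s = A' * B' * (1/r + 1/s)"
    using pos r(1,2) by (simp add: cA_def cB_def distrib_left)
  finally show "(\<integral>\<^sup>+x. ennreal (a x * b x) \<partial>M) \<le> ennreal ((A + e) * (B + e))"
    using r(3) by (simp add: A'_def B'_def)
qed

text \<open>Extends the convexity of the power function from the open to the closed half line.\<close>

lemma powr_convex_nonneg:
  fixes x y t r :: real
  assumes "0 \<le> x" "0 \<le> y" "0 < t" "t < 1" "1 \<le> r"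
  shows "(t * x + (1 - t) * y) powr r \<le> t * x powr r + (1 - t) * y powr r"
proof -
  have zero: "(u * z) powr r \<le> u * z powr r" if "0 < u" "u < 1" "0 \<le> z" for u z :: real
  proof -
    have "(u * z) powr r = u powr r * z powr r" using that by (simp add: powr_mult)
    also have "\<dots> \<le> u powr 1 * z powr r"
      using that assms by (intro mult_right_mono powr_mono') auto
    finally show ?thesis using that by simp
  qed
  consider "x = 0" | "y = 0" | "0 < x" "0 < y" using assms by linarith
  then show ?thesis
  proof cases
    case 1 then show ?thesis using zero[of "1 - t" y] assms by simp
  next
    case 2 then show ?thesis using zero[of t x] assms by simp
  next
    case 3
    then show ?thesis
      using convex_onD[OF powr_convex[OF assms(5)], of "1 - t" x y] assms by simp
  qed
qed

text \<open>The quotient \<open>(a + b) / (A + B)\<close> is a convex combination of \<open>a / A\<close> and \<open>b / B\<close>, to which convexity of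
the power function applies. As before \<open>A\<close> and \<open>B\<close> are perturbed.\<close>

lemma nn_integral_Minkowski:
  fixes a b :: "'a \<Rightarrow> real"
  assumes [measurable]: "a \<in> borel_measurable M" "b \<in> borel_measurable M"
    and nonneg: "\<And>x. 0 \<le> a x" "\<And>x. 0 \<le> b x" "0 \<le> A" "0 \<le> B" and r: "1 \<le> r"
    and A: "(\<integral>\<^sup>+x. ennreal (a x powr r) \<partial>M) \<le> ennreal (A powr r)"
    and B: "(\<integral>\<^sup>+x. ennreal (b x powr r) \<partial>M) \<le> ennreal (B powr r)"
  shows "(\<integral>\<^sup>+x. ennreal ((a x + b x) powr r) \<partial>M) \<le> ennreal ((A + B) powr r)"
proof (rule ennreal_le_of_approx)
  show "((\<lambda>e. ((A + e) + (B + e)) powr r) \<longlongrightarrow> (A + B) powr r) (at_right 0)"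
    using r nonneg
    by (intro tendsto_powr' tendsto_eq_intros)
      (auto simp: eventually_at_filter intro!: always_eventually)
  fix e :: real assume "0 < e"
  define A' B' where "A' = A + e" and "B' = B + e"
  have pos: "0 < A'" "0 < B'" using \<open>0 < e\<close> nonneg by (auto simp: A'_def B'_def)
  have A': "(\<integral>\<^sup>+x. ennreal (a x powr r) \<partial>M) \<le> ennreal (A' powr r)"
    by (rule order_trans[OF A])
      (use nonneg \<open>0 < e\<close> r in \<open>auto simp: A'_def intro!: ennreal_leI powr_mono2\<close>)
  have B': "(\<integral>\<^sup>+x. ennreal (b x powr r) \<partial>M) \<le> ennreal (B' powr r)"
    by (rule order_trans[OF B])
      (use nonneg \<open>0 < e\<close> r in \<open>auto simp: B'_def intro!: ennreal_leI powr_mono2\<close>)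
  define t where "t = A' / (A' + B')"
  have t: "0 < t" "t < 1" "1 - t = B' / (A' + B')" using pos by (auto simp: t_def field_simps)
  define D where "D = (A' + B') powr r"
  define cA cB where "cA = D * t / A' powr r" and "cB = D * (1 - t) / B' powr r"
  have cpos: "0 \<le> cA" "0 \<le> cB" using pos t by (auto simp: cA_def cB_def D_def)
  have pt: "(a x + b x) powr r \<le> cA * a x powr r + cB * b x powr r" for x
  proof -
    have "(a x + b x) / (A' + B') = t * (a x / A') + (1 - t) * (b x / B')"
      unfolding t(3) unfolding t_def using pos by (simp add: add_divide_distrib)
    then have "((a x + b x) / (A' + B')) powr r \<le> t * (a x / A') powr r + (1 - t) * (b x / B') powr r"
      using powr_convex_nonneg[of "a x / A'" "b x / B'" t r] nonneg pos t r by simp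
    then have "D * ((a x + b x) / (A' + B')) powr r \<le> 
       D * (t * (a x / A') powr r + (1 - t) * (b x / B') powr r)"
      by (rule mult_left_mono) (simp add: D_def)
    moreover have "D * ((a x + b x) / (A' + B')) powr r = (a x + b x) powr r"
      using nonneg pos by (simp add: D_def powr_divide)
    ultimately show ?thesis
      using nonneg pos by (simp add: cA_def cB_def powr_divide distrib_left mult.assoc)
  qed
  have "(\<integral>\<^sup>+x. ennreal ((a x + b x) powr r) \<partial>M) \<le> ennreal (cA * A' powr r + cB * B' powr r)"
    by (rule nn_integral_weighted_bound[OF _ _ _ _ cpos _ _ pt A' B']) auto
  also have "cA * A' powr r + cB * B' powr r = D"
    using pos by (simp add: cA_def cB_def field_simps)
  finally show "(\<integral>\<^sup>+x. ennreal ((a x + b x) powr r) \<partial>M) \<le> ennreal (((A + e) + (B + e)) powr r)"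
    by (simp add: A'_def B'_def D_def)
qed

section \<open>Norm bounds for functions\<close>

text \<open>A bound on the norm, rather than its value, is what most estimates produce and consume. It treats
finite and infinite exponents uniformly and avoids roots of extended real integrals.\<close>

definition Lp_le :: "ennreal \<Rightarrow> (real^'n \<Rightarrow> complex) \<Rightarrow> real \<Rightarrow> bool" where
  "Lp_le p f C \<longleftrightarrow> f \<in> borel_measurable borel \<and> 0 \<le> C \<and>
    (if p = \<infinity> then AE x in lborel. cmod (f x) \<le> C
     else (\<integral>\<^sup>+x. ennreal (cmod (f x) powr enn2real p) \<partial>lborel) \<le> ennreal (C powr enn2real p))"

lemma Lp_le_top:
  "Lp_le top f C \<longleftrightarrow> f \<in> borel_measurable borel \<and> 0 \<le> C \<and> (AE x in lborel. cmod (f x) \<le> C)"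
  by (simp add: Lp_le_def)

lemma Lp_le_real:
  "0 \<le> r \<Longrightarrow> Lp_le (ennreal r) f C \<longleftrightarrow> f \<in> borel_measurable borel \<and> 0 \<le> C \<and>
    (\<integral>\<^sup>+x. ennreal (cmod (f x) powr r) \<partial>lborel) \<le> ennreal (C powr r)"
  by (simp add: Lp_le_def)

lemma Lp_le_1:
  "Lp_le 1 f C \<longleftrightarrow> f \<in> borel_measurable borel \<and> 0 \<le> C \<and>
    (\<integral>\<^sup>+x. ennreal (cmod (f x)) \<partial>lborel) \<le> ennreal C"
  using Lp_le_real[of 1 f C] by auto

lemma exponent_cases [consumes 1, case_names infinity real]:
  fixes p :: ennreal
  assumes "1 \<le> p"
  obtains "p = top" | r where "1 \<le> r" "p = ennreal r"
  using assms by (cases p) auto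

lemma Lp_leD: 
  assumes "Lp_le p f C" shows "f \<in> borel_measurable borel" "0 \<le> C"
  using assms by (auto simp: Lp_le_def)

lemma Lp_le_AE_mono:
  assumes "1 \<le> p" "Lp_le p f C" "g \<in> borel_measurable borel" "AE x in lborel. cmod (g x) \<le> cmod (f x)"
  shows "Lp_le p g C"
  using assms(1)
proof (cases rule: exponent_cases)
  case infinity
  then show ?thesis using assms by (auto simp: Lp_le_top elim!: eventually_elim2)
next
  case (real r)
  have "(\<integral>\<^sup>+x. ennreal (cmod (g x) powr r) \<partial>lborel) \<le> (\<integral>\<^sup>+x. ennreal (cmod (f x) powr r) \<partial>lborel)"
    using assms(4) real by (intro nn_integral_mono_AE) (auto elim!: eventually_mono intro!: ennreal_leI powr_mono2)
  then show ?thesis using assms real by (auto simp: Lp_le_real)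
qed

lemma Lp_le_mono_bound:
  assumes "1 \<le> p" "Lp_le p f C" "C \<le> D"
  shows "Lp_le p f D"
  using assms(1)
proof (cases rule: exponent_cases)
  case infinity
  then show ?thesis using assms by (auto simp: Lp_le_top elim!: eventually_mono)
next
  case (real r)
  have "ennreal (C powr r) \<le> ennreal (D powr r)"
    using assms real Lp_leD[OF assms(2)] by (intro ennreal_leI powr_mono2) auto
  then show ?thesis using assms real by (auto simp: Lp_le_real intro: order_trans)
qed

lemma Lp_le_cmult:
  assumes "1 \<le> p" "Lp_le p f C"
  shows "Lp_le p (\<lambda>x. c * f x) (cmod c * C)"
proof -
  have [measurable]: "f \<in> borel_measurable borel" using Lp_leD[OF assms(2)] by simp
  show ?thesis using assms(1)
  proof (cases rule: exponent_cases)
    case infinity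
    then show ?thesis using assms 
      by (auto simp: Lp_le_top norm_mult elim!: eventually_mono intro!: mult_left_mono)
  next
    case (real r)
    have "(\<integral>\<^sup>+x. ennreal (cmod (c * f x) powr r) \<partial>lborel) =
       ennreal (cmod c powr r) * (\<integral>\<^sup>+x. ennreal (cmod (f x) powr r) \<partial>lborel)"
      by (simp add: norm_mult powr_mult ennreal_mult nn_integral_cmult)
    also have "\<dots> \<le> ennreal (cmod c powr r) * ennreal (C powr r)"
      using assms real by (intro mult_left_mono) (auto simp: Lp_le_real)
    also have "\<dots> = ennreal ((cmod c * C) powr r)"
      using Lp_leD[OF assms(2)] by (simp add: powr_mult ennreal_mult)
    finally show ?thesis using Lp_leD[OF assms(2)] real by (auto simp: Lp_le_real)
  qed
qed

lemma Lp_le_add: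
  assumes "1 \<le> p" "Lp_le p f A" "Lp_le p g B"
  shows "Lp_le p (\<lambda>x. f x + g x) (A + B)"
proof -
  have [measurable]: "f \<in> borel_measurable borel" "g \<in> borel_measurable borel" 
    and pos: "0 \<le> A" "0 \<le> B" using Lp_leD assms by auto
  show ?thesis using assms(1)
  proof (cases rule: exponent_cases)
    case infinity
    have "AE x in lborel. cmod (f x + g x) \<le> A + B"
      using assms(2,3) unfolding infinity Lp_le_top
      by (auto elim!: eventually_elim2 intro: norm_triangle_mono)
    then show ?thesis using infinity pos by (auto simp: Lp_le_top)
  next
    case (real r)
    have "(\<integral>\<^sup>+x. ennreal (cmod (f x + g x) powr r) \<partial>lborel) \<le>
      (\<integral>\<^sup>+x. ennreal ((cmod (f x) + cmod (g x)) powr r) \<partial>lborel)"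
      using real by (intro nn_integral_mono ennreal_leI powr_mono2) (auto intro: norm_triangle_ineq)
    also have "\<dots> \<le> ennreal ((A + B) powr r)"
      using assms real pos by (intro nn_integral_Minkowski) (auto simp: Lp_le_real)
    finally show ?thesis using pos real by (auto simp: Lp_le_real)
  qed
qed

lemma Lp_le_zero: "1 \<le> p \<Longrightarrow> Lp_le p (\<lambda>x. 0) 0"
  by (auto simp: Lp_le_def)

lemma Lp_le_sum:
  assumes "1 \<le> p" "finite I" "\<And>i. i \<in> I \<Longrightarrow> Lp_le p (f i) (a i)"
  shows "Lp_le p (\<lambda>x. \<Sum>i\<in>I. f i x) (\<Sum>i\<in>I. a i)"
  using assms(2,3) by (induction) (auto intro: Lp_le_add Lp_le_zero assms(1))

lemma Lp_le_bounded_mult: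
  assumes "1 \<le> p" "Lp_le p f C" "g \<in> borel_measurable borel" "AE x in lborel. cmod (g x) \<le> B" "0 \<le> B"
  shows "Lp_le p (\<lambda>x. g x * f x) (B * C)"
proof -
  have [measurable]: "f \<in> borel_measurable borel" "g \<in> borel_measurable borel" using Lp_leD assms by auto
  have "Lp_le p (\<lambda>x. complex_of_real B * f x) (B * C)"
    using Lp_le_cmult[OF assms(1,2), of "of_real B"] assms(5) by simp
  then show ?thesis
    by (rule Lp_le_AE_mono[OF assms(1)])
      (use assms(4,5) in \<open>auto simp: norm_mult elim!: eventually_mono intro!: mult_right_mono\<close>)
qed

text \<open>For finite exponents this is Fatou's lemma.\<close>

lemma Lp_le_Fatou:
  assumes "1 \<le> p" "\<And>n. Lp_le p (f n) C" "g \<in> borel_measurable borel"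
    and lim: "AE x in lborel. (\<lambda>n::nat. f n x) \<longlonglongrightarrow> g x"
  shows "Lp_le p g C"
proof -
  have [measurable]: "f n \<in> borel_measurable borel" for n using Lp_leD[OF assms(2)] by simp
  have C: "0 \<le> C" using Lp_leD[OF assms(2)] by simp
  show ?thesis using assms(1)
  proof (cases rule: exponent_cases)
    case infinity
    have "AE x in lborel. \<forall>n. cmod (f n x) \<le> C"
      using assms(2) unfolding infinity Lp_le_top by (simp add: AE_all_countable)
    then have "AE x in lborel. cmod (g x) \<le> C"
      using lim by eventually_elim (auto intro: LIMSEQ_le_const2 tendsto_norm)
    then show ?thesis using infinity C assms(3) by (auto simp: Lp_le_top)
  next
    case (real r)
    have "AE x in lborel. ennreal (cmod (g x) powr r) = liminf (\<lambda>n. ennreal (cmod (f n x) powr r))"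
      using lim
    proof eventually_elim
      case (elim x)
      have "(\<lambda>n. cmod (f n x) powr r) \<longlonglongrightarrow> cmod (g x) powr r"
        using real by (intro tendsto_powr' tendsto_norm elim tendsto_const) auto
      then have "(\<lambda>n. ennreal (cmod (f n x) powr r)) \<longlonglongrightarrow> ennreal (cmod (g x) powr r)"
        by (rule tendsto_ennrealI)
      then show ?case using lim_imp_Liminf by force
    qed
    then have "(\<integral>\<^sup>+x. ennreal (cmod (g x) powr r) \<partial>lborel) =
       (\<integral>\<^sup>+x. liminf (\<lambda>n. ennreal (cmod (f n x) powr r)) \<partial>lborel)"
      by (rule nn_integral_cong_AE)
    also have "\<dots> \<le> liminf (\<lambda>n. \<integral>\<^sup>+x. ennreal (cmod (f n x) powr r) \<partial>lborel)"
      by (rule nn_integral_liminf) auto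
    also have "\<dots> \<le> liminf (\<lambda>n. ennreal (C powr r))"
      using assms(2) real by (intro Liminf_mono) (auto simp: Lp_le_real)
    also have "\<dots> = ennreal (C powr r)" by (simp add: Liminf_const)
    finally show ?thesis using real C assms(3) by (auto simp: Lp_le_real)
  qed
qed

text \<open>The reciprocal relation for extended real exponents, spelled out case by case.\<close>

definition conjugate :: "ennreal \<Rightarrow> ennreal \<Rightarrow> bool" where
  "conjugate p q \<longleftrightarrow> (p = top \<and> q = 1) \<or> (p = 1 \<and> q = top) \<or>
     (\<exists>r s. 1 < r \<and> 1 < s \<and> 1 / r + 1 / s = 1 \<and> p = ennreal r \<and> q = ennreal s)"

lemma conjugate_sym: "conjugate p q \<Longrightarrow> conjugate q p"
  unfolding conjugate_def by (metis add.commute)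

lemma conjugate_ge1: assumes "conjugate p q" shows "1 \<le> p" "1 \<le> q"
  using assms by (auto simp: conjugate_def)

lemma Hoelder:
  assumes "conjugate p q" "Lp_le p f A" "Lp_le q g B"
  shows "(\<integral>\<^sup>+x. ennreal (cmod (f x * g x)) \<partial>lborel) \<le> ennreal (A * B)"
proof -
  have *: "(\<integral>\<^sup>+x. ennreal (cmod (f x * g x)) \<partial>lborel) \<le> ennreal (A * B)"
    if f: "Lp_le top f A" and g: "Lp_le 1 g B" for f g :: "real^'n \<Rightarrow> complex" and A B
  proof -
    have [measurable]: "g \<in> borel_measurable borel" and A: "0 \<le> A" "0 \<le> B" using Lp_leD that by auto
    have "(\<integral>\<^sup>+x. ennreal (cmod (f x * g x)) \<partial>lborel) \<le> (\<integral>\<^sup>+x. ennreal A * ennreal (cmod (g x)) \<partial>lborel)"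
      using f unfolding Lp_le_top
      by (intro nn_integral_mono_AE)
       (auto simp: norm_mult ennreal_mult[symmetric] A elim!: eventually_mono intro!: ennreal_leI mult_right_mono)
    also have "\<dots> = ennreal A * (\<integral>\<^sup>+x. ennreal (cmod (g x)) \<partial>lborel)"
      by (simp add: nn_integral_cmult)
    also have "\<dots> \<le> ennreal A * ennreal B"
      using g by (intro mult_left_mono) (auto simp: Lp_le_1)
    finally show ?thesis using A by (simp add: ennreal_mult)
  qed
  from assms(1) consider "p = top" "q = 1" | "p = 1" "q = top" |
     (r) r s where "1 < r" "1 < s" "1/r + 1/s = 1" "p = ennreal r" "q = ennreal s"
    unfolding conjugate_def by blast
  then show ?thesis
  proof cases
    case 1 then show ?thesis using * assms by blast
  next
    case 2 then show ?thesis using *[of g B f A] assms by (simp add: mult.commute)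
  next
    case r
    then show ?thesis using assms(2,3) 
      using nn_integral_Hoelder[of "\<lambda>x. cmod (f x)" lborel "\<lambda>x. cmod (g x)" A B r s]
      by (auto simp: Lp_le_real norm_mult)
  qed
qed

lemma Hoelder_integrable:
  assumes "conjugate p q" "Lp_le p f A" "Lp_le q g B"
  shows "integrable lborel (\<lambda>x. f x * g x)" "cmod (LINT x|lborel. f x * g x) \<le> A * B"
proof -
  have [measurable]: "f \<in> borel_measurable borel" "g \<in> borel_measurable borel" 
    and pos: "0 \<le> A" "0 \<le> B" using Lp_leD assms by auto
  show i: "integrable lborel (\<lambda>x. f x * g x)"
    using Hoelder[OF assms] by (intro integrableI_bounded) (auto intro: le_less_trans)
  have "ennreal (cmod (LINT x|lborel. f x * g x)) \<le> ennreal (A * B)"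
    by (rule order_trans[OF integral_norm_bound_ennreal[OF i] Hoelder[OF assms]])
  then show "cmod (LINT x|lborel. f x * g x) \<le> A * B" using pos by simp
qed

section \<open>Convolution\<close>

lemma lborel_distr_reflect: "distr lborel borel (\<lambda>y. x - y) = (lborel :: 'a::euclidean_space measure)"
  using lborel_affine[of "- 1" x] by (simp add: density_1)

lemma nn_integral_lborel_reflect:
  fixes x :: "'a::euclidean_space"
  assumes [measurable]: "f \<in> borel_measurable borel"
  shows "(\<integral>\<^sup>+y. f (x - y) \<partial>lborel) = (\<integral>\<^sup>+y. f y \<partial>lborel)"
proof -
  have "(\<integral>\<^sup>+y. f y \<partial>lborel) = (\<integral>\<^sup>+y. f y \<partial>distr lborel borel (\<lambda>y. x - y))"
    by (simp add: lborel_distr_reflect)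
  then show ?thesis by (simp add: nn_integral_distr)
qed

lemma nn_integral_lborel_shift:
  fixes y :: "'a::euclidean_space"
  assumes [measurable]: "f \<in> borel_measurable borel"
  shows "(\<integral>\<^sup>+x. f (x - y) \<partial>lborel) = (\<integral>\<^sup>+x. f x \<partial>lborel)"
proof -
  have "(\<integral>\<^sup>+x. f x \<partial>lborel) = (\<integral>\<^sup>+x. f x \<partial>distr lborel borel ((+) (- y)))"
    by (simp only: lborel_distr_plus)
  also have "\<dots> = (\<integral>\<^sup>+x. f (- y + x) \<partial>lborel)" by (rule nn_integral_distr) auto
  finally show ?thesis by simp
qed

lemma integral_lborel_reflect:
  fixes x :: "'a::euclidean_space" and f :: "'a \<Rightarrow> complex"
  assumes [measurable]: "f \<in> borel_measurable borel"
  shows "(LINT y|lborel. f (x - y)) = (LINT y|lborel. f y)"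
proof -
  have "(LINT y|lborel. f y) = (LINT y|distr lborel borel (\<lambda>y. x - y). f y)"
    by (simp add: lborel_distr_reflect)
  then show ?thesis by (simp add: integral_distr)
qed

lemma integral_lborel_shift:
  fixes y :: "'a::euclidean_space" and f :: "'a \<Rightarrow> complex"
  assumes [measurable]: "f \<in> borel_measurable borel"
  shows "(LINT x|lborel. f (x - y)) = (LINT x|lborel. f x)"
proof -
  have "(LINT x|lborel. f x) = (LINT x|distr lborel borel ((+) (- y)). f x)"
    by (simp only: lborel_distr_plus)
  also have "\<dots> = (LINT x|lborel. f (- y + x))" by (rule integral_distr) auto
  finally show ?thesis by simp
qed

definition convolve :: "(real^'n \<Rightarrow> complex) \<Rightarrow> (real^'n \<Rightarrow> complex) \<Rightarrow> real^'n \<Rightarrow> complex" where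
  "convolve h f x = (LINT y|lborel. h y * f (x - y))"

text \<open>The value may be infinite at some points; where it is finite, the Bochner integral that defines the
convolution converges absolutely.\<close>

definition abs_convolve :: "(real^'n \<Rightarrow> complex) \<Rightarrow> (real^'n \<Rightarrow> complex) \<Rightarrow> real^'n \<Rightarrow> ennreal" where
  "abs_convolve h f x = (\<integral>\<^sup>+y. ennreal (cmod (h y * f (x - y))) \<partial>lborel)"

lemma measurable_convolve [measurable]:
  assumes [measurable]: "h \<in> borel_measurable borel" "f \<in> borel_measurable borel"
  shows "convolve h f \<in> borel_measurable borel"
  unfolding convolve_def by measurable

lemma measurable_abs_convolve [measurable]:
  assumes [measurable]: "h \<in> borel_measurable borel" "f \<in> borel_measurable borel"
  shows "abs_convolve h f \<in> borel_measurable borel"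
  unfolding abs_convolve_def by measurable

lemma convolve_commute:
  assumes [measurable]: "h \<in> borel_measurable borel" "f \<in> borel_measurable borel"
  shows "convolve h f x = convolve f h x"
proof -
  have "convolve h f x = (LINT y|lborel. h (x - y) * f (x - (x - y)))"
    unfolding convolve_def by (subst integral_lborel_reflect[of _ x, symmetric]) auto
  then show ?thesis by (simp add: convolve_def mult.commute)
qed

text \<open>This holds even where the convolution diverges, since the Bochner integral of a function that is not
integrable is \<open>0\<close>.\<close>

lemma cmod_convolve_le: "ennreal (cmod (convolve h f x)) \<le> abs_convolve h f x"
proof (cases "integrable lborel (\<lambda>y. h y * f (x - y))")
  case True
  then show ?thesis unfolding convolve_def abs_convolve_def by (rule integral_norm_bound_ennreal)
next
  case False
  then show ?thesis by (simp add: convolve_def not_integrable_integral_eq)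
qed

text \<open>Hoelder's inequality for the factors \<open>\<bar>h\<bar>\<^sup>1\<^sup>/\<^sup>r \<bar>u(x - \<cdot>)\<bar>\<close> and \<open>\<bar>h\<bar>\<^sup>1\<^sup>/\<^sup>s\<close>. The exponent \<open>r = 1\<close>, whose
conjugate is infinite, is set apart also because \<open>A powr 0\<close> is \<open>0\<close> for \<open>A = 0\<close>.\<close>

lemma abs_convolve_powr_le:
  fixes h u :: "real^'n \<Rightarrow> complex"
  assumes r: "1 \<le> r" and h: "Lp_le 1 h A" and [measurable]: "u \<in> borel_measurable borel"
    and J: "(\<integral>\<^sup>+y. ennreal (cmod (h y)) * ennreal (cmod (u (x - y)) powr r) \<partial>lborel) = ennreal j" "0 \<le> j"
  shows "\<exists>v\<ge>0. abs_convolve h u x \<le> ennreal v \<and> v powr r = (if r = 1 then 1 else A powr (r - 1)) * j"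
proof (cases "r = 1")
  case True
  have "abs_convolve h u x = ennreal j"
    using J True by (simp add: abs_convolve_def norm_mult ennreal_mult)
  then show ?thesis using J True by (intro exI[of _ j]) auto
next
  case False
  with r have r: "1 < r" by simp
  have [measurable]: "h \<in> borel_measurable borel" and A: "0 \<le> A" using Lp_leD[OF h] by auto
  define s where "s = r / (r - 1)"
  have s: "1 < s" "1/r + 1/s = 1" "r / s = r - 1" using r by (auto simp: s_def field_simps)
  define a where "a y = cmod (h y) powr (1/r) * cmod (u (x - y))" for y
  define b where "b y = cmod (h y) powr (1/s)" for y
  have [measurable]: "a \<in> borel_measurable lborel" "b \<in> borel_measurable lborel"
    unfolding a_def b_def by measurable
  have "a y powr r = cmod (h y) * cmod (u (x - y)) powr r" for y
    using r by (simp add: a_def powr_mult powr_powr)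
  then have ia: "(\<integral>\<^sup>+y. ennreal (a y powr r) \<partial>lborel) \<le> ennreal ((j powr (1/r)) powr r)"
    using J r by (simp add: ennreal_mult powr_powr)
  have "b y powr s = cmod (h y)" for y
    using s by (simp add: b_def powr_powr)
  then have ib: "(\<integral>\<^sup>+y. ennreal (b y powr s) \<partial>lborel) \<le> ennreal ((A powr (1/s)) powr s)"
    using h s A by (simp add: Lp_le_1 powr_powr)
  have ab: "a y * b y = cmod (h y * u (x - y))" for y
  proof -
    have "cmod (h y) powr (1/r) * cmod (h y) powr (1/s) = cmod (h y)"
      using s(2) by (simp add: powr_add[symmetric])
    then show ?thesis by (simp add: a_def b_def norm_mult ac_simps)
  qed
  have "(\<integral>\<^sup>+y. ennreal (a y * b y) \<partial>lborel) \<le> ennreal (j powr (1/r) * A powr (1/s))"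
    by (rule nn_integral_Hoelder[OF _ _ _ _ _ _ r s(1,2) ia ib]) (auto simp: a_def b_def)
  then have "abs_convolve h u x \<le> ennreal (j powr (1/r) * A powr (1/s))"
    by (simp add: ab abs_convolve_def)
  moreover have "(j powr (1/r) * A powr (1/s)) powr r = A powr (r - 1) * j"
    using J r s by (simp add: powr_mult powr_powr mult.commute)
  ultimately show ?thesis using False by (intro exI[of _ "j powr (1/r) * A powr (1/s)"]) auto
qed

text \<open>For finite \<open>p\<close> the pointwise estimate \<open>abs_convolve_powr_le\<close> is integrated with Tonelli's theorem,
which also shows that the integral \<open>J x\<close> on its right-hand side is finite for almost every \<open>x\<close>. Stating
the bound for the absolute convolution, and not just for the convolution, provides the integrability
that later applications of Fubini's theorem depend on.\<close>

lemma Young_abs_convolve: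
  fixes h u :: "real^'n \<Rightarrow> complex"
  assumes p: "1 \<le> p" and h: "Lp_le 1 h A" and u: "Lp_le p u C"
  shows "AE x in lborel. abs_convolve h u x < top"
    and "Lp_le p (\<lambda>x. complex_of_real (enn2real (abs_convolve h u x))) (A * C)"
proof -
  have [measurable]: "h \<in> borel_measurable borel" "u \<in> borel_measurable borel" 
    and pos: "0 \<le> A" "0 \<le> C" using Lp_leD[OF h] Lp_leD[OF u] by auto
  have "(AE x in lborel. abs_convolve h u x < top) \<and>
     Lp_le p (\<lambda>x. complex_of_real (enn2real (abs_convolve h u x))) (A * C)" using p
  proof (cases rule: exponent_cases)
    case infinity
    have "abs_convolve h u x \<le> ennreal (A * C)" for x
    proof -
      have "AE y in lborel. cmod (u (x - y)) \<le> C"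
        by (rule AE_lborel_reflect) (use u in \<open>auto simp: infinity Lp_le_top\<close>)
      then have "abs_convolve h u x \<le> (\<integral>\<^sup>+y. ennreal (cmod (h y)) * ennreal C \<partial>lborel)"
        unfolding abs_convolve_def
        by (intro nn_integral_mono_AE)
          (auto simp: norm_mult ennreal_mult[symmetric] pos intro!: ennreal_leI mult_left_mono elim!: eventually_mono)
      also have "\<dots> = (\<integral>\<^sup>+y. ennreal (cmod (h y)) \<partial>lborel) * ennreal C"
        by (simp add: nn_integral_multc)
      also have "\<dots> \<le> ennreal A * ennreal C"
        using h by (intro mult_right_mono) (auto simp: Lp_le_1)
      finally show ?thesis using pos by (simp add: ennreal_mult)
    qed
    then have "abs_convolve h u x < top" "enn2real (abs_convolve h u x) \<le> A * C" for x
      using pos by (auto intro!: enn2real_leI intro: le_less_trans[OF _ ennreal_less_top])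
    then show ?thesis using pos by (auto simp: infinity Lp_le_top)
  next
    case (real r)
    define J where "J x = (\<integral>\<^sup>+y. ennreal (cmod (h y)) * ennreal (cmod (u (x - y)) powr r) \<partial>lborel)" for x
    have [measurable]: "J \<in> borel_measurable borel" unfolding J_def by measurable
    \<comment> \<open>This factor and the factor \<open>A\<close> from the integral of \<open>\<bar>h\<bar>\<close> combine to \<open>A powr r\<close>.\<close>
    define c where "c = (if r = 1 then 1 else A powr (r - 1))"
    have c: "0 \<le> c" "c * A = A powr r"
      using pos real by (auto simp: c_def powr_diff)
    have "(\<integral>\<^sup>+x. J x \<partial>lborel) = 
      (\<integral>\<^sup>+y. (\<integral>\<^sup>+x. ennreal (cmod (h y)) * ennreal (cmod (u (x - y)) powr r) \<partial>lborel) \<partial>lborel)"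
      unfolding J_def by (rule lborel_pair.Fubini'[symmetric]) measurable
    also have "\<dots> = (\<integral>\<^sup>+y. ennreal (cmod (h y)) * (\<integral>\<^sup>+x. ennreal (cmod (u x) powr r) \<partial>lborel) \<partial>lborel)"
    proof (rule nn_integral_cong)
      fix y
      have "(\<integral>\<^sup>+x. ennreal (cmod (h y)) * ennreal (cmod (u (x - y)) powr r) \<partial>lborel) =
        ennreal (cmod (h y)) * (\<integral>\<^sup>+x. ennreal (cmod (u (x - y)) powr r) \<partial>lborel)"
        by (rule nn_integral_cmult) measurable
      then show "(\<integral>\<^sup>+x. ennreal (cmod (h y)) * ennreal (cmod (u (x - y)) powr r) \<partial>lborel) =
        ennreal (cmod (h y)) * (\<integral>\<^sup>+x. ennreal (cmod (u x) powr r) \<partial>lborel)"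
        using nn_integral_lborel_shift[of "\<lambda>x. ennreal (cmod (u x) powr r)" y] by simp
    qed
    also have "\<dots> = (\<integral>\<^sup>+y. ennreal (cmod (h y)) \<partial>lborel) * (\<integral>\<^sup>+x. ennreal (cmod (u x) powr r) \<partial>lborel)"
      by (rule nn_integral_multc) measurable
    also have "\<dots> \<le> ennreal A * ennreal (C powr r)"
      using h u real by (intro mult_mono) (auto simp: Lp_le_1 Lp_le_real)
    finally have intJ: "(\<integral>\<^sup>+x. J x \<partial>lborel) \<le> ennreal A * ennreal (C powr r)" .
    have finJ: "AE x in lborel. J x \<noteq> top"
      by (rule nn_integral_PInf_AE[unfolded infinity_ennreal_def]) (use intJ in \<open>auto simp: ennreal_mult[symmetric] pos top_unique\<close>)
    have pt: "abs_convolve h u x < top \<and> ennreal (enn2real (abs_convolve h u x) powr r) \<le> ennreal c * J x"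
      if "J x \<noteq> top" for x
    proof -
      from that obtain j where j: "J x = ennreal j" "0 \<le> j" by (cases "J x") auto
      from abs_convolve_powr_le[OF real(1) h _ j(1)[unfolded J_def] j(2)]
      obtain v where v: "0 \<le> v" "abs_convolve h u x \<le> ennreal v" "v powr r = c * j"
        by (auto simp: c_def)
      have "enn2real (abs_convolve h u x) powr r \<le> v powr r"
        using v real by (intro powr_mono2 enn2real_leI) auto
      then show ?thesis using v j c 
        by (auto simp: ennreal_mult[symmetric] intro: le_less_trans)
    qed
    have "(\<integral>\<^sup>+x. ennreal (enn2real (abs_convolve h u x) powr r) \<partial>lborel) \<le> (\<integral>\<^sup>+x. ennreal c * J x \<partial>lborel)"
      using finJ by (intro nn_integral_mono_AE) (auto elim!: eventually_mono intro: pt[THEN conjunct2])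
    also have "\<dots> = ennreal c * (\<integral>\<^sup>+x. J x \<partial>lborel)" by (rule nn_integral_cmult) measurable
    also have "\<dots> \<le> ennreal c * (ennreal A * ennreal (C powr r))"
      by (intro mult_left_mono intJ) auto
    also have "\<dots> = ennreal ((A * C) powr r)"
      using c pos by (simp add: ennreal_mult[symmetric] powr_mult mult.assoc[symmetric])
    finally have "Lp_le p (\<lambda>x. complex_of_real (enn2real (abs_convolve h u x))) (A * C)"
      using real pos by (auto simp: Lp_le_real)
    moreover have "AE x in lborel. abs_convolve h u x < top"
      using finJ by eventually_elim (auto dest: pt)
    ultimately show ?thesis by simp
  qed
  then show "AE x in lborel. abs_convolve h u x < top"
    and "Lp_le p (\<lambda>x. complex_of_real (enn2real (abs_convolve h u x))) (A * C)" by auto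
qed

lemma Young:
  assumes p: "1 \<le> p" and h: "Lp_le 1 h A" and u: "Lp_le p u C"
  shows "Lp_le p (convolve h u) (A * C)"
proof (rule Lp_le_AE_mono[OF p Young_abs_convolve(2)[OF assms]])
  show "convolve h u \<in> borel_measurable borel" using Lp_leD h u by (auto intro: measurable_convolve)
  show "AE x in lborel. cmod (convolve h u x) \<le> cmod (complex_of_real (enn2real (abs_convolve h u x)))"
    using Young_abs_convolve(1)[OF assms]
  proof eventually_elim
    case (elim x)
    have "enn2real (ennreal (cmod (convolve h u x))) \<le> enn2real (abs_convolve h u x)"
      using elim by (intro enn2real_mono cmod_convolve_le)
    then show ?case by simp
  qed
qed

lemma abs_convolve_integrable:
  assumes [measurable]: "h \<in> borel_measurable borel" "u \<in> borel_measurable borel" 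
    and "abs_convolve h u x < top"
  shows "integrable lborel (\<lambda>y. h y * u (x - y))"
  using assms(3) unfolding abs_convolve_def by (intro integrableI_bounded) auto

lemma convolve_integrable_AE:
  assumes p: "1 \<le> p" and h: "Lp_le 1 h A" and u: "Lp_le p u C"
  shows "AE x in lborel. integrable lborel (\<lambda>y. h y * u (x - y))"
  using Young_abs_convolve(1)[OF assms]
  by eventually_elim (use Lp_leD h u in \<open>auto intro: abs_convolve_integrable\<close>)

lemma convolve_add_right_AE:
  assumes p: "1 \<le> p" and h: "Lp_le 1 h A" and u: "Lp_le p u C" and v: "Lp_le p v D"
  shows "AE x in lborel. convolve h (\<lambda>x. u x + v x) x = convolve h u x + convolve h v x"
  using convolve_integrable_AE[OF p h u] convolve_integrable_AE[OF p h v]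
  by eventually_elim (simp add: convolve_def distrib_left)

lemma convolve_add_left_AE:
  assumes p: "1 \<le> p" and h: "Lp_le 1 h A" and k: "Lp_le 1 k B" and u: "Lp_le p u C"
  shows "AE x in lborel. convolve (\<lambda>x. h x + k x) u x = convolve h u x + convolve k u x"
  using convolve_integrable_AE[OF p h u] convolve_integrable_AE[OF p k u]
  by eventually_elim (simp add: convolve_def distrib_right)

text \<open>Fubini's theorem, after the substitution \<open>w = y + z\<close>; it applies at every point where the triple
absolute convolution is finite.\<close>

lemma convolve_assoc_AE:
  fixes h e u :: "real^'n \<Rightarrow> complex"
  assumes p: "1 \<le> p" and h: "Lp_le 1 h A" and e: "Lp_le 1 e B" and u: "Lp_le p u C"
  shows "AE x in lborel. convolve h (convolve e u) x = convolve (convolve h e) u x"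
proof -
  have [measurable]: "h \<in> borel_measurable borel" "u \<in> borel_measurable borel" "e \<in> borel_measurable borel"
    using Lp_leD h e u by auto
  \<comment> \<open>\<open>W'\<close> is a version of \<open>\<bar>e\<bar> * \<bar>u\<bar>\<close> with finite values, so that Young's inequality can be applied
    to it in turn; the two differ on a null set only.\<close>
  define W where "W = abs_convolve e u"
  define W' where "W' x = complex_of_real (enn2real (W x))" for x
  have W: "AE x in lborel. W x < top" "Lp_le p W' (B * C)"
    using Young_abs_convolve[OF p e u] by (simp_all add: W_def W'_def[abs_def])
  have [measurable]: "W \<in> borel_measurable borel" unfolding W_def by measurable
  show ?thesis using Young_abs_convolve(1)[OF p h W(2)]
  proof eventually_elim
    case (elim x)
    define k where "k y w = h y * e (w - y) * u (x - w)" for y w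
    have [measurable]: "(\<lambda>(y, w). k y w) \<in> borel_measurable (lborel \<Otimes>\<^sub>M lborel)"
      unfolding k_def by measurable
    have shift: "(\<integral>\<^sup>+w. ennreal (cmod (k y w)) \<partial>lborel) = ennreal (cmod (h y)) * W (x - y)" for y
    proof -
      have "(\<integral>\<^sup>+w. ennreal (cmod (k y w)) \<partial>lborel) = 
        (\<integral>\<^sup>+w. ennreal (cmod (h y)) * ennreal (cmod (e (w - y) * u (x - y - (w - y)))) \<partial>lborel)"
        by (simp add: k_def norm_mult ennreal_mult mult.assoc)
      also have "\<dots> = ennreal (cmod (h y)) * (\<integral>\<^sup>+w. ennreal (cmod (e (w - y) * u (x - y - (w - y)))) \<partial>lborel)"
        by (rule nn_integral_cmult) measurable
      also have "(\<integral>\<^sup>+w. ennreal (cmod (e (w - y) * u (x - y - (w - y)))) \<partial>lborel) = W (x - y)"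
        unfolding W_def abs_convolve_def 
        by (rule nn_integral_lborel_shift[where f="\<lambda>z. ennreal (cmod (e z * u (x - y - z)))"]) measurable
      finally show ?thesis .
    qed
    have "(\<integral>\<^sup>+z. ennreal (norm (case z of (y, w) \<Rightarrow> k y w)) \<partial>(lborel \<Otimes>\<^sub>M lborel)) =
       (\<integral>\<^sup>+y. (\<integral>\<^sup>+w. ennreal (cmod (k y w)) \<partial>lborel) \<partial>lborel)"
      by (subst lborel.nn_integral_fst[symmetric]) auto
    also have "\<dots> = (\<integral>\<^sup>+y. ennreal (cmod (h y)) * W (x - y) \<partial>lborel)" by (simp add: shift)
    also have "\<dots> = abs_convolve h W' x"
      unfolding abs_convolve_def
    proof (rule nn_integral_cong_AE)
      show "AE y in lborel. ennreal (cmod (h y)) * W (x - y) = ennreal (cmod (h y * W' (x - y)))"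
        using AE_lborel_reflect[OF W(1), of x]
        by eventually_elim (simp add: W'_def norm_mult ennreal_mult)
    qed
    finally have int: "integrable (lborel \<Otimes>\<^sub>M lborel) (\<lambda>(y, w). k y w)"
      using elim by (intro integrableI_bounded) auto
    have "convolve h (convolve e u) x = (LINT y|lborel. (LINT w|lborel. k y w))"
      unfolding convolve_def
    proof (rule Bochner_Integration.integral_cong[OF refl])
      fix y
      have "(LINT w|lborel. k y w) = h y * (LINT w|lborel. e (w - y) * u (x - y - (w - y)))"
        by (simp add: k_def mult.assoc)
      also have "(LINT w|lborel. e (w - y) * u (x - y - (w - y))) = (LINT z|lborel. e z * u (x - y - z))"
        by (rule integral_lborel_shift[where f="\<lambda>z. e z * u (x - y - z)"]) measurable
      finally show "h y * (LINT z|lborel. e z * u (x - y - z)) = (LINT w|lborel. k y w)" by simp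
    qed
    also have "\<dots> = (LINT w|lborel. (LINT y|lborel. k y w))"
      by (rule lborel_pair.Fubini_integral[OF int, symmetric])
    also have "\<dots> = convolve (convolve h e) u x"
      by (simp add: k_def convolve_def)
    finally show ?case .
  qed
qed

text \<open>Convolution with \<open>h\<close> is the transpose of convolution with the reflection of \<open>h\<close>. The substitution
\<open>w = x - y\<close> turns the integrand into \<open>h(x - w) u(w) \<phi>(x)\<close>, for which one exchange of integrals suffices.\<close>

lemma convolve_adjoint:
  fixes h u \<phi> :: "real^'n \<Rightarrow> complex"
  assumes pq: "conjugate p q" and h: "Lp_le 1 h A" and u: "Lp_le p u C" and \<phi>: "Lp_le q \<phi> D"
  shows "(LINT x|lborel. convolve h u x * \<phi> x) = (LINT x|lborel. u x * convolve (\<lambda>y. h (- y)) \<phi> x)"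
proof -
  have [measurable]: "h \<in> borel_measurable borel" "u \<in> borel_measurable borel" "\<phi> \<in> borel_measurable borel"
    using Lp_leD h \<phi> u by auto
  define k where "k x w = h (x - w) * u w * \<phi> x" for x w
  have [measurable]: "(\<lambda>(x, w). k x w) \<in> borel_measurable (lborel \<Otimes>\<^sub>M lborel)"
    unfolding k_def by measurable
  define W where "W = abs_convolve h u"
  define W' where "W' x = complex_of_real (enn2real (W x))" for x
  have W: "AE x in lborel. W x < top" "Lp_le p W' (A * C)"
    using Young_abs_convolve[OF conjugate_ge1(1)[OF pq] h u] by (simp_all add: W_def W'_def[abs_def])
  have reflect: "(\<integral>\<^sup>+w. ennreal (cmod (k x w)) \<partial>lborel) = W x * ennreal (cmod (\<phi> x))" for x
  proof -
    have "(\<integral>\<^sup>+w. ennreal (cmod (k x w)) \<partial>lborel) = 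
      (\<integral>\<^sup>+w. ennreal (cmod (h (x - w) * u (x - (x - w)))) * ennreal (cmod (\<phi> x)) \<partial>lborel)"
      by (simp add: k_def norm_mult ennreal_mult)
    also have "\<dots> = (\<integral>\<^sup>+w. ennreal (cmod (h (x - w) * u (x - (x - w)))) \<partial>lborel) * ennreal (cmod (\<phi> x))"
      by (rule nn_integral_multc) measurable
    also have "(\<integral>\<^sup>+w. ennreal (cmod (h (x - w) * u (x - (x - w)))) \<partial>lborel) = W x"
      unfolding W_def abs_convolve_def
      by (rule nn_integral_lborel_reflect[where f="\<lambda>y. ennreal (cmod (h y * u (x - y)))"]) measurable
    finally show ?thesis .
  qed
  have "(\<integral>\<^sup>+z. ennreal (norm (case z of (x, w) \<Rightarrow> k x w)) \<partial>(lborel \<Otimes>\<^sub>M lborel)) =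
     (\<integral>\<^sup>+x. (\<integral>\<^sup>+w. ennreal (cmod (k x w)) \<partial>lborel) \<partial>lborel)"
    by (subst lborel.nn_integral_fst[symmetric]) auto
  also have "\<dots> = (\<integral>\<^sup>+x. ennreal (cmod (W' x * \<phi> x)) \<partial>lborel)"
    unfolding reflect
  proof (rule nn_integral_cong_AE)
    show "AE x in lborel. W x * ennreal (cmod (\<phi> x)) = ennreal (cmod (W' x * \<phi> x))"
      using W(1) by eventually_elim (simp add: W'_def norm_mult ennreal_mult)
  qed
  also have "\<dots> \<le> ennreal (A * C * D)" by (rule Hoelder[OF pq W(2) \<phi>])
  also have "\<dots> < top" by simp
  finally have int: "integrable (lborel \<Otimes>\<^sub>M lborel) (\<lambda>(x, w). k x w)"
    by (intro integrableI_bounded) auto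
  have "(LINT x|lborel. convolve h u x * \<phi> x) = (LINT x|lborel. (LINT w|lborel. k x w))"
  proof (rule Bochner_Integration.integral_cong[OF refl])
    fix x
    have "convolve h u x = (LINT w|lborel. h (x - w) * u (x - (x - w)))"
      unfolding convolve_def
      by (rule integral_lborel_reflect[where f="\<lambda>y. h y * u (x - y)", symmetric]) measurable
    then show "convolve h u x * \<phi> x = (LINT w|lborel. k x w)" by (simp add: k_def)
  qed
  also have "\<dots> = (LINT w|lborel. (LINT x|lborel. k x w))"
    by (rule lborel_pair.Fubini_integral[OF int, symmetric])
  also have "\<dots> = (LINT w|lborel. u w * convolve (\<lambda>y. h (- y)) \<phi> w)"
  proof (rule Bochner_Integration.integral_cong[OF refl])
    fix w
    have "convolve (\<lambda>y. h (- y)) \<phi> w = (LINT x|lborel. h (- (w - x)) * \<phi> (w - (w - x)))"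
      unfolding convolve_def
      by (rule integral_lborel_reflect[where f="\<lambda>y. h (- y) * \<phi> (w - y)", symmetric]) measurable
    moreover have "(LINT x|lborel. k x w) = (LINT x|lborel. u w * (h (x - w) * \<phi> x))"
      by (simp add: k_def ac_simps)
    ultimately show "(LINT x|lborel. k x w) = u w * convolve (\<lambda>y. h (- y)) \<phi> w" by simp
  qed
  finally show ?thesis .
qed

lemma Lp_le_1_uminus: assumes "Lp_le 1 h A" shows "Lp_le 1 (\<lambda>y. h (- y)) A"
proof -
  have [measurable]: "h \<in> borel_measurable borel" using Lp_leD assms by auto
  show ?thesis using assms nn_integral_lborel_reflect[of "\<lambda>y. ennreal (cmod (h y))" 0]
    by (simp add: Lp_le_1)
qed

section \<open>Duality\<close>

lemma borel_measurable_cnj_sgn [measurable]: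
  assumes [measurable]: "f \<in> borel_measurable M"
  shows "(\<lambda>x. cnj (sgn (f x))) \<in> borel_measurable M"
proof -
  have [measurable]: "cnj \<in> borel_measurable borel"
    by (intro borel_measurable_continuous_onI continuous_intros)
  show ?thesis unfolding sgn_div_norm by measurable
qed

lemma mult_cnj_sgn: "z * cnj (sgn z) = complex_of_real (cmod z)"
proof (cases "z = 0")
  case False
  have "z * cnj (sgn z) = (z * cnj z) / complex_of_real (cmod z)"
    by (simp add: sgn_div_norm scaleR_conv_of_real field_simps)
  also have "\<dots> = complex_of_real (cmod z)"
    using False by (simp add: complex_norm_square[symmetric] power2_eq_square)
  finally show ?thesis .
qed simp

text \<open>If \<open>\<bar>w\<bar>\<close> exceeded \<open>B\<close> by some \<open>1/(n+1)\<close> on a set of positive measure, testing against the normalised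
conjugate phase of \<open>w\<close> on that set would contradict the hypothesis. Intersecting with a ball makes
the measure finite.\<close>

lemma Lp_le_top_of_pairing:
  fixes w :: "real^'n \<Rightarrow> complex"
  assumes w: "Lp_le top w C" and B: "0 \<le> B"
    and dual: "\<And>\<phi>. Lp_le 1 \<phi> 1 \<Longrightarrow> cmod (LINT x|lborel. w x * \<phi> x) \<le> B"
  shows "Lp_le top w B"
proof -
  have [measurable]: "w \<in> borel_measurable borel" using Lp_leD[OF w] by simp
  define A where "A n = {x. B + 1 / Suc n < cmod (w x)} \<inter> cball 0 (real n)" for n
  have [measurable]: "A n \<in> sets borel" for n unfolding A_def by measurable
  have null: "emeasure lborel (A n) = 0" for n
  proof (rule ccontr)
    assume ne: "emeasure lborel (A n) \<noteq> 0"
    have fin: "emeasure lborel (A n) < \<infinity>"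
      by (rule emeasure_bounded_finite) (auto simp: A_def)
    define m where "m = measure lborel (A n)"
    have em: "emeasure lborel (A n) = ennreal m" using fin by (simp add: m_def emeasure_eq_ennreal_measure)
    have m: "0 < m" using ne em zero_less_measure_iff[of lborel "A n"] by (auto simp: m_def)
    define \<phi> where "\<phi> x = indicator (A n) x * cnj (sgn (w x)) / complex_of_real m" for x
    have [measurable]: "\<phi> \<in> borel_measurable borel" unfolding \<phi>_def by measurable
    have "(\<integral>\<^sup>+x. ennreal (cmod (\<phi> x)) \<partial>lborel) \<le> (\<integral>\<^sup>+x. ennreal (1/m) * indicator (A n) x \<partial>lborel)"
      using m by (intro nn_integral_mono) 
        (simp add: \<phi>_def norm_divide norm_mult norm_sgn ennreal_leI split: split_indicator)
    also have "\<dots> = ennreal (1/m) * ennreal m" using em by (simp add: nn_integral_cmult_indicator)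
    also have "\<dots> = 1" using m by (simp add: ennreal_mult[symmetric])
    finally have \<phi>: "Lp_le 1 \<phi> 1" by (simp add: Lp_le_1)
    have pt: "w x * \<phi> x = complex_of_real (indicator (A n) x * cmod (w x) / m)" for x
      using mult_cnj_sgn[of "w x"] by (simp add: \<phi>_def split: split_indicator)
    have int: "integrable lborel (\<lambda>x. indicator (A n) x * cmod (w x) / m)"
    proof -
      have "integrable lborel (\<lambda>x. w x * \<phi> x)" 
        by (rule Hoelder_integrable(1)[OF _ w \<phi>]) (simp add: conjugate_def)
      then show ?thesis by (simp add: pt complex_of_real_integrable_eq del: of_real_mult of_real_divide)
    qed
    have "(B + 1 / Suc n) = (LINT x|lborel. (B + 1/Suc n) / m * indicator (A n) x)"
      using m by (simp add: m_def)
    also have "\<dots> \<le> (LINT x|lborel. indicator (A n) x * cmod (w x) / m)"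
      using m fin by (intro integral_mono int) 
        (auto simp: A_def divide_right_mono split: split_indicator)
    also have "\<dots> \<le> cmod (LINT x|lborel. w x * \<phi> x)"
      unfolding pt integral_complex_of_real norm_of_real by (rule abs_ge_self)
    also have "\<dots> \<le> B" by (rule dual[OF \<phi>])
    finally show False by simp
  qed
  have "AE x in lborel. \<forall>n. x \<notin> A n"
    unfolding AE_all_countable using null by (auto intro!: AE_not_in null_setsI)
  then have "AE x in lborel. cmod (w x) \<le> B"
  proof eventually_elim
    case (elim x)
    show ?case
    proof (rule ccontr)
      assume "\<not> ?thesis"
      then obtain n where n: "1 / real (Suc n) < cmod (w x) - B"
        using reals_Archimedean[of "cmod (w x) - B"] by (auto simp: inverse_eq_divide)
      obtain k where k: "norm x \<le> real k" using real_arch_simple by blast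
      have "1 / real (Suc (max n k)) \<le> 1 / real (Suc n)" by (simp add: frac_le)
      then have "x \<in> A (max n k)" using n k by (auto simp: A_def)
      then show False using elim by blast
    qed
  qed
  then show ?thesis using B by (simp add: Lp_le_top)
qed

text \<open>The extremal function in Hoelder's inequality, the conjugate phase of \<open>w\<close> times \<open>\<bar>w\<bar>\<^sup>r\<^sup>-\<^sup>1\<close>, is used as
a test function.\<close>

lemma Lp_le_real_of_pairing:
  fixes w :: "real^'n \<Rightarrow> complex"
  assumes r: "1 < r" "1 < s" "1/r + 1/s = 1" and w: "Lp_le (ennreal r) w C" and B: "0 \<le> B"
    and dual: "\<And>\<phi>. Lp_le (ennreal s) \<phi> 1 \<Longrightarrow> cmod (LINT x|lborel. w x * \<phi> x) \<le> B"
  shows "Lp_le (ennreal r) w B"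
proof -
  have [measurable]: "w \<in> borel_measurable borel" using Lp_leD[OF w] by simp
  have "(\<integral>\<^sup>+x. ennreal (cmod (w x) powr r) \<partial>lborel) \<le> ennreal (C powr r)"
    using w r by (simp add: Lp_le_real)
  then have "(\<integral>\<^sup>+x. ennreal (cmod (w x) powr r) \<partial>lborel) < top" by (rule le_less_trans) simp
  then obtain I where I: "(\<integral>\<^sup>+x. ennreal (cmod (w x) powr r) \<partial>lborel) = ennreal I" "0 \<le> I"
    by (cases "(\<integral>\<^sup>+x. ennreal (cmod (w x) powr r) \<partial>lborel)") auto
  have "I \<le> B powr r"
  proof (cases "I = 0")
    case False
    with I have pos: "0 < I" by simp
    define \<phi> where "\<phi> x = cnj (sgn (w x)) * complex_of_real (cmod (w x) powr (r - 1) / I powr (1/s))" for x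
    have [measurable]: "\<phi> \<in> borel_measurable borel" unfolding \<phi>_def by measurable
    have rs: "(r - 1) * s = r" using r by (simp add: field_simps)
    have "cmod (\<phi> x) powr s = cmod (w x) powr r / I" for x
    proof (cases "w x = 0")
      case True then show ?thesis using r by (simp add: \<phi>_def)
    next
      case False
      then have "cmod (\<phi> x) = cmod (w x) powr (r - 1) / I powr (1/s)"
        by (simp add: \<phi>_def norm_mult norm_divide norm_sgn)
      then show ?thesis using pos r rs by (simp add: powr_divide powr_powr)
    qed
    then have "(\<integral>\<^sup>+x. ennreal (cmod (\<phi> x) powr s) \<partial>lborel) =
       (\<integral>\<^sup>+x. ennreal (1/I) * ennreal (cmod (w x) powr r) \<partial>lborel)"
      using pos by (simp add: ennreal_mult[symmetric])
    also have "\<dots> = ennreal (1/I) * ennreal I" using I by (simp add: nn_integral_cmult)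
    also have "\<dots> = 1" using pos by (simp add: ennreal_mult[symmetric])
    finally have \<phi>: "Lp_le (ennreal s) \<phi> 1" using r by (simp add: Lp_le_real)
    have pt: "w x * \<phi> x = complex_of_real (cmod (w x) powr r / I powr (1/s))" for x
    proof (cases "w x = 0")
      case False
      note mult_cnj_sgn[of "w x"]
      moreover have "cmod (w x) * cmod (w x) powr (r - 1) = cmod (w x) powr r"
        using False by (simp add: powr_diff)
      ultimately show ?thesis unfolding \<phi>_def 
        by (metis (no_types, opaque_lifting) mult.assoc of_real_mult times_divide_eq_right)
    qed (use r in \<open>auto simp: \<phi>_def\<close>)
    have "(LINT x|lborel. cmod (w x) powr r) = I"
      using I by (subst integral_eq_nn_integral) auto
    then have "(LINT x|lborel. w x * \<phi> x) = complex_of_real (I / I powr (1/s))"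
      unfolding pt by (simp del: of_real_divide)
    then have "I / I powr (1/s) \<le> B" using dual[OF \<phi>] pos by (simp del: of_real_divide)
    moreover have "I / I powr (1/s) = I powr (1 - 1/s)" using pos by (simp add: powr_diff)
    moreover have "1 - 1/s = 1/r" using r by simp
    ultimately have "I powr (1/r) \<le> B" by simp
    then have "(I powr (1/r)) powr r \<le> B powr r" using r by (intro powr_mono2) auto
    then show ?thesis using pos r by (simp add: powr_powr)
  qed simp
  then show ?thesis using I B r by (simp add: Lp_le_real ennreal_leI)
qed

lemma Lp_le_of_pairing:
  assumes "conjugate p q" "1 < p" "Lp_le p w C" "0 \<le> B"
    "\<And>\<phi>. Lp_le q \<phi> 1 \<Longrightarrow> cmod (LINT x|lborel. w x * \<phi> x) \<le> B"
  shows "Lp_le p w B"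
  using assms Lp_le_top_of_pairing[of w C B] Lp_le_real_of_pairing[of _ _ w C B]
  unfolding conjugate_def by auto

section \<open>Absolutely convergent series\<close>

text \<open>The Riesz-Fischer argument: the partial sums of \<open>\<Sum>\<bar>g\<^sub>k\<bar>\<close> have bounded norms, so by monotone convergence
the series converges absolutely almost everywhere, and the tails are estimated with Fatou's lemma.\<close>

lemma Lp_le_suminf:
  fixes g :: "nat \<Rightarrow> real^'n \<Rightarrow> complex"
  assumes r: "1 \<le> r" and g: "\<And>k. Lp_le (ennreal r) (g k) (a k)" and a: "summable a"
  shows "AE x in lborel. summable (\<lambda>k. cmod (g k x))"
    and "Lp_le (ennreal r) (\<lambda>x. (\<Sum>k. g k x) - (\<Sum>k<m. g k x)) (\<Sum>k. a (k + m))"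
proof -
  have r1: "1 \<le> ennreal r" using r by simp
  have [measurable]: "g k \<in> borel_measurable borel" and apos: "0 \<le> a k" for k using Lp_leD[OF g] by auto
  define S where "S n x = (\<Sum>k<n. cmod (g k x))" for n x
  have [measurable]: "S n \<in> borel_measurable borel" for n unfolding S_def by measurable
  have Spos: "0 \<le> S n x" for n x by (auto simp: S_def intro: sum_nonneg)
  have SL: "Lp_le (ennreal r) (\<lambda>x. \<Sum>k<n. complex_of_real (cmod (g k x))) (\<Sum>k<n. a k)" for n
    by (intro Lp_le_sum r1 finite_lessThan Lp_le_AE_mono[OF r1 g]) auto
  have le: "(\<integral>\<^sup>+x. ennreal (S n x powr r) \<partial>lborel) \<le> ennreal (suminf a powr r)" for n
  proof -
    have "(\<Sum>k<n. complex_of_real (cmod (g k x))) = of_real (S n x)" for x by (simp add: S_def)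
    then have "(\<integral>\<^sup>+x. ennreal (S n x powr r) \<partial>lborel) \<le> ennreal ((\<Sum>k<n. a k) powr r)"
      using SL[of n] r Spos by (simp add: Lp_le_real)
    also have "\<dots> \<le> ennreal (suminf a powr r)"
      using r apos by (intro ennreal_leI powr_mono2 sum_le_suminf a sum_nonneg) auto
    finally show ?thesis .
  qed
  have "(\<integral>\<^sup>+x. (SUP n. ennreal (S n x powr r)) \<partial>lborel) = (SUP n. \<integral>\<^sup>+x. ennreal (S n x powr r) \<partial>lborel)"
    using r Spos by (intro nn_integral_monotone_convergence_SUP)
      (auto simp: incseq_def le_fun_def S_def intro!: ennreal_leI powr_mono2 sum_mono2 sum_nonneg)
  also have "\<dots> \<le> ennreal (suminf a powr r)" using le by (rule SUP_least)
  finally have "(\<integral>\<^sup>+x. (SUP n. ennreal (S n x powr r)) \<partial>lborel) \<noteq> \<infinity>"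
    by (auto simp: top_unique)
  then have "AE x in lborel. (SUP n. ennreal (S n x powr r)) \<noteq> \<infinity>"
    by (intro nn_integral_PInf_AE) auto
  then show summ: "AE x in lborel. summable (\<lambda>k. cmod (g k x))"
  proof eventually_elim
    case (elim x)
    then obtain b where b: "(SUP n. ennreal (S n x powr r)) = ennreal b" "0 \<le> b"
      by (cases "(SUP n. ennreal (S n x powr r))") auto
    have "S n x \<le> b powr (1/r)" for n
    proof -
      have "ennreal (S n x powr r) \<le> ennreal b" unfolding b(1)[symmetric] by (rule SUP_upper) simp
      then have "S n x powr r \<le> b" using b by simp
      then have "(S n x powr r) powr (1/r) \<le> b powr (1/r)" using r by (intro powr_mono2) auto
      then show ?thesis using r Spos by (simp add: powr_powr)
    qed
    then show ?case unfolding S_def by (intro summableI_nonneg_bounded[where x="b powr (1/r)"]) auto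
  qed
  show "Lp_le (ennreal r) (\<lambda>x. (\<Sum>k. g k x) - (\<Sum>k<m. g k x)) (\<Sum>k. a (k + m))"
  proof (rule Lp_le_Fatou[OF r1, where f="\<lambda>n x. \<Sum>k<n. g (k + m) x"])
    fix n
    have "Lp_le (ennreal r) (\<lambda>x. \<Sum>k<n. g (k + m) x) (\<Sum>k<n. a (k + m))"
      by (intro Lp_le_sum r1 finite_lessThan g)
    then show "Lp_le (ennreal r) (\<lambda>x. \<Sum>k<n. g (k + m) x) (\<Sum>k. a (k + m))"
      by (rule Lp_le_mono_bound[OF r1]) (use a apos in \<open>auto intro!: sum_le_suminf simp: summable_iff_shift\<close>)
  next
    show "AE x in lborel. (\<lambda>n. \<Sum>k<n. g (k + m) x) \<longlonglongrightarrow> (\<Sum>k. g k x) - (\<Sum>k<m. g k x)"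
      using summ
    proof eventually_elim
      case (elim x)
      then have s: "summable (\<lambda>k. g k x)" by (rule summable_norm_cancel)
      have "(\<lambda>n. \<Sum>k<n. g (k + m) x) \<longlonglongrightarrow> (\<Sum>k. g (k + m) x)"
        by (intro summable_LIMSEQ summable_ignore_initial_segment s)
      then show ?case using suminf_minus_initial_segment[OF s, of m] by simp
    qed
  qed measurable
qed

section \<open>Mollification by an approximate identity\<close>

text \<open>Dominated convergence; this is where \<open>p = \<infinity>\<close> has to be excluded.\<close>

lemma Lp_le_vanishing:
  fixes f :: "real^'n \<Rightarrow> complex"
  assumes r: "1 \<le> r" and f: "Lp_le (ennreal r) f C" and [measurable]: "\<And>n. A n \<in> sets borel"
    and van: "\<And>x. \<forall>\<^sub>F n in sequentially. x \<notin> A n" and "0 < \<epsilon>"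
  shows "\<forall>\<^sub>F n in sequentially. Lp_le (ennreal r) (\<lambda>x. indicator (A n) x * f x) \<epsilon>"
proof -
  have [measurable]: "f \<in> borel_measurable borel" using Lp_leD[OF f] by simp
  have fin: "(\<integral>\<^sup>+x. ennreal (cmod (f x) powr r) \<partial>lborel) < top"
    using f r by (auto simp: Lp_le_real intro: le_less_trans[OF _ ennreal_less_top])
  have "(\<lambda>n. \<integral>\<^sup>+x. ennreal (cmod (indicator (A n) x * f x) powr r) \<partial>lborel) \<longlonglongrightarrow> (\<integral>\<^sup>+x. 0 \<partial>(lborel :: (real^'n) measure))"
  proof (rule nn_integral_dominated_convergence[where w="\<lambda>x. ennreal (cmod (f x) powr r)"])
    show "AE x in lborel. (\<lambda>n. ennreal (cmod (indicator (A n) x * f x) powr r)) \<longlonglongrightarrow> 0"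
    proof (rule AE_I2)
      fix x
      have "\<forall>\<^sub>F n in sequentially. ennreal (cmod (indicator (A n) x * f x) powr r) = 0"
        using van[of x] by eventually_elim simp
      then show "(\<lambda>n. ennreal (cmod (indicator (A n) x * f x) powr r)) \<longlonglongrightarrow> 0"
        by (rule tendsto_eventually)
    qed
    show "AE x in lborel. ennreal (cmod (indicator (A j) x * f x) powr r) \<le> ennreal (cmod (f x) powr r)" for j
      by (auto split: split_indicator)
  qed (use fin in auto)
  then have "(\<lambda>n. \<integral>\<^sup>+x. ennreal (cmod (indicator (A n) x * f x) powr r) \<partial>lborel) \<longlonglongrightarrow> 0"
    by simp
  moreover have "0 < ennreal (\<epsilon> powr r)" using \<open>0 < \<epsilon>\<close> by simp
  ultimately have "\<forall>\<^sub>F n in sequentially. (\<integral>\<^sup>+x. ennreal (cmod (indicator (A n) x * f x) powr r) \<partial>lborel) < ennreal (\<epsilon> powr r)"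
    by (rule order_tendstoD(2))
  then show ?thesis
    by eventually_elim (use \<open>0 < \<epsilon>\<close> r in \<open>auto simp: Lp_le_real\<close>)
qed

text \<open>The mollifiers are normalised tents on shrinking balls. Lipschitz continuity, which indicators of balls
lack, is what makes mollified functions equicontinuous even when they only have an \<open>L\<^sup>1\<close> bound.\<close>

definition tent :: "nat \<Rightarrow> real^'n \<Rightarrow> real" where
  "tent j x = max 0 (1 - real (Suc j) * norm x)"

definition mollifier :: "nat \<Rightarrow> real^'n \<Rightarrow> complex" where
  "mollifier j x = complex_of_real (tent j x / (LINT y|lborel. tent j (y :: real^'n)))"

lemma measurable_tent [measurable]: "tent j \<in> borel_measurable borel"
  unfolding tent_def by measurable

lemma tent_nonneg [simp]: "0 \<le> tent j x" by (simp add: tent_def)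

lemma tent_le_1: "tent j x \<le> 1" by (simp add: tent_def)

lemma tent_minus [simp]: "tent j (- x) = tent j x" by (simp add: tent_def)

lemma tent_eq_0: "1 \<le> real (Suc j) * norm x \<Longrightarrow> tent j x = 0" by (simp add: tent_def)

lemma tent_Lipschitz: "\<bar>tent j x - tent j y\<bar> \<le> real (Suc j) * norm (x - y)"
proof -
  have "\<bar>tent j x - tent j y\<bar> \<le> \<bar>real (Suc j) * norm x - real (Suc j) * norm y\<bar>"
    unfolding tent_def by linarith
  also have "\<dots> = real (Suc j) * \<bar>norm x - norm y\<bar>"
    by (simp only: right_diff_distrib[symmetric] abs_mult abs_of_nat)
  also have "\<dots> \<le> real (Suc j) * norm (x - y)"
    by (intro mult_left_mono norm_triangle_ineq3) auto
  finally show ?thesis .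
qed

lemma tent_integrable [simp]: "integrable lborel (tent j :: real^'n \<Rightarrow> real)"
proof (rule Bochner_Integration.integrable_bound)
  show "integrable lborel (indicator (cball 0 1) :: real^'n \<Rightarrow> real)"
    by (intro integrable_real_indicator emeasure_bounded_finite) auto
  show "AE x in lborel. norm (tent j (x :: real^'n)) \<le> norm (indicator (cball 0 1) x :: real)"
  proof (rule AE_I2)
    fix x :: "real^'n"
    have "tent j x = 0" if "1 < norm x"
    proof (rule tent_eq_0)
      have "1 * 1 \<le> real (Suc j) * norm x" using that by (intro mult_mono) auto
      then show "1 \<le> real (Suc j) * norm x" by simp
    qed
    then show "norm (tent j x :: real) \<le> norm (indicator (cball 0 1) x :: real)"
      using tent_le_1[of j x] by (auto split: split_indicator simp: not_le)
  qed
qed measurable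

lemma tent_integral_pos: "0 < (LINT y|lborel. tent j (y :: real^'n))"
proof -
  define r where "r = 1 / (2 * real (Suc j))"
  have r: "0 < r" by (simp add: r_def)
  have "0 < 1/2 * measure lborel (ball (0 :: real^'n) r)" using content_ball_pos[OF r] by simp
  also have "\<dots> = (LINT y|lborel. 1/2 * indicator (ball (0 :: real^'n) r) y)" by simp
  also have "\<dots> \<le> (LINT y|lborel. tent j (y :: real^'n))"
  proof (rule integral_mono)
    show "integrable lborel (\<lambda>y. 1 / 2 * indicat_real (ball (0 :: real^'n) r) y)"
      by (intro integrable_mult_right integrable_real_indicator emeasure_bounded_finite) auto
    show "1 / 2 * indicator (ball 0 r) y \<le> tent j y" for y :: "real^'n"
    proof (cases "norm y < r")
      case True
      then have "real (Suc j) * norm y \<le> real (Suc j) * r" by (intro mult_left_mono) auto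
      also have "\<dots> = 1/2" by (simp add: r_def)
      finally show ?thesis by (simp add: tent_def split: split_indicator)
    qed (simp split: split_indicator)
  qed simp
  finally show ?thesis .
qed

lemma measurable_mollifier [measurable]: "mollifier j \<in> borel_measurable borel"
  unfolding mollifier_def by measurable

lemma mollifier_minus [simp]: "mollifier j (- x) = mollifier j x"
  by (simp add: mollifier_def)

lemma cmod_mollifier: "cmod (mollifier j (x :: real^'n)) = tent j x / (LINT y|lborel. tent j (y :: real^'n))"
  using tent_integral_pos[where 'n='n, of j] by (simp add: mollifier_def norm_divide)

lemma nn_integral_mollifier: "(\<integral>\<^sup>+x. ennreal (cmod (mollifier j (x :: real^'n))) \<partial>lborel) = 1"
proof -
  define c where "c = (LINT y|lborel. tent j (y :: real^'n))"
  have c: "0 < c" using tent_integral_pos by (simp add: c_def)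
  have "(\<integral>\<^sup>+x. ennreal (tent j (x :: real^'n)) \<partial>lborel) = ennreal c"
    unfolding c_def by (rule nn_integral_eq_integral) auto
  moreover have "(\<integral>\<^sup>+x. ennreal (cmod (mollifier j (x :: real^'n))) \<partial>lborel) =
     (\<integral>\<^sup>+x. ennreal (1/c) * ennreal (tent j (x :: real^'n)) \<partial>lborel)"
    using c by (simp add: cmod_mollifier c_def ennreal_mult[symmetric])
  moreover have "\<dots> = ennreal (1/c) * (\<integral>\<^sup>+x. ennreal (tent j (x :: real^'n)) \<partial>lborel)"
    by (rule nn_integral_cmult) measurable
  ultimately have "(\<integral>\<^sup>+x. ennreal (cmod (mollifier j (x :: real^'n))) \<partial>lborel) = ennreal (1/c) * ennreal c"
    by simp
  then show ?thesis using c by (simp add: ennreal_mult[symmetric])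
qed

lemma Lp_le_mollifier: "Lp_le 1 (mollifier j) 1"
  by (simp add: Lp_le_1 nn_integral_mollifier)

definition mollifies :: "ennreal \<Rightarrow> (real^'n \<Rightarrow> complex) \<Rightarrow> bool" where
  "mollifies p f \<longleftrightarrow>
    (\<forall>\<epsilon>>0. \<forall>\<^sub>F j in sequentially. Lp_le p (\<lambda>x. convolve (mollifier j) f x - f x) \<epsilon>)"

text \<open>Convolution with a mollifier does not increase the norm, hence the functions that are approximated by
their mollifications form a closed set.\<close>

lemma mollifies_lim:
  assumes p: "1 \<le> p" and f: "Lp_le p f C"
    and approx: "\<And>\<epsilon>::real. 0 < \<epsilon> \<Longrightarrow> \<exists>g D. Lp_le p g D \<and> Lp_le p (\<lambda>x. f x - g x) \<epsilon> \<and> mollifies p g"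
  shows "mollifies p f"
  unfolding mollifies_def
proof (intro allI impI)
  fix \<epsilon> :: real assume "0 < \<epsilon>"
  then have "0 < \<epsilon> / 3" by simp
  from approx[OF this] obtain g D where g: "Lp_le p g D" "Lp_le p (\<lambda>x. f x - g x) (\<epsilon>/3)" "mollifies p g"
    by blast
  have [measurable]: "f \<in> borel_measurable borel" "g \<in> borel_measurable borel"
    using Lp_leD[OF f] Lp_leD[OF g(1)] by auto
  from g(3) \<open>0 < \<epsilon> / 3\<close> have "\<forall>\<^sub>F j in sequentially. Lp_le p (\<lambda>x. convolve (mollifier j) g x - g x) (\<epsilon>/3)"
    unfolding mollifies_def by blast
  then show "\<forall>\<^sub>F j in sequentially. Lp_le p (\<lambda>x. convolve (mollifier j) f x - f x) \<epsilon>"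
  proof eventually_elim
    case (elim j)
    have 1: "Lp_le p (convolve (mollifier j) (\<lambda>x. f x - g x)) (1 * (\<epsilon>/3))"
      by (rule Young[OF p Lp_le_mollifier g(2)])
    have 2: "Lp_le p (\<lambda>x. (-1) * (f x - g x)) (cmod (-1) * (\<epsilon>/3))"
      by (rule Lp_le_cmult[OF p g(2)])
    have "AE x in lborel. convolve (mollifier j) f x = convolve (mollifier j) (\<lambda>x. f x - g x) x + convolve (mollifier j) g x"
      using convolve_add_right_AE[OF p Lp_le_mollifier g(2) g(1), of j] by simp
    then have ae: "AE x in lborel. cmod (convolve (mollifier j) f x - f x) \<le>
      cmod ((convolve (mollifier j) (\<lambda>x. f x - g x) x + (convolve (mollifier j) g x - g x)) + (-1) * (f x - g x))"
      by eventually_elim (simp add: algebra_simps)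
    have "Lp_le p (\<lambda>x. convolve (mollifier j) f x - f x) (1 * (\<epsilon>/3) + \<epsilon>/3 + cmod (-1) * (\<epsilon>/3))"
      by (rule Lp_le_AE_mono[OF p Lp_le_add[OF p Lp_le_add[OF p 1 elim] 2] _ ae]) measurable
    then show ?case by simp
  qed
qed

lemma mollifies_cmult:
  assumes p: "1 \<le> p" and f: "mollifies p f"
  shows "mollifies p (\<lambda>x. c * f x)"
  unfolding mollifies_def
proof (intro allI impI)
  fix \<epsilon> :: real assume "0 < \<epsilon>"
  then have "0 < \<epsilon> / (1 + cmod c)" by (simp add: add_pos_nonneg)
  with f have "\<forall>\<^sub>F j in sequentially. Lp_le p (\<lambda>x. convolve (mollifier j) f x - f x) (\<epsilon> / (1 + cmod c))"
    unfolding mollifies_def by blast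
  then show "\<forall>\<^sub>F j in sequentially. Lp_le p (\<lambda>x. convolve (mollifier j) (\<lambda>x. c * f x) x - c * f x) \<epsilon>"
  proof eventually_elim
    case (elim j)
    have "convolve (mollifier j) (\<lambda>x. c * f x) x = c * convolve (mollifier j) f x" for x
    proof -
      have "convolve (mollifier j) (\<lambda>x. c * f x) x = (LINT y|lborel. c * (mollifier j y * f (x - y)))"
        by (simp add: convolve_def ac_simps)
      then show ?thesis by (simp add: convolve_def)
    qed
    then have eq: "(\<lambda>x. convolve (mollifier j) (\<lambda>x. c * f x) x - c * f x) = 
       (\<lambda>x. c * (convolve (mollifier j) f x - f x))" by (simp add: right_diff_distrib)
    have "cmod c * (\<epsilon> / (1 + cmod c)) \<le> \<epsilon>"
      using \<open>0 < \<epsilon>\<close> by (simp add: field_simps add_pos_nonneg)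
    then show ?case unfolding eq 
      by (rule Lp_le_mono_bound[OF p Lp_le_cmult[OF p elim]])
  qed
qed

lemma mollifies_add:
  assumes p: "1 \<le> p" and f: "Lp_le p f C" "mollifies p f" and g: "Lp_le p g D" "mollifies p g"
  shows "mollifies p (\<lambda>x. f x + g x)"
  unfolding mollifies_def
proof (intro allI impI)
  fix \<epsilon> :: real assume "0 < \<epsilon>"
  then have "0 < \<epsilon> / 2" by simp
  have [measurable]: "f \<in> borel_measurable borel" "g \<in> borel_measurable borel"
    using Lp_leD[OF f(1)] Lp_leD[OF g(1)] by auto
  from f(2) \<open>0 < \<epsilon> / 2\<close> have F: "\<forall>\<^sub>F j in sequentially. Lp_le p (\<lambda>x. convolve (mollifier j) f x - f x) (\<epsilon>/2)"
    unfolding mollifies_def by blast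
  from g(2) \<open>0 < \<epsilon> / 2\<close> have G: "\<forall>\<^sub>F j in sequentially. Lp_le p (\<lambda>x. convolve (mollifier j) g x - g x) (\<epsilon>/2)"
    unfolding mollifies_def by blast
  from F G show "\<forall>\<^sub>F j in sequentially. Lp_le p (\<lambda>x. convolve (mollifier j) (\<lambda>x. f x + g x) x - (f x + g x)) \<epsilon>"
  proof eventually_elim
    case (elim j)
    have ae: "AE x in lborel. cmod (convolve (mollifier j) (\<lambda>x. f x + g x) x - (f x + g x)) \<le>
       cmod ((convolve (mollifier j) f x - f x) + (convolve (mollifier j) g x - g x))"
      using convolve_add_right_AE[OF p Lp_le_mollifier f(1) g(1), of j]
      by eventually_elim (simp add: algebra_simps)
    have "Lp_le p (\<lambda>x. convolve (mollifier j) (\<lambda>x. f x + g x) x - (f x + g x)) (\<epsilon>/2 + \<epsilon>/2)"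
      by (rule Lp_le_AE_mono[OF p Lp_le_add[OF p elim] _ ae]) measurable
    then show ?case by simp
  qed
qed

lemma Lp_le_1_indicator:
  fixes A :: "(real^'n) set"
  assumes "A \<in> sets borel" "emeasure lborel A < top"
  shows "Lp_le 1 (indicator A) (measure lborel A)"
proof -
  have "ennreal (cmod (indicator A x)) = indicator A x" for x :: "real^'n"
    by (simp split: split_indicator)
  then show ?thesis using assms by (simp add: Lp_le_1 emeasure_eq_ennreal_measure)
qed

text \<open>Write \<open>v\<^sub>j\<close> for the mollification. As \<open>v\<^sub>j\<close> and the indicator of \<open>U\<close> have the same integral, the \<open>L\<^sup>1\<close>
distance is twice the integral of the positive part of \<open>1\<^sub>U - v\<^sub>j\<close>. That part is dominated by \<open>1\<^sub>U\<close> and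
vanishes at each point eventually, since \<open>v\<^sub>j(x) = 1\<close> as soon as the support of the mollifier fits into
\<open>U\<close> around \<open>x\<close>.\<close>

lemma mollifies_open:
  fixes U :: "(real^'n) set"
  assumes U: "open U" "emeasure lborel U < top"
  shows "mollifies 1 (indicator U)"
proof -
  have [measurable]: "U \<in> sets borel" using U by simp
  define m where "m j y = cmod (mollifier j y)" for j and y :: "real^'n"
  have [measurable]: "m j \<in> borel_measurable borel" for j unfolding m_def by measurable
  define v where "v j x = enn2real (\<integral>\<^sup>+y. ennreal (m j y * indicator U (x - y)) \<partial>lborel)" for j and x :: "real^'n"
  have fin: "(\<integral>\<^sup>+y. ennreal (m j y * indicator U (x - y)) \<partial>lborel) \<le> 1" for j x
  proof -
    have "(\<integral>\<^sup>+y. ennreal (m j y * indicator U (x - y)) \<partial>lborel) \<le> (\<integral>\<^sup>+y. ennreal (m j y) \<partial>lborel)"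
      by (intro nn_integral_mono ennreal_leI) (auto simp: m_def split: split_indicator)
    then show ?thesis by (simp add: m_def nn_integral_mollifier)
  qed
  have v_ennreal: "ennreal (v j x) = (\<integral>\<^sup>+y. ennreal (m j y * indicator U (x - y)) \<partial>lborel)" for j x
    unfolding v_def by (intro ennreal_enn2real le_less_trans[OF fin[of j x]]) simp
  have v01: "0 \<le> v j x" "v j x \<le> 1" for j x
    using fin by (auto simp: v_def intro: enn2real_leI)
  have [measurable]: "v j \<in> borel_measurable borel" for j unfolding v_def by measurable
  have conv_v: "convolve (mollifier j) (indicator U) x = complex_of_real (v j x)" for j x
  proof -
    have "mollifier j y = complex_of_real (m j y)" for y
      using tent_integral_pos[where 'n='n, of j] by (simp add: m_def cmod_mollifier) (simp add: mollifier_def)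
    then have "convolve (mollifier j) (indicator U) x = (LINT y|lborel. complex_of_real (m j y * indicator U (x - y)))"
      by (simp add: convolve_def of_real_indicator)
    also have "\<dots> = complex_of_real (LINT y|lborel. m j y * indicator U (x - y))"
      by (rule integral_complex_of_real)
    also have "(LINT y|lborel. m j y * indicator U (x - y)) = v j x"
      unfolding v_def by (rule integral_eq_nn_integral) (auto simp: m_def)
    finally show ?thesis .
  qed
  have intv: "(\<integral>\<^sup>+x. ennreal (v j x) \<partial>lborel) = emeasure lborel U" for j
  proof -
    have "(\<integral>\<^sup>+x. ennreal (v j x) \<partial>lborel) =
       (\<integral>\<^sup>+x. (\<integral>\<^sup>+y. ennreal (m j y) * indicator U (x - y) \<partial>lborel) \<partial>lborel)"
      unfolding v_ennreal by (intro nn_integral_cong) (simp split: split_indicator)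
    also have "\<dots> = (\<integral>\<^sup>+y. (\<integral>\<^sup>+x. ennreal (m j y) * indicator U (x - y) \<partial>lborel) \<partial>lborel)"
      by (rule lborel_pair.Fubini'[symmetric]) measurable
    also have "\<dots> = (\<integral>\<^sup>+y. ennreal (m j y) * emeasure lborel U \<partial>lborel)"
    proof (rule nn_integral_cong)
      fix y :: "real^'n"
      have "(\<integral>\<^sup>+x. ennreal (m j y) * indicator U (x - y) \<partial>lborel) = ennreal (m j y) * (\<integral>\<^sup>+x. indicator U (x - y) \<partial>lborel)"
        by (rule nn_integral_cmult) measurable
      also have "(\<integral>\<^sup>+x. indicator U (x - y) \<partial>lborel) = (\<integral>\<^sup>+x. indicator U x \<partial>lborel)"
        by (rule nn_integral_lborel_shift) measurable
      finally show "(\<integral>\<^sup>+x. ennreal (m j y) * indicator U (x - y) \<partial>lborel) = ennreal (m j y) * emeasure lborel U"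
        by simp
    qed
    also have "\<dots> = emeasure lborel U" by (simp add: nn_integral_multc m_def nn_integral_mollifier)
    finally show ?thesis .
  qed
  have iU: "integrable lborel (indicat_real U)" using U by simp
  have iv: "integrable lborel (v j)" for j
    using intv[of j] U v01 by (intro integrableI_nonneg) auto
  have Iv: "(LINT x|lborel. v j x) = measure lborel U" for j
    using intv[of j] U v01 by (subst integral_eq_nn_integral) (auto simp: measure_def)
  have lim: "(\<lambda>j. LINT x|lborel. max 0 (indicator U x - v j x)) \<longlonglongrightarrow> (LINT x|(lborel :: (real^'n) measure). 0)"
  proof (rule integral_dominated_convergence[where w="indicator U"])
    show "integrable lborel (indicat_real U)" by (rule iU)
    show "AE x in lborel. norm (max 0 (indicat_real U x - v j x)) \<le> indicat_real U x" for j
      using v01 by (auto split: split_indicator)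
    show "AE x in lborel. (\<lambda>j. max 0 (indicat_real U x - v j x)) \<longlonglongrightarrow> 0"
    proof (rule AE_I2)
      fix x :: "real^'n"
      show "(\<lambda>j. max 0 (indicat_real U x - v j x)) \<longlonglongrightarrow> 0"
      proof (cases "x \<in> U")
        case True
        then obtain d where d: "0 < d" "ball x d \<subseteq> U" using U(1) openE by blast
        obtain J where J: "1 / d \<le> real J" using real_arch_simple by blast
        have "max 0 (indicat_real U x - v j x) = 0" if "J \<le> j" for j
        proof -
          have "m j y * indicator U (x - y) = m j y" for y
          proof (cases "norm y < d")
            case True
            then have "x - y \<in> U" using d by (auto simp: dist_norm subset_iff)
            then show ?thesis by simp
          next
            case False
            have "1 \<le> real J * d" using J d by (simp add: field_simps)
            also have "\<dots> \<le> real (Suc j) * norm y" using False that d by (intro mult_mono) auto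
            finally have "tent j y = 0" by (rule tent_eq_0)
            then show ?thesis by (simp add: m_def mollifier_def)
          qed
          then have "v j x = enn2real (\<integral>\<^sup>+y. ennreal (m j y) \<partial>lborel)" by (simp only: v_def)
          then have "v j x = 1" by (simp add: m_def nn_integral_mollifier)
          then show ?thesis using True by simp
        qed
        then show ?thesis by (intro tendsto_eventually) (auto simp: eventually_sequentially)
      next
        case False
        then have "max 0 (indicat_real U x - v j x) = 0" for j using v01[of j x] by simp
        then show ?thesis by simp
      qed
    qed
  qed measurable
  have norm_eq: "(\<integral>\<^sup>+x. ennreal (cmod (convolve (mollifier j) (indicator U) x - indicator U x)) \<partial>lborel) =
     ennreal (2 * (LINT x|lborel. max 0 (indicator U x - v j x)))" for j
  proof -
    have pt: "cmod (convolve (mollifier j) (indicator U) x - indicator U x) =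
       (v j x - indicator U x) + 2 * max 0 (indicator U x - v j x)" for x
    proof -
      have "convolve (mollifier j) (indicator U) x - indicator U x = complex_of_real (v j x - indicator U x)"
        by (simp add: conv_v of_real_indicator)
      then show ?thesis by (simp only: norm_of_real) (auto simp: max_def)
    qed
    have imax: "integrable lborel (\<lambda>x. max 0 (indicator U x - v j x))"
      by (intro integrable_max iU iv Bochner_Integration.integrable_diff integrable_zero)
    have i: "integrable lborel (\<lambda>x. cmod (convolve (mollifier j) (indicator U) x - indicator U x))"
      by (simp add: pt iU iv imax)
    have "(LINT x|lborel. cmod (convolve (mollifier j) (indicator U) x - indicator U x)) =
        2 * (LINT x|lborel. max 0 (indicator U x - v j x))"
      by (simp add: pt iU iv imax Iv)
    then show ?thesis using nn_integral_eq_integral[OF i] by simp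
  qed
  show ?thesis
    unfolding mollifies_def
  proof (intro allI impI)
    fix \<epsilon> :: real assume "0 < \<epsilon>"
    then have "\<forall>\<^sub>F j in sequentially. (LINT x|lborel. max 0 (indicator U x - v j x)) < \<epsilon> / 2"
      by (intro order_tendstoD(2)[OF lim]) simp
    then show "\<forall>\<^sub>F j in sequentially. Lp_le 1 (\<lambda>x. convolve (mollifier j) (indicator U) x - indicator U x) \<epsilon>"
      by eventually_elim (use \<open>0 < \<epsilon>\<close> in \<open>auto simp: Lp_le_1 norm_eq intro!: ennreal_leI\<close>)
  qed
qed

lemma integrable_imp_Lp_le_1:
  assumes "integrable lborel f" shows "Lp_le 1 f (LINT x|lborel. cmod (f x))"
proof -
  have "(\<integral>\<^sup>+x. ennreal (cmod (f x)) \<partial>lborel) = ennreal (LINT x|lborel. cmod (f x))"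
    using assms by (intro nn_integral_eq_integral) auto
  moreover have "f \<in> borel_measurable borel" using assms by auto
  ultimately show ?thesis by (simp add: Lp_le_1)
qed

text \<open>By outer regularity, open sets suffice for indicators; general functions follow by approximation.\<close>

lemma mollifies_L1:
  fixes f :: "real^'n \<Rightarrow> complex"
  assumes "integrable lborel f"
  shows "mollifies 1 f"
  using assms
proof (induction rule: integrable_induct)
  case (base A c)
  have A: "A \<in> sets borel" "emeasure lborel A < top" using base by auto
  have "mollifies 1 (indicator A)"
  proof (rule mollifies_lim[OF order_refl Lp_le_1_indicator[OF A]])
    fix \<epsilon> :: real assume "0 < \<epsilon>"
    from outer_regular_lborel[OF A(1) this] obtain U 
      where U: "open U" "A \<subseteq> U" "emeasure lborel (U - A) < \<epsilon>" by auto
    have Ub [measurable]: "U \<in> sets borel" using U by simp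
    note A(1)[measurable]
    have "U = A \<union> (U - A)" using U by auto
    then have "emeasure lborel U \<le> emeasure lborel A + emeasure lborel (U - A)"
      using emeasure_subadditive[of A lborel "U - A"] A by simp
    also have "\<dots> < top" using A(2) U(3) by (auto simp: less_top[symmetric])
    finally have fin: "emeasure lborel U < top" .
    have "ennreal (cmod (indicator A x - indicator U x)) = indicator (U - A) x" for x
      using U by (auto split: split_indicator)
    then have "Lp_le 1 (\<lambda>x. indicator A x - indicator U x) \<epsilon>"
      using U \<open>0 < \<epsilon>\<close> by (simp add: Lp_le_1)
    then show "\<exists>g D. Lp_le 1 g D \<and> Lp_le 1 (\<lambda>x. indicator A x - g x) \<epsilon> \<and> mollifies 1 g"
      using Lp_le_1_indicator[OF Ub fin] mollifies_open[OF U(1) fin] by blast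
  qed
  then have "mollifies 1 (\<lambda>x. c * indicator A x)" by (rule mollifies_cmult[rotated]) simp
  moreover have "(\<lambda>x. indicat_real A x *\<^sub>R c) = (\<lambda>x. c * indicator A x)"
    by (auto split: split_indicator)
  ultimately show ?case by simp
next
  case (add f g)
  then show ?case
    using mollifies_add[OF order_refl integrable_imp_Lp_le_1 _ integrable_imp_Lp_le_1] by blast
next
  case (lim f s)
  note C = integrable_imp_Lp_le_1[OF lim(4)]
  note borel_measurable_integrable[OF lim(4), measurable] borel_measurable_integrable[OF lim(1), measurable]
  show ?case
  proof (rule mollifies_lim[OF order_refl C])
    fix \<epsilon> :: real assume "0 < \<epsilon>"
    have "(\<lambda>i. LINT x|lborel. cmod (f x - s i x)) \<longlonglongrightarrow> (LINT x|(lborel :: (real^'n) measure). 0)"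
    proof (rule integral_dominated_convergence[where w="\<lambda>x. 3 * cmod (f x)"])
      show "integrable lborel (\<lambda>x. 3 * cmod (f x))" using lim(4) by simp
      show "AE x in lborel. (\<lambda>i. cmod (f x - s i x)) \<longlonglongrightarrow> 0"
      proof (rule AE_I2)
        fix x
        have "(\<lambda>i. cmod (f x - s i x)) \<longlonglongrightarrow> cmod (f x - f x)"
          using lim(2) by (intro tendsto_intros) auto
        then show "(\<lambda>i. cmod (f x - s i x)) \<longlonglongrightarrow> 0" by simp
      qed
      show "AE x in lborel. norm (cmod (f x - s i x)) \<le> 3 * cmod (f x)" for i
      proof (rule AE_I2)
        fix x
        have "cmod (f x - s i x) \<le> cmod (f x) + cmod (s i x)" by (rule norm_triangle_ineq4)
        also have "\<dots> \<le> 3 * cmod (f x)" using lim(3)[of x i] by simp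
        finally show "norm (cmod (f x - s i x)) \<le> 3 * cmod (f x)" by simp
      qed
    qed measurable
    then have "\<forall>\<^sub>F i in sequentially. (LINT x|lborel. cmod (f x - s i x)) < \<epsilon>"
      using \<open>0 < \<epsilon>\<close> by (intro order_tendstoD(2)) auto
    then obtain i where i: "(LINT x|lborel. cmod (f x - s i x)) < \<epsilon>" 
      by (auto simp: eventually_sequentially)
    have "(\<integral>\<^sup>+x. ennreal (cmod (f x - s i x)) \<partial>lborel) = ennreal (LINT x|lborel. cmod (f x - s i x))"
      using lim(1,4) by (intro nn_integral_eq_integral) auto
    then have "Lp_le 1 (\<lambda>x. f x - s i x) \<epsilon>"
      using i \<open>0 < \<epsilon>\<close> by (auto simp: Lp_le_1 intro!: ennreal_leI)
    then show "\<exists>g D. Lp_le 1 g D \<and> Lp_le 1 (\<lambda>x. f x - g x) \<epsilon> \<and> mollifies 1 g"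
      using integrable_imp_Lp_le_1[OF lim(1)[of i]] lim(5)[of i] by blast
  qed
qed

text \<open>From \<open>\<bar>d\<bar>\<^sup>r \<le> M\<^sup>r\<^sup>-\<^sup>1 \<bar>d\<bar>\<close>; it reduces convergence in \<open>L\<^sup>r\<close> to convergence in \<open>L\<^sup>1\<close> for bounded functions.\<close>

lemma Lp_le_interpolate:
  fixes d :: "real^'n \<Rightarrow> complex"
  assumes r: "1 \<le> r" and M: "Lp_le top d M" "0 < M" and a: "Lp_le 1 d (\<epsilon> powr r / M powr (r - 1))" and e: "0 < \<epsilon>"
  shows "Lp_le (ennreal r) d \<epsilon>"
proof -
  have [measurable]: "d \<in> borel_measurable borel" using Lp_leD[OF a] by simp
  have "AE x in lborel. cmod (d x) powr r \<le> M powr (r - 1) * cmod (d x)"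
    using M(1)[unfolded Lp_le_top, THEN conjunct2, THEN conjunct2]
  proof eventually_elim
    case (elim x)
    show ?case
    proof (cases "d x = 0")
      case False
      have "cmod (d x) powr r = cmod (d x) powr (r - 1) * cmod (d x)"
        using False by (simp add: powr_diff)
      also have "\<dots> \<le> M powr (r - 1) * cmod (d x)"
        using elim r by (intro mult_right_mono powr_mono2) auto
      finally show ?thesis .
    qed simp
  qed
  then have "(\<integral>\<^sup>+x. ennreal (cmod (d x) powr r) \<partial>lborel) \<le>
     (\<integral>\<^sup>+x. ennreal (M powr (r - 1)) * ennreal (cmod (d x)) \<partial>lborel)"
    by (intro nn_integral_mono_AE) (auto simp: ennreal_mult[symmetric] elim!: eventually_mono intro!: ennreal_leI)
  also have "\<dots> = ennreal (M powr (r - 1)) * (\<integral>\<^sup>+x. ennreal (cmod (d x)) \<partial>lborel)"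
    by (rule nn_integral_cmult) measurable
  also have "\<dots> \<le> ennreal (M powr (r - 1)) * ennreal (\<epsilon> powr r / M powr (r - 1))"
    using a by (intro mult_left_mono) (auto simp: Lp_le_1)
  also have "\<dots> = ennreal (\<epsilon> powr r)" using M(2) by (simp add: ennreal_mult[symmetric])
  finally show ?thesis using r e by (simp add: Lp_le_real)
qed

text \<open>Cutting \<open>f\<close> off where it or its argument is large changes little in \<open>L\<^sup>r\<close> and leads to a bounded
integrable function, for which convergence in \<open>L\<^sup>1\<close> is known.\<close>

lemma mollifies_Lp:
  fixes f :: "real^'n \<Rightarrow> complex"
  assumes r: "1 \<le> r" and f: "Lp_le (ennreal r) f C"
  shows "mollifies (ennreal r) f"
proof (rule mollifies_lim[OF _ f])
  show r1: "1 \<le> ennreal r" using r by simp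
  have [measurable]: "f \<in> borel_measurable borel" using Lp_leD[OF f] by simp
  fix \<epsilon> :: real assume "0 < \<epsilon>"
  define A where "A n = {x. real n < cmod (f x)} \<union> - cball 0 (real n)" for n
  have [measurable]: "A n \<in> sets borel" for n unfolding A_def by measurable
  have "\<forall>\<^sub>F n in sequentially. x \<notin> A n" for x
  proof -
    obtain N where "max (cmod (f x)) (norm x) \<le> real N" using real_arch_simple by blast
    then have "x \<notin> A n" if "N \<le> n" for n using that by (auto simp: A_def)
    then show ?thesis unfolding eventually_sequentially by blast
  qed
  then have "\<forall>\<^sub>F n in sequentially. Lp_le (ennreal r) (\<lambda>x. indicator (A n) x * f x) \<epsilon>"
    by (intro Lp_le_vanishing[OF r f _ _ \<open>0 < \<epsilon>\<close>]) auto
  then   obtain n where n: "Lp_le (ennreal r) (\<lambda>x. indicator (A n) x * f x) \<epsilon>"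
    unfolding eventually_sequentially by blast
  define g where "g x = indicator (- A n) x * f x" for x
  have [measurable]: "g \<in> borel_measurable borel" unfolding g_def by measurable
  have fg: "f x - g x = indicator (A n) x * f x" for x by (simp add: g_def split: split_indicator)
  have g: "Lp_le (ennreal r) g C"
    by (rule Lp_le_AE_mono[OF r1 f]) (auto simp: g_def norm_mult split: split_indicator)
  have gb: "cmod (g x) \<le> real n * indicator (cball 0 (real n)) x" for x
    by (auto simp: g_def A_def split: split_indicator)
  have "cmod (g x) \<le> real n" for x
    using gb[of x] by (simp split: split_indicator_asm)
  then have gtop: "Lp_le top g (real n)" by (simp add: Lp_le_top)
  have "integrable lborel g"
  proof (rule Bochner_Integration.integrable_bound)
    show "integrable lborel (\<lambda>x. real n * indicator (cball 0 (real n)) x :: real)" 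
      by (intro integrable_mult_right integrable_real_indicator emeasure_bounded_finite) auto
    show "AE x in lborel. norm (g x) \<le> norm (real n * indicat_real (cball 0 (real n)) x)"
      by (rule AE_I2, rule order_trans[OF gb]) simp
  qed measurable
  then have g1: "mollifies 1 g" by (rule mollifies_L1)
  have "mollifies (ennreal r) g"
    unfolding mollifies_def
  proof (intro allI impI)
    fix \<eta> :: real assume "0 < \<eta>"
    \<comment> \<open>A bound for the mollification error; the summand \<open>1\<close> makes it positive for \<open>n = 0\<close>.\<close>
    define M where "M = 2 * real n + 1"
    have M: "0 < M" by (simp add: M_def)
    have "0 < \<eta> powr r / M powr (r - 1)" using \<open>0 < \<eta>\<close> M by simp
    with g1 have "\<forall>\<^sub>F j in sequentially. Lp_le 1 (\<lambda>x. convolve (mollifier j) g x - g x) (\<eta> powr r / M powr (r - 1))"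
      unfolding mollifies_def by blast
    then show "\<forall>\<^sub>F j in sequentially. Lp_le (ennreal r) (\<lambda>x. convolve (mollifier j) g x - g x) \<eta>"
    proof eventually_elim
      case (elim j)
      have 1: "1 \<le> (top :: ennreal)" by simp
      have "Lp_le top (\<lambda>x. convolve (mollifier j) g x + (-1) * g x) (1 * real n + cmod (-1) * real n)"
        by (rule Lp_le_add[OF 1 Young[OF 1 Lp_le_mollifier gtop] Lp_le_cmult[OF 1 gtop]])
      then have "Lp_le top (\<lambda>x. convolve (mollifier j) g x - g x) (2 * real n)"
        by simp
      then have "Lp_le top (\<lambda>x. convolve (mollifier j) g x - g x) M"
        by (rule Lp_le_mono_bound[OF 1]) (simp add: M_def)
      then show ?case using Lp_le_interpolate[OF r _ M elim \<open>0 < \<eta>\<close>] by simp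
    qed
  qed
  then show "\<exists>g D. Lp_le (ennreal r) g D \<and> Lp_le (ennreal r) (\<lambda>x. f x - g x) \<epsilon> \<and> mollifies (ennreal r) g"
    using g n by (auto simp: fg)
qed

section \<open>Lebesgue spaces of classes\<close>

lemma L0_cases:
  fixes F :: "'n::finite L0"
  obtains (rep) f where "f \<in> borel_measurable borel" "F = class_L0 f"
  by (induction F rule: L0.abs_induct) (auto simp: ae_eq_def)

lemma ae_eq_refl: "f \<in> borel_measurable borel \<Longrightarrow> ae_eq f f"
  by (simp add: ae_eq_def)

lemma class_L0_eq_iff:
  assumes "f \<in> borel_measurable borel" "g \<in> borel_measurable borel"
  shows "class_L0 f = class_L0 g \<longleftrightarrow> (AE x in lborel. f x = g x)"
  using Quotient_rel[OF Quotient_L0, of f g] assms by (auto simp: ae_eq_def)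

lemma
  assumes "f \<in> borel_measurable borel" "g \<in> borel_measurable borel"
  shows class_L0_plus: "class_L0 f + class_L0 g = class_L0 (\<lambda>x. f x + g x)"
    and class_L0_minus: "class_L0 f - class_L0 g = class_L0 (\<lambda>x. f x - g x)"
    and class_L0_times: "class_L0 f * class_L0 g = class_L0 (\<lambda>x. f x * g x)"
    and class_L0_conv: "conv (class_L0 f) (class_L0 g) = class_L0 (convolve f g)"
    and class_L0_pairing: "pairing (class_L0 f) (class_L0 g) = (LINT x|lborel. f x * g x)"
  using assms[THEN ae_eq_refl]
  by (simp_all add: plus_L0.abs_eq minus_L0.abs_eq times_L0.abs_eq conv.abs_eq
      pairing.abs_eq convolve_def[abs_def])

lemma class_L0_scaleC: "f \<in> borel_measurable borel \<Longrightarrow> c *\<^sub>C class_L0 f = class_L0 (\<lambda>x. c * f x)"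
  by (simp add: scaleC_L0.abs_eq ae_eq_def)

lemma eLp_norm_le_iff:
  assumes p: "1 \<le> p" and [measurable]: "f \<in> borel_measurable borel" and C: "0 \<le> C"
  shows "eLp_norm p (class_L0 f) \<le> ennreal C \<longleftrightarrow> Lp_le p f C"
  using p
proof (cases rule: exponent_cases)
  case infinity
  have "esssup lborel (\<lambda>x. ennreal (cmod (f x))) \<le> ennreal C \<longleftrightarrow> (AE x in lborel. cmod (f x) \<le> C)"
  proof
    assume *: "esssup lborel (\<lambda>x. ennreal (cmod (f x))) \<le> ennreal C"
    have "AE x in lborel. ennreal (cmod (f x)) \<le> esssup lborel (\<lambda>x. ennreal (cmod (f x)))"
      by (rule esssup_AE)
    then show "AE x in lborel. cmod (f x) \<le> C"
    proof eventually_elim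
      case (elim x)
      with * have "ennreal (cmod (f x)) \<le> ennreal C" by (rule order_trans[rotated])
      then show ?case using C by simp
    qed
  next
    assume "AE x in lborel. cmod (f x) \<le> C"
    then show "esssup lborel (\<lambda>x. ennreal (cmod (f x))) \<le> ennreal C"
      by (intro esssup_I) (auto elim!: eventually_mono intro!: ennreal_leI)
  qed
  then show ?thesis using infinity C by (simp add: eLp_norm.abs_eq[OF ae_eq_refl] Lp_le_top)
next
  case (real r)
  show ?thesis
  proof (cases "(\<integral>\<^sup>+x. ennreal (cmod (f x) powr r) \<partial>lborel)")
    case (real i)
    have "i powr (1/r) \<le> C \<longleftrightarrow> i \<le> C powr r"
    proof
      assume "i powr (1/r) \<le> C"
      then have "(i powr (1/r)) powr r \<le> C powr r" using \<open>1 \<le> r\<close> by (intro powr_mono2) auto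
      then show "i \<le> C powr r" using real \<open>1 \<le> r\<close> by (simp add: powr_powr)
    next
      assume "i \<le> C powr r"
      then have "i powr (1/r) \<le> (C powr r) powr (1/r)" using \<open>1 \<le> r\<close> real by (intro powr_mono2) auto
      then show "i powr (1/r) \<le> C" using C \<open>1 \<le> r\<close> by (simp add: powr_powr)
    qed
    then show ?thesis using \<open>p = ennreal r\<close> \<open>1 \<le> r\<close> C real
      by (simp add: eLp_norm.abs_eq[OF ae_eq_refl] Lp_le_real)
  next
    case top
    then show ?thesis using \<open>p = ennreal r\<close> \<open>1 \<le> r\<close> C
      by (simp add: eLp_norm.abs_eq[OF ae_eq_refl] Lp_le_real top_unique)
  qed
qed

lemma Lp_norm_nonneg [simp]: "0 \<le> Lp_norm p F"
  by (simp add: Lp_norm_def)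

lemma Lp_class_iff:
  assumes "1 \<le> p" "f \<in> borel_measurable borel" "0 \<le> C"
  shows "class_L0 f \<in> Lp p \<and> Lp_norm p (class_L0 f) \<le> C \<longleftrightarrow> Lp_le p f C"
proof -
  have "class_L0 f \<in> Lp p \<and> Lp_norm p (class_L0 f) \<le> C \<longleftrightarrow> eLp_norm p (class_L0 f) \<le> ennreal C"
    using assms(3) by (cases "eLp_norm p (class_L0 f)") (auto simp: Lp_def Lp_norm_def top_unique)
  then show ?thesis using eLp_norm_le_iff[OF assms] by simp
qed

lemma Lp_le_imp_Lp:
  assumes "1 \<le> p" "Lp_le p f C" 
  shows "class_L0 f \<in> Lp p" "Lp_norm p (class_L0 f) \<le> C"
  using Lp_class_iff[OF assms(1)] Lp_leD[OF assms(2)] assms(2) by auto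

lemma Lp_cases:
  assumes "1 \<le> p" "F \<in> Lp p"
  obtains f where "F = class_L0 f" "Lp_le p f (Lp_norm p F)" "f \<in> borel_measurable borel"
proof (cases F rule: L0_cases)
  case (rep f)
  then show ?thesis using that[of f] Lp_class_iff[OF assms(1), of f "Lp_norm p F"] assms(2) by auto
qed

lemma Lp_norm_0: assumes "1 \<le> p" shows "0 \<in> Lp p" "Lp_norm p 0 = 0"
  using Lp_le_imp_Lp[OF assms Lp_le_zero[OF assms]] 
  by (auto simp: zero_L0.abs_eq intro: antisym)

text \<open>Definiteness of the norm, which makes \<open>L\<^sup>p\<close> a metric space of classes.\<close>

lemma Lp_norm_eq_0:
  assumes p: "1 \<le> p" and F: "F \<in> Lp p" and 0: "Lp_norm p F = 0"
  shows "F = 0"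
proof -
  from Lp_cases[OF p F] obtain f where f: "F = class_L0 f" "Lp_le p f 0" "f \<in> borel_measurable borel"
    using 0 by metis
  note f(3)[measurable]
  have "AE x in lborel. f x = 0"
    using p
  proof (cases rule: exponent_cases)
    case infinity then show ?thesis using f(2) by (auto simp: Lp_le_top)
  next
    case (real r)
    then have "(\<integral>\<^sup>+x. ennreal (cmod (f x) powr r) \<partial>lborel) = 0" using f(2) by (simp add: Lp_le_real)
    then have "AE x in lborel. ennreal (cmod (f x) powr r) = 0" by (subst (asm) nn_integral_0_iff_AE) auto
    then show ?thesis by eventually_elim auto
  qed
  then show ?thesis using f by (simp add: zero_L0.abs_eq class_L0_eq_iff)
qed

lemma Lp_add:
  assumes p: "1 \<le> p" and F: "F \<in> Lp p" and G: "G \<in> Lp p"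
  shows "F + G \<in> Lp p" "Lp_norm p (F + G) \<le> Lp_norm p F + Lp_norm p G"
proof -
  from Lp_cases[OF p F] obtain f where f: "F = class_L0 f" "Lp_le p f (Lp_norm p F)" "f \<in> borel_measurable borel" .
  from Lp_cases[OF p G] obtain g where g: "G = class_L0 g" "Lp_le p g (Lp_norm p G)" "g \<in> borel_measurable borel" .
  have "F + G = class_L0 (\<lambda>x. f x + g x)" using f g by (simp add: class_L0_plus)
  then show "F + G \<in> Lp p" "Lp_norm p (F + G) \<le> Lp_norm p F + Lp_norm p G"
    using Lp_le_imp_Lp[OF p Lp_le_add[OF p f(2) g(2)]] by auto
qed

lemma scaleC_scaleC: "a *\<^sub>C b *\<^sub>C F = (a * b) *\<^sub>C F" 
  and scaleC_one: "1 *\<^sub>C F = F" and scaleC_zero: "0 *\<^sub>C F = 0" and scaleC_minus_one: "(-1) *\<^sub>C F = - F"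
  and scaleC_add: "a *\<^sub>C (F + G) = a *\<^sub>C F + a *\<^sub>C G"
  and scaleC_add_left: "(a + b) *\<^sub>C F = a *\<^sub>C F + b *\<^sub>C F"
  and times_scaleC: "G * (a *\<^sub>C F) = a *\<^sub>C (G * F)"
  for F G :: "'n::finite L0"
  by (transfer; auto simp: ae_eq_def algebra_simps)+

lemma Lp_scaleC:
  assumes p: "1 \<le> p" and F: "F \<in> Lp p"
  shows "c *\<^sub>C F \<in> Lp p" "Lp_norm p (c *\<^sub>C F) = cmod c * Lp_norm p F"
proof -
  have *: "c *\<^sub>C F \<in> Lp p \<and> Lp_norm p (c *\<^sub>C F) \<le> cmod c * Lp_norm p F" if F: "F \<in> Lp p" for c F
  proof -
    from Lp_cases[OF p F] obtain f where f: "F = class_L0 f" "Lp_le p f (Lp_norm p F)" "f \<in> borel_measurable borel" .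
    have "c *\<^sub>C F = class_L0 (\<lambda>x. c * f x)" using f by (simp add: class_L0_scaleC)
    then show ?thesis using Lp_le_imp_Lp[OF p Lp_le_cmult[OF p f(2)]] by auto
  qed
  from *[OF F] show "c *\<^sub>C F \<in> Lp p" by simp
  show "Lp_norm p (c *\<^sub>C F) = cmod c * Lp_norm p F"
  proof (cases "c = 0")
    case True then show ?thesis using Lp_norm_0[OF p] by (simp add: scaleC_zero)
  next
    case False
    have "F = (1/c) *\<^sub>C (c *\<^sub>C F)" using False by (simp add: scaleC_scaleC scaleC_one)
    then have "Lp_norm p F \<le> cmod (1/c) * Lp_norm p (c *\<^sub>C F)"
      using *[of "c *\<^sub>C F" "1/c"] *[OF F] by metis
    then have "cmod c * Lp_norm p F \<le> Lp_norm p (c *\<^sub>C F)"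
      using False by (simp add: norm_divide field_simps)
    then show ?thesis using *[OF F] by (simp add: antisym)
  qed
qed

lemma Lp_norm_uminus: "Lp_norm p (- F) = Lp_norm p F"
proof -
  have "eLp_norm p (- F) = eLp_norm p F" by transfer simp
  then show ?thesis by (simp add: Lp_norm_def)
qed

lemma Lp_uminus:
  assumes "1 \<le> p" "F \<in> Lp p" shows "- F \<in> Lp p" "Lp_norm p (- F) = Lp_norm p F"
  using Lp_scaleC[OF assms, of "-1"] by (simp_all add: scaleC_minus_one)

lemma Lp_diff:
  assumes "1 \<le> p" "F \<in> Lp p" "G \<in> Lp p"
  shows "F - G \<in> Lp p" "Lp_norm p (F - G) \<le> Lp_norm p F + Lp_norm p G"
  using Lp_add[OF assms(1,2), of "- G"] Lp_uminus[OF assms(1,3)] by simp_all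

lemma Lp_norm_minus_commute: "Lp_norm p (F - G) = Lp_norm p (G - F)"
  using Lp_norm_uminus[of p "F - G"] by simp

lemma Lp_norm_triangle:
  assumes "1 \<le> p" "F \<in> Lp p" "G \<in> Lp p" "H \<in> Lp p"
  shows "Lp_norm p (F - H) \<le> Lp_norm p (F - G) + Lp_norm p (G - H)"
  using Lp_add(2)[OF assms(1) Lp_diff(1)[OF assms(1-3)] Lp_diff(1)[OF assms(1,3,4)]] by simp

lemma Lp_conv:
  assumes p: "1 \<le> p" and H: "H \<in> Lp 1" and F: "F \<in> Lp p"
  shows "conv H F \<in> Lp p" "Lp_norm p (conv H F) \<le> Lp_norm 1 H * Lp_norm p F"
proof -
  from Lp_cases[OF p F] obtain f where f: "F = class_L0 f" "Lp_le p f (Lp_norm p F)" "f \<in> borel_measurable borel" .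
  from Lp_cases[OF order_refl H] obtain h where h: "H = class_L0 h" "Lp_le 1 h (Lp_norm 1 H)" "h \<in> borel_measurable borel" .
  have "conv H F = class_L0 (convolve h f)" using f h by (simp add: class_L0_conv)
  then show "conv H F \<in> Lp p" "Lp_norm p (conv H F) \<le> Lp_norm 1 H * Lp_norm p F"
    using Lp_le_imp_Lp[OF p Young[OF p h(2) f(2)]] by auto
qed

lemma conv_add_right:
  assumes p: "1 \<le> p" and H: "H \<in> Lp 1" and F: "F \<in> Lp p" and G: "G \<in> Lp p"
  shows "conv H (F + G) = conv H F + conv H G"
proof -
  from Lp_cases[OF p F] obtain f where f: "F = class_L0 f" "Lp_le p f (Lp_norm p F)" "f \<in> borel_measurable borel" .
  from Lp_cases[OF p G] obtain g where g: "G = class_L0 g" "Lp_le p g (Lp_norm p G)" "g \<in> borel_measurable borel" .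
  from Lp_cases[OF order_refl H] obtain h where h: "H = class_L0 h" "Lp_le 1 h (Lp_norm 1 H)" "h \<in> borel_measurable borel" .
  note [measurable] = f(3) g(3) h(3)
  show ?thesis unfolding f g h using convolve_add_right_AE[OF p h(2) f(2) g(2)]
    by (simp add: class_L0_conv class_L0_plus class_L0_eq_iff)
qed

lemma conv_add_left:
  assumes p: "1 \<le> p" and H: "H \<in> Lp 1" and K: "K \<in> Lp 1" and F: "F \<in> Lp p"
  shows "conv (H + K) F = conv H F + conv K F"
proof -
  from Lp_cases[OF p F] obtain f where f: "F = class_L0 f" "Lp_le p f (Lp_norm p F)" "f \<in> borel_measurable borel" .
  from Lp_cases[OF order_refl K] obtain k where k: "K = class_L0 k" "Lp_le 1 k (Lp_norm 1 K)" "k \<in> borel_measurable borel" .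
  from Lp_cases[OF order_refl H] obtain h where h: "H = class_L0 h" "Lp_le 1 h (Lp_norm 1 H)" "h \<in> borel_measurable borel" .
  note [measurable] = f(3) k(3) h(3)
  show ?thesis unfolding f k h using convolve_add_left_AE[OF p h(2) k(2) f(2)]
    by (simp add: class_L0_conv class_L0_plus class_L0_eq_iff)
qed

lemma conv_scaleC_right: "conv H (c *\<^sub>C F) = c *\<^sub>C conv H F"
proof (cases H rule: L0_cases)
  case H: (rep h)
  show ?thesis
  proof (cases F rule: L0_cases)
    case F: (rep f)
    note [measurable] = H(1) F(1)
    have "convolve h (\<lambda>x. c * f x) = (\<lambda>x. c * convolve h f x)"
    proof
      fix x
      have "convolve h (\<lambda>x. c * f x) x = (LINT y|lborel. c * (h y * f (x - y)))"
        by (simp add: convolve_def ac_simps)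
      then show "convolve h (\<lambda>x. c * f x) x = c * convolve h f x" by (simp add: convolve_def)
    qed
    then show ?thesis by (simp add: H(2) F(2) class_L0_scaleC class_L0_conv)
  qed
qed

lemma conv_commute: "conv H F = conv F H"
proof (cases H rule: L0_cases)
  case H: (rep h)
  show ?thesis
  proof (cases F rule: L0_cases)
    case F: (rep f)
    have "convolve h f = convolve f h" using convolve_commute[OF H(1) F(1)] by blast
    then show ?thesis by (simp add: H F class_L0_conv)
  qed
qed

lemma conv_scaleC_left: "conv (c *\<^sub>C H) F = c *\<^sub>C conv H F"
  by (metis conv_commute conv_scaleC_right)

lemma conv_diff_right:
  assumes p: "1 \<le> p" and H: "H \<in> Lp 1" and F: "F \<in> Lp p" and G: "G \<in> Lp p"
  shows "conv H (F - G) = conv H F - conv H G"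
  using conv_add_right[OF p H Lp_diff(1)[OF p F G] G] by simp

lemma conv_diff_left:
  assumes p: "1 \<le> p" and H: "H \<in> Lp 1" and K: "K \<in> Lp 1" and F: "F \<in> Lp p"
  shows "conv (H - K) F = conv H F - conv K F"
  using conv_add_left[OF p Lp_diff(1)[OF order_refl H K] K F] by simp

lemma conv_assoc:
  assumes p: "1 \<le> p" and H: "H \<in> Lp 1" and K: "K \<in> Lp 1" and F: "F \<in> Lp p"
  shows "conv H (conv K F) = conv (conv H K) F"
proof -
  from Lp_cases[OF p F] obtain f where f: "F = class_L0 f" "Lp_le p f (Lp_norm p F)" "f \<in> borel_measurable borel" .
  from Lp_cases[OF order_refl K] obtain k where k: "K = class_L0 k" "Lp_le 1 k (Lp_norm 1 K)" "k \<in> borel_measurable borel" .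
  from Lp_cases[OF order_refl H] obtain h where h: "H = class_L0 h" "Lp_le 1 h (Lp_norm 1 H)" "h \<in> borel_measurable borel" .
  note [measurable] = f(3) k(3) h(3)
  show ?thesis unfolding f k h using convolve_assoc_AE[OF p h(2) k(2) f(2)]
    by (simp add: class_L0_conv class_L0_eq_iff)
qed

lemma Lp_mult_bounded:
  assumes p: "1 \<le> p" and g: "g \<in> borel_measurable borel" "\<And>x. cmod (g x) \<le> B" and F: "F \<in> Lp p"
  shows "class_L0 g * F \<in> Lp p" "Lp_norm p (class_L0 g * F) \<le> B * Lp_norm p F"
proof -
  from Lp_cases[OF p F] obtain f where f: "F = class_L0 f" "Lp_le p f (Lp_norm p F)" "f \<in> borel_measurable borel" .
  have B: "0 \<le> B" using g(2)[of 0] norm_ge_zero order_trans by blast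
  have "class_L0 g * F = class_L0 (\<lambda>x. g x * f x)" using f g by (simp add: class_L0_times)
  then show "class_L0 g * F \<in> Lp p" "Lp_norm p (class_L0 g * F) \<le> B * Lp_norm p F"
    using Lp_le_imp_Lp[OF p Lp_le_bounded_mult[OF p f(2) g(1) _ B]] g(2) by auto
qed

section \<open>The bilinear pairing\<close>

lemma pairing_commute: "pairing F G = pairing G F"
  by transfer (simp add: mult.commute)

lemma pairing_mult: "pairing (G * F) K = pairing F (G * K)"
proof (transfer)
  show "(LINT x|lborel. G x * F x * K x) = (LINT x|lborel. F x * (G x * K x))" for F G K :: "real^'n \<Rightarrow> complex"
    by (simp add: ac_simps)
qed

lemma pairing_scaleC: "pairing (c *\<^sub>C F) K = c * pairing F K"
proof (transfer)
  show "(LINT x|lborel. c * F x * K x) = c * (LINT x|lborel. F x * K x)" for c and F K :: "real^'n \<Rightarrow> complex"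
    by (simp add: mult.assoc)
qed

lemma cmod_pairing_le:
  assumes pq: "conjugate p q" and F: "F \<in> Lp p" and K: "K \<in> Lp q"
  shows "cmod (pairing F K) \<le> Lp_norm p F * Lp_norm q K"
proof -
  from Lp_cases[OF conjugate_ge1(1)[OF pq] F] obtain f where f: "F = class_L0 f" "Lp_le p f (Lp_norm p F)" "f \<in> borel_measurable borel" .
  from Lp_cases[OF conjugate_ge1(2)[OF pq] K] obtain k where k: "K = class_L0 k" "Lp_le q k (Lp_norm q K)" "k \<in> borel_measurable borel" .
  show ?thesis using Hoelder_integrable(2)[OF pq f(2) k(2)] f k by (simp add: class_L0_pairing)
qed

lemma pairing_add:
  assumes pq: "conjugate p q" and F: "F \<in> Lp p" "G \<in> Lp p" and K: "K \<in> Lp q"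
  shows "pairing (F + G) K = pairing F K + pairing G K"
proof -
  note p = conjugate_ge1(1)[OF pq]
  from Lp_cases[OF p F(1)] obtain f where f: "F = class_L0 f" "Lp_le p f (Lp_norm p F)" "f \<in> borel_measurable borel" .
  from Lp_cases[OF p F(2)] obtain g where g: "G = class_L0 g" "Lp_le p g (Lp_norm p G)" "g \<in> borel_measurable borel" .
  from Lp_cases[OF conjugate_ge1(2)[OF pq] K] obtain k where k: "K = class_L0 k" "Lp_le q k (Lp_norm q K)" "k \<in> borel_measurable borel" .
  note [measurable] = f(3) g(3) k(3)
  show ?thesis unfolding f g k
    using Hoelder_integrable(1)[OF pq f(2) k(2)] Hoelder_integrable(1)[OF pq g(2) k(2)]
    by (simp add: class_L0_pairing class_L0_plus distrib_right)
qed

lemma pairing_diff: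
  assumes pq: "conjugate p q" and F: "F \<in> Lp p" "G \<in> Lp p" and K: "K \<in> Lp q"
  shows "pairing (F - G) K = pairing F K - pairing G K"
  using pairing_add[OF pq Lp_diff(1)[OF conjugate_ge1(1)[OF pq] F] F(2) K] by simp

lemma pairing_diff_right:
  assumes pq: "conjugate p q" and F: "F \<in> Lp p" and K: "K \<in> Lp q" "L \<in> Lp q"
  shows "pairing F (K - L) = pairing F K - pairing F L"
  using pairing_diff[OF conjugate_sym[OF pq] K F] by (simp add: pairing_commute)

text \<open>The converse of Hoelder's inequality: the norm is the supremum of the pairing over the unit ball of the
conjugate exponent.\<close>

lemma Lp_norm_le_of_pairing:
  assumes pq: "conjugate p q" "1 < p" and F: "F \<in> Lp p" and B: "0 \<le> B"
    and dual: "\<And>K. K \<in> Lp q \<Longrightarrow> Lp_norm q K \<le> 1 \<Longrightarrow> cmod (pairing F K) \<le> B"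
  shows "Lp_norm p F \<le> B"
proof -
  note p = conjugate_ge1(1)[OF pq(1)]
  from Lp_cases[OF p F] obtain f where f: "F = class_L0 f" "Lp_le p f (Lp_norm p F)" "f \<in> borel_measurable borel" .
  have "Lp_le p f B"
  proof (rule Lp_le_of_pairing[OF pq f(2) B])
    fix \<phi> :: "real^'a \<Rightarrow> complex" assume \<phi>: "Lp_le q \<phi> 1"
    show "cmod (LINT x|lborel. f x * \<phi> x) \<le> B"
      using dual[of "class_L0 \<phi>"] Lp_le_imp_Lp[OF conjugate_ge1(2)[OF pq(1)] \<phi>] f Lp_leD[OF \<phi>]
      by (simp add: class_L0_pairing)
  qed
  then show ?thesis using Lp_le_imp_Lp(2)[OF p] f by simp
qed

text \<open>The witness is the reflection of \<open>H\<close>; all that matters is that one and the same \<open>L\<^sup>1\<close> class serves all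
exponents and all arguments.\<close>

lemma pairing_conv_ex:
  fixes H :: "'n::finite L0"
  assumes H: "H \<in> Lp 1"
  shows "\<exists>H'\<in>Lp 1. \<forall>p q F K. conjugate p q \<longrightarrow> F \<in> Lp p \<longrightarrow> K \<in> Lp q \<longrightarrow>
    pairing (conv H F) K = pairing F (conv H' K)"
proof -
  from Lp_cases[OF order_refl H] obtain h where h: "H = class_L0 h" "Lp_le 1 h (Lp_norm 1 H)" "h \<in> borel_measurable borel" .
  note [measurable] = h(3)
  show ?thesis
  proof (intro bexI allI impI)
    show "class_L0 (\<lambda>y. h (- y)) \<in> Lp 1" by (rule Lp_le_imp_Lp[OF order_refl Lp_le_1_uminus[OF h(2)]])
    fix p q and F K :: "'n L0" assume pq: "conjugate p q" and F: "F \<in> Lp p" and K: "K \<in> Lp q"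
    from Lp_cases[OF conjugate_ge1(1)[OF pq] F] obtain f where f: "F = class_L0 f" "Lp_le p f (Lp_norm p F)" "f \<in> borel_measurable borel" .
    from Lp_cases[OF conjugate_ge1(2)[OF pq] K] obtain k where k: "K = class_L0 k" "Lp_le q k (Lp_norm q K)" "k \<in> borel_measurable borel" .
    note [measurable] = f(3) k(3)
    show "pairing (conv H F) K = pairing F (conv (class_L0 (\<lambda>y. h (- y))) K)"
      unfolding f k h using convolve_adjoint[OF pq h(2) f(2) k(2)]
      by (simp add: class_L0_pairing class_L0_conv)
  qed
qed

section \<open>Mollification of classes\<close>

definition moll :: "nat \<Rightarrow> 'n::finite L0" where
  "moll j = class_L0 (mollifier j)"

lemma moll_Lp: "moll j \<in> Lp 1" "Lp_norm 1 (moll j) \<le> 1"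
  unfolding moll_def by (rule Lp_le_imp_Lp[OF order_refl Lp_le_mollifier])+

lemma Lp_conv_moll:
  assumes "1 \<le> p" "F \<in> Lp p"
  shows "conv (moll j) F \<in> Lp p" "Lp_norm p (conv (moll j) F) \<le> Lp_norm p F"
proof -
  show "conv (moll j) F \<in> Lp p" by (rule Lp_conv(1)[OF assms(1) moll_Lp(1) assms(2)])
  have "Lp_norm p (conv (moll j) F) \<le> Lp_norm 1 (moll j :: 'a L0) * Lp_norm p F"
    by (rule Lp_conv(2)[OF assms(1) moll_Lp(1) assms(2)])
  also have "\<dots> \<le> 1 * Lp_norm p F" by (intro mult_right_mono moll_Lp) auto
  finally show "Lp_norm p (conv (moll j) F) \<le> Lp_norm p F" by simp
qed

text \<open>Mollifiers are even, so that mollification is its own transpose.\<close>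

lemma pairing_conv_moll:
  assumes pq: "conjugate p q" and F: "F \<in> Lp p" and K: "K \<in> Lp q"
  shows "pairing (conv (moll j) F) K = pairing F (conv (moll j) K)"
proof -
  from Lp_cases[OF conjugate_ge1(1)[OF pq] F] obtain f where f: "F = class_L0 f" "Lp_le p f (Lp_norm p F)" "f \<in> borel_measurable borel" .
  from Lp_cases[OF conjugate_ge1(2)[OF pq] K] obtain k where k: "K = class_L0 k" "Lp_le q k (Lp_norm q K)" "k \<in> borel_measurable borel" .
  note [measurable] = f(3) k(3)
  show ?thesis unfolding f k moll_def using convolve_adjoint[OF pq Lp_le_mollifier f(2) k(2)]
    by (simp add: class_L0_pairing class_L0_conv)
qed

lemma conv_moll_tendsto:
  assumes r: "1 \<le> r" and F: "F \<in> Lp (ennreal r)" and e: "0 < \<epsilon>"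
  shows "\<forall>\<^sub>F j in sequentially. Lp_norm (ennreal r) (conv (moll j) F - F) \<le> \<epsilon>"
proof -
  have p: "1 \<le> ennreal r" using r by simp
  from Lp_cases[OF p F] obtain f where f: "F = class_L0 f" "Lp_le (ennreal r) f (Lp_norm (ennreal r) F)" "f \<in> borel_measurable borel" .
  note [measurable] = f(3)
  have "\<forall>\<^sub>F j in sequentially. Lp_le (ennreal r) (\<lambda>x. convolve (mollifier j) f x - f x) \<epsilon>"
    using mollifies_Lp[OF r f(2)] e unfolding mollifies_def by blast
  then show ?thesis
  proof eventually_elim
    case (elim j)
    have "conv (moll j) F - F = class_L0 (\<lambda>x. convolve (mollifier j) f x - f x)"
      unfolding f moll_def by (simp add: class_L0_conv class_L0_minus)
    then show ?case using Lp_le_imp_Lp(2)[OF p elim] by simp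
  qed
qed

section \<open>Completeness\<close>

lemma class_L0_sum:
  assumes "\<And>i. i \<in> I \<Longrightarrow> f i \<in> borel_measurable borel"
  shows "(\<Sum>i\<in>I. class_L0 (f i)) = class_L0 (\<lambda>x. \<Sum>i\<in>I. f i x)"
  using assms by (induction I rule: infinite_finite_induct) (auto simp: zero_L0.abs_eq class_L0_plus)

text \<open>Completeness in the form in which it is used twice: for the completeness of the metric space, and to
construct the convolution factor in \<open>L\<^sup>1\<close>.\<close>

lemma Lp_series_converges:
  fixes G :: "nat \<Rightarrow> 'n::finite L0"
  assumes r: "1 \<le> r" and G: "\<And>k. G k \<in> Lp (ennreal r)" 
    and a: "\<And>k. Lp_norm (ennreal r) (G k) \<le> a k" "summable a"
  shows "\<exists>S\<in>Lp (ennreal r). (\<lambda>m. Lp_norm (ennreal r) (S - (\<Sum>k<m. G k))) \<longlonglongrightarrow> 0"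
proof -
  have p: "1 \<le> ennreal r" using r by simp
  have "\<exists>g. G k = class_L0 g \<and> Lp_le (ennreal r) g (a k)" for k
  proof -
    from Lp_cases[OF p G] obtain g where "G k = class_L0 g" "Lp_le (ennreal r) g (Lp_norm (ennreal r) (G k))" .
    then show ?thesis using Lp_le_mono_bound[OF p _ a(1)[of k]] by blast
  qed
  then obtain g where g: "G k = class_L0 (g k)" "Lp_le (ennreal r) (g k) (a k)" for k by metis
  have [measurable]: "g k \<in> borel_measurable borel" for k using Lp_leD[OF g(2)] by simp
  define s where "s x = (\<Sum>k. g k x)" for x
  have [measurable]: "s \<in> borel_measurable borel" unfolding s_def by measurable
  have tail: "Lp_le (ennreal r) (\<lambda>x. s x - (\<Sum>k<m. g k x)) (\<Sum>k. a (k + m))" for m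
    using Lp_le_suminf(2)[OF r g(2) a(2)] by (simp add: s_def)
  have diff: "class_L0 s - (\<Sum>k<m. G k) = class_L0 (\<lambda>x. s x - (\<Sum>k<m. g k x))" for m
    by (simp add: g(1) class_L0_sum class_L0_minus)
  show ?thesis
  proof
    show "class_L0 s \<in> Lp (ennreal r)" using Lp_le_imp_Lp(1)[OF p tail[of 0]] by simp
    show "(\<lambda>m. Lp_norm (ennreal r) (class_L0 s - (\<Sum>k<m. G k))) \<longlonglongrightarrow> 0"
    proof (rule tendsto_sandwich[OF _ _ tendsto_const])
      show "(\<lambda>m. \<Sum>k. a (k + m)) \<longlonglongrightarrow> 0" by (rule suminf_exist_split2[OF a(2)])
      show "\<forall>\<^sub>F m in sequentially. Lp_norm (ennreal r) (class_L0 s - (\<Sum>k<m. G k)) \<le> (\<Sum>k. a (k + m))"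
        unfolding diff by (intro always_eventually allI Lp_le_imp_Lp(2)[OF p tail])
    qed simp
  qed
qed

lemma Metric_space_Lp:
  assumes "1 \<le> p"
  shows "Metric_space (Lp p) (\<lambda>f g. Lp_norm p (f - g))"
proof
  fix x y z :: "'a L0"
  show "0 \<le> Lp_norm p (x - y)" by simp
  show "Lp_norm p (x - y) = Lp_norm p (y - x)"
    by (rule Lp_norm_minus_commute)
  assume xy: "x \<in> Lp p" "y \<in> Lp p"
  show "(Lp_norm p (x - y) = 0) = (x = y)"
    using Lp_norm_eq_0[OF assms Lp_diff(1)[OF assms xy]] Lp_norm_0[OF assms] by auto
  assume z: "z \<in> Lp p"
  show "Lp_norm p (x - z) \<le> Lp_norm p (x - y) + Lp_norm p (y - z)"
    by (rule Lp_norm_triangle[OF assms xy z])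
qed

text \<open>A Cauchy sequence has a subsequence with summable increments.\<close>

lemma mcomplete_Lp:
  assumes r: "1 \<le> r"
  shows "Metric_space.mcomplete (Lp (ennreal r) :: 'n::finite L0 set) (\<lambda>f g. Lp_norm (ennreal r) (f - g))"
proof -
  have p: "1 \<le> ennreal r" using r by simp
  let ?d = "\<lambda>f g :: 'n L0. Lp_norm (ennreal r) (f - g)"
  interpret M: Metric_space "Lp (ennreal r) :: 'n L0 set" ?d by (rule Metric_space_Lp[OF p])
  show ?thesis
    unfolding M.mcomplete_def
  proof (intro allI impI)
    fix \<sigma> :: "nat \<Rightarrow> 'n L0" assume C: "M.MCauchy \<sigma>"
    then have ran: "\<sigma> n \<in> Lp (ennreal r)" for n by (auto simp: M.MCauchy_def)
    have "\<exists>N. \<forall>n n'. N \<le> n \<longrightarrow> N \<le> n' \<longrightarrow> ?d (\<sigma> n) (\<sigma> n') < (1/2)^k" for k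
      using C unfolding M.MCauchy_def by (meson zero_less_power half_gt_zero zero_less_one)
    then obtain N where N: "N k \<le> n \<Longrightarrow> N k \<le> n' \<Longrightarrow> ?d (\<sigma> n) (\<sigma> n') < (1/2)^k" for k n n' by metis
    \<comment> \<open>A strictly increasing sequence of indices above \<open>N\<close>.\<close>
    define M where "M k = k + (\<Sum>i\<le>k. N i)" for k
    have M: "strict_mono M" unfolding strict_mono_Suc_iff by (simp add: M_def)
    have MN: "N k \<le> M k" for k unfolding M_def by (simp add: member_le_sum trans_le_add2)
    define G where "G k = \<sigma> (M (Suc k)) - \<sigma> (M k)" for k
    have "N k \<le> M (Suc k)" for k using MN[of k] strict_monoD[OF M, of k "Suc k"] by simp
    then have G: "G k \<in> Lp (ennreal r)" "Lp_norm (ennreal r) (G k) \<le> (1/2)^k" for k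
      unfolding G_def using less_imp_le[OF N[OF _ MN]] by (auto intro!: Lp_diff p ran)
    have "summable (\<lambda>k. (1/2 :: real)^k)" by simp
    from Lp_series_converges[OF r G this]
    obtain S where S: "S \<in> Lp (ennreal r)" "(\<lambda>m. Lp_norm (ennreal r) (S - (\<Sum>k<m. G k))) \<longlonglongrightarrow> 0" by blast
    have sumG: "(\<Sum>k<m. G k) = \<sigma> (M m) - \<sigma> (M 0)" for m
      unfolding G_def by (rule sum_lessThan_telescope)
    define L where "L = S + \<sigma> (M 0)"
    have L: "L \<in> Lp (ennreal r)" unfolding L_def by (intro Lp_add p S ran)
    have "(\<lambda>m. ?d (\<sigma> (M m)) L) \<longlonglongrightarrow> 0"
    proof -
      have "?d (\<sigma> (M m)) L = Lp_norm (ennreal r) (S - (\<Sum>k<m. G k))" for m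
        unfolding Lp_norm_minus_commute[of _ _ L] by (simp add: sumG L_def algebra_simps)
      then show ?thesis using S(2) by simp
    qed
    then have "limitin M.mtopology (\<sigma> \<circ> M) L sequentially"
      using L ran by (auto simp: M.limitin_metric_dist_null)
    then show "\<exists>x. limitin M.mtopology \<sigma> x sequentially"
      using M.MCauchy_convergent_subsequence[OF C M] by blast
  qed
qed

section \<open>Compactness of convolution followed by multiplication\<close>

lemma Lp_le_indicator:
  fixes A :: "(real^'n) set"
  assumes p: "1 \<le> p" and A [measurable]: "A \<in> sets borel" "emeasure lborel A < top"
  shows "Lp_le p (indicator A) (1 + measure lborel A)"
  using p
proof (cases rule: exponent_cases)
  case infinity
  have "cmod (indicator A x) \<le> 1 + measure lborel A" for x
    by (auto split: split_indicator intro: add_increasing2)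
  then show ?thesis by (simp add: infinity Lp_le_top)
next
  case (real r)
  have "ennreal (cmod (indicator A x) powr r) = indicator A x" for x
    by (simp split: split_indicator)
  then have "(\<integral>\<^sup>+x. ennreal (cmod (indicator A x) powr r) \<partial>lborel) = ennreal (measure lborel A)"
    using A by (simp add: emeasure_eq_ennreal_measure)
  also have "\<dots> \<le> ennreal ((1 + measure lborel A) powr 1)" by (intro ennreal_leI) simp
  also have "\<dots> \<le> ennreal ((1 + measure lborel A) powr r)"
    using real by (intro ennreal_leI powr_mono) auto
  finally show ?thesis using real by (simp add: Lp_le_real)
qed

lemma Lp_le_of_indicator_bound:
  fixes f :: "real^'n \<Rightarrow> complex"
  assumes p: "1 \<le> p" and A: "A \<in> sets borel" "emeasure lborel A < top" and "f \<in> borel_measurable borel"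
    and a: "0 \<le> a" "\<And>x. cmod (f x) \<le> a * indicator A x"
  shows "Lp_le p f (a * (1 + measure lborel A))"
proof -
  have "Lp_le p (\<lambda>x. complex_of_real a * indicator A x) (cmod (complex_of_real a) * (1 + measure lborel A))"
    by (rule Lp_le_cmult[OF p Lp_le_indicator[OF p A]])
  then have "Lp_le p f (cmod (complex_of_real a) * (1 + measure lborel A))"
  proof (rule Lp_le_AE_mono[OF p _ assms(4)], intro AE_I2)
    fix x
    have "cmod (complex_of_real a * indicator A x) = a * indicator A x"
      using a(1) by (simp add: norm_mult split: split_indicator)
    then show "cmod (f x) \<le> cmod (complex_of_real a * indicator A x)" using a(2) by metis
  qed
  then show ?thesis using a by simp
qed

text \<open>Total boundedness with the centres of the nets anywhere in \<open>L\<^sup>q\<close>, not necessarily in the set. This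
form is easier to establish, and it agrees with total boundedness in the metric sense.\<close>

definition relcompact :: "ennreal \<Rightarrow> 'n::finite L0 set \<Rightarrow> bool" where
  "relcompact q S \<longleftrightarrow> S \<subseteq> Lp q \<and>
     (\<forall>\<epsilon>>0. \<exists>F\<subseteq>Lp q. finite F \<and> (\<forall>s\<in>S. \<exists>f\<in>F. Lp_norm q (s - f) \<le> \<epsilon>))"

lemma mtotally_bounded_Lp:
  assumes q: "1 \<le> q"
  shows "Metric_space.mtotally_bounded (Lp q) (\<lambda>f g. Lp_norm q (f - g)) S \<longleftrightarrow> relcompact q S"
proof -
  interpret M: Metric_space "Lp q" "\<lambda>f g. Lp_norm q (f - g)" by (rule Metric_space_Lp[OF q])
  show ?thesis
  proof
    assume tb: "M.mtotally_bounded S"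
    show "relcompact q S"
      unfolding relcompact_def
    proof (intro conjI allI impI)
      show "S \<subseteq> Lp q" by (rule M.mtotally_bounded_imp_subset[OF tb])
      fix \<epsilon> :: real assume "0 < \<epsilon>"
      then have "\<exists>F. finite F \<and> F \<subseteq> S \<and> S \<subseteq> (\<Union>x\<in>F. M.mball x \<epsilon>)"
        by (rule tb[unfolded M.mtotally_bounded_def, rule_format])
      then obtain F where F: "finite F" "F \<subseteq> S" "S \<subseteq> (\<Union>x\<in>F. M.mball x \<epsilon>)" by (elim exE conjE)
      have "\<exists>f\<in>F. Lp_norm q (s - f) \<le> \<epsilon>" if "s \<in> S" for s
      proof -
        from that F obtain f where "f \<in> F" "Lp_norm q (f - s) < \<epsilon>" by (auto simp: M.in_mball)
        then show ?thesis unfolding Lp_norm_minus_commute[of q s] by (blast intro: less_imp_le)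
      qed
      then show "\<exists>F\<subseteq>Lp q. finite F \<and> (\<forall>s\<in>S. \<exists>f\<in>F. Lp_norm q (s - f) \<le> \<epsilon>)"
        using F \<open>S \<subseteq> Lp q\<close> by (intro exI[of _ F]) auto
    qed
  next
    assume rc: "relcompact q S"
    then have S: "S \<subseteq> Lp q" by (simp add: relcompact_def)
    show "M.mtotally_bounded S"
      unfolding M.mtotally_bounded_def
    proof (intro allI impI)
      fix \<epsilon> :: real assume "0 < \<epsilon>"
      then have "0 < \<epsilon> / 3" by simp
      with rc obtain F where F: "F \<subseteq> Lp q" "finite F" "\<And>s. s \<in> S \<Longrightarrow> \<exists>f\<in>F. Lp_norm q (s - f) \<le> \<epsilon> / 3" 
        unfolding relcompact_def by meson
      define F' where "F' = {f \<in> F. \<exists>s\<in>S. Lp_norm q (s - f) \<le> \<epsilon> / 3}"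
      define c where "c f = (SOME s. s \<in> S \<and> Lp_norm q (s - f) \<le> \<epsilon> / 3)" for f
      have c: "c f \<in> S \<and> Lp_norm q (c f - f) \<le> \<epsilon> / 3" if "f \<in> F'" for f
        unfolding c_def by (rule someI_ex) (use that in \<open>auto simp: F'_def\<close>)
      have "s \<in> (\<Union>x\<in>c ` F'. M.mball x \<epsilon>)" if s: "s \<in> S" for s
      proof -
        from F(3)[OF s] obtain f where f: "f \<in> F" "Lp_norm q (s - f) \<le> \<epsilon> / 3" by blast
        then have f': "f \<in> F'" using s by (auto simp: F'_def)
        have "Lp_norm q (c f - s) \<le> Lp_norm q (c f - f) + Lp_norm q (f - s)"
          by (rule Lp_norm_triangle[OF q]) (use c[OF f'] S s f F in auto)
        also have "\<dots> < \<epsilon>" using c[OF f'] f \<open>0 < \<epsilon>\<close> Lp_norm_minus_commute[of q f s] by simp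
        finally have "s \<in> M.mball (c f) \<epsilon>" using c[OF f'] s S by (auto simp: M.in_mball)
        then show ?thesis using f' by blast
      qed
      then show "\<exists>K. finite K \<and> K \<subseteq> S \<and> S \<subseteq> (\<Union>x\<in>K. M.mball x \<epsilon>)"
        using c F(2) by (intro exI[of _ "c ` F'"]) (auto simp: F'_def)
    qed
  qed
qed

lemma relcompact_approx:
  assumes q: "1 \<le> q" and S: "S \<subseteq> Lp q"
    and T: "\<And>\<epsilon>::real. 0 < \<epsilon> \<Longrightarrow> \<exists>T. relcompact q T \<and> (\<forall>s\<in>S. \<exists>t\<in>T. Lp_norm q (s - t) \<le> \<epsilon>)"
  shows "relcompact q S"
  unfolding relcompact_def
proof (intro conjI allI impI S)
  fix \<epsilon> :: real assume "0 < \<epsilon>"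
  then have e: "0 < \<epsilon> / 2" by simp
  from T[OF e] obtain T where T: "relcompact q T" "\<And>s. s \<in> S \<Longrightarrow> \<exists>t\<in>T. Lp_norm q (s - t) \<le> \<epsilon> / 2" by blast
  from T(1) e obtain F where F: "F \<subseteq> Lp q" "finite F" "\<And>t. t \<in> T \<Longrightarrow> \<exists>f\<in>F. Lp_norm q (t - f) \<le> \<epsilon> / 2"
    unfolding relcompact_def by meson
  have "\<exists>f\<in>F. Lp_norm q (s - f) \<le> \<epsilon>" if s: "s \<in> S" for s
  proof -
    from T(2)[OF s] obtain t where t: "t \<in> T" "Lp_norm q (s - t) \<le> \<epsilon> / 2" by blast
    from F(3)[OF t(1)] obtain f where f: "f \<in> F" "Lp_norm q (t - f) \<le> \<epsilon> / 2" by blast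
    have "Lp_norm q (s - f) \<le> Lp_norm q (s - t) + Lp_norm q (t - f)"
      by (rule Lp_norm_triangle[OF q]) (use s t f S F T(1) in \<open>auto simp: relcompact_def\<close>)
    then show ?thesis using t f by (intro bexI[of _ f]) auto
  qed
  then show "\<exists>F\<subseteq>Lp q. finite F \<and> (\<forall>s\<in>S. \<exists>f\<in>F. Lp_norm q (s - f) \<le> \<epsilon>)"
    using F by (intro exI[of _ F]) auto
qed

text \<open>Uniform estimates for translates of a mollifier as long as the translations stay in a ball; the
indicator records that the translates then live in a common larger ball.\<close>

lemma mollifier_bounds:
  fixes x y z :: "real^'n" and j :: nat
  defines "c \<equiv> (LINT y|lborel. tent j (y :: real^'n))"
  assumes z: "norm x \<le> R + 1" "norm y \<le> R + 1"
  shows "cmod (mollifier j (x - z)) \<le> 1 / c * indicator (cball 0 (R + 2)) z"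
    and "cmod (mollifier j (x - z) - mollifier j (y - z)) \<le> real (Suc j) / c * norm (x - y) * indicator (cball 0 (R + 2)) z"
proof -
  have c: "0 < c" unfolding c_def by (rule tent_integral_pos)
  have far: "tent j (w - z) = 0" if "R + 2 < norm z" "norm w \<le> R + 1" for w :: "real^'n"
  proof (rule tent_eq_0)
    have "1 \<le> norm (w - z)" using that norm_triangle_ineq3[of w z] by linarith
    then have "1 * 1 \<le> real (Suc j) * norm (w - z)" by (intro mult_mono) auto
    then show "1 \<le> real (Suc j) * norm (w - z)" by simp
  qed
  show "cmod (mollifier j (x - z)) \<le> 1 / c * indicator (cball 0 (R + 2)) z"
    using far[of x] z c tent_le_1[of j "x - z"] by (auto simp: cmod_mollifier c_def[symmetric] divide_right_mono not_le split: split_indicator)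
  have "mollifier j (x - z) - mollifier j (y - z) = complex_of_real ((tent j (x - z) - tent j (y - z)) / c)"
    by (simp add: mollifier_def c_def diff_divide_distrib)
  then have "cmod (mollifier j (x - z) - mollifier j (y - z)) = \<bar>tent j (x - z) - tent j (y - z)\<bar> / c"
    using c by (simp del: of_real_divide of_real_diff)
  also have "\<dots> \<le> real (Suc j) / c * norm (x - y) * indicator (cball 0 (R + 2)) z"
  proof (cases "norm z \<le> R + 2")
    case True
    have "\<bar>tent j (x - z) - tent j (y - z)\<bar> / c \<le> real (Suc j) * norm ((x - z) - (y - z)) / c"
      using c by (intro divide_right_mono tent_Lipschitz) auto
    then show ?thesis using True by simp
  qed (use far[of x] far[of y] z in \<open>simp\<close>)
  finally show "cmod (mollifier j (x - z) - mollifier j (y - z)) \<le> real (Suc j) / c * norm (x - y) * indicator (cball 0 (R + 2)) z" .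
qed

text \<open>Mollifications of the functions in a ball of \<open>L\<^sup>q\<close> are uniformly bounded and uniformly Lipschitz on
bounded sets.\<close>

lemma mollified_bounds:
  fixes \<phi> :: "real^'n \<Rightarrow> complex" and x y :: "real^'n" and j :: nat and R :: real
  assumes pq: "conjugate p q" and \<phi>: "Lp_le q \<phi> C"
  defines "c \<equiv> (LINT y|lborel. tent j (y :: real^'n))"
    and "D \<equiv> 1 + measure lborel (cball (0 :: real^'n) (R + 2))"
  assumes x: "norm x \<le> R + 1" "norm y \<le> R + 1"
  shows "cmod (convolve (mollifier j) \<phi> x) \<le> 1 / c * D * C"
    and "cmod (convolve (mollifier j) \<phi> x - convolve (mollifier j) \<phi> y) \<le> real (Suc j) / c * norm (x - y) * D * C"
proof -
  have c: "0 < c" unfolding c_def by (rule tent_integral_pos)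
  have [measurable]: "\<phi> \<in> borel_measurable borel" using Lp_leD[OF \<phi>] by simp
  have fin: "emeasure lborel (cball (0 :: real^'n) (R + 2)) < top"
    using emeasure_bounded_finite[of "cball (0 :: real^'n) (R + 2)"] by simp
  note p = conjugate_ge1(1)[OF pq]
  have k: "Lp_le p (\<lambda>z. mollifier j (x - z)) (1 / c * D)" if "norm x \<le> R + 1" for x :: "real^'n"
    unfolding D_def by (rule Lp_le_of_indicator_bound[OF p _ fin])
      (use c mollifier_bounds(1)[OF that that, of j] in \<open>auto simp: c_def\<close>)
  have d: "Lp_le p (\<lambda>z. mollifier j (x - z) - mollifier j (y - z)) (real (Suc j) / c * norm (x - y) * D)"
    unfolding D_def by (rule Lp_le_of_indicator_bound[OF p _ fin])
      (use c mollifier_bounds(2)[OF x, of j] in \<open>auto simp: c_def\<close>)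
  have eq: "convolve (mollifier j) \<phi> x = (LINT z|lborel. mollifier j (x - z) * \<phi> z)" for x
    by (subst convolve_commute) (auto simp: convolve_def mult.commute)
  show "cmod (convolve (mollifier j) \<phi> x) \<le> 1 / c * D * C"
    unfolding eq by (rule Hoelder_integrable(2)[OF pq k[OF x(1)] \<phi>])
  have "convolve (mollifier j) \<phi> x - convolve (mollifier j) \<phi> y =
    (LINT z|lborel. (mollifier j (x - z) - mollifier j (y - z)) * \<phi> z)"
    unfolding eq left_diff_distrib
    by (rule Bochner_Integration.integral_diff[symmetric])
      (rule Hoelder_integrable(1)[OF pq k \<phi>], rule x)+
  then show "cmod (convolve (mollifier j) \<phi> x - convolve (mollifier j) \<phi> y) \<le> real (Suc j) / c * norm (x - y) * D * C"
    using Hoelder_integrable(2)[OF pq d \<phi>] by simp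
qed

text \<open>A quantitative Arzela-Ascoli argument. The ball of radius \<open>R\<close> is covered by finitely many small balls
with centres \<open>cs\<close>, and the disc in which the mollifications take their values by finitely many small
discs with centres \<open>Z\<close>. A mollification is close to a step function that takes, at \<open>x\<close>, a value of \<open>Z\<close>
which belongs to the first centre near \<open>x\<close>; there are only finitely many such step functions.\<close>

lemma relcompact_localised_mollification:
  fixes g :: "real^'n \<Rightarrow> complex"
  assumes pq: "conjugate p q" and g [measurable]: "g \<in> borel_measurable borel" 
    and B: "\<And>x. cmod (g x) \<le> B" and supp: "\<And>x. R < norm x \<Longrightarrow> g x = 0" and C: "0 \<le> C"
  shows "relcompact q ((\<lambda>\<Phi>. class_L0 g * conv (moll j) \<Phi>) ` {\<Phi> \<in> Lp q. Lp_norm q \<Phi> \<le> C})"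
  unfolding relcompact_def
proof (intro conjI allI impI)
  note q = conjugate_ge1(2)[OF pq]
  show "(\<lambda>\<Phi>. class_L0 g * conv (moll j) \<Phi>) ` {\<Phi> \<in> Lp q. Lp_norm q \<Phi> \<le> C} \<subseteq> Lp q"
    by (auto intro!: Lp_mult_bounded[OF q g B] Lp_conv_moll q)
  fix \<epsilon> :: real assume "0 < \<epsilon>"
  have B0: "0 \<le> B" using B[of 0] norm_ge_zero order_trans by blast
  define c where "c = (LINT y|lborel. tent j (y :: real^'n))"
  have c: "0 < c" unfolding c_def by (rule tent_integral_pos)
  define D where "D = 1 + measure lborel (cball (0 :: real^'n) (R + 2))"
  have D: "1 \<le> D" by (simp add: D_def)
  \<comment> \<open>Chosen such that an error of \<open>2 * \<delta>\<close> in the values of the mollification costs at most \<open>\<epsilon>\<close> in norm.\<close>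
  define \<delta> where "\<delta> = \<epsilon> / (2 * (B + 1) * D)"
  have \<delta>: "0 < \<delta>" using \<open>0 < \<epsilon>\<close> B0 D by (simp add: \<delta>_def)
  define L where "L = real (Suc j) / c * D * C"
  have L: "0 \<le> L" using c D C by (simp add: L_def)
  define \<rho> where "\<rho> = min 1 (\<delta> / (L + 1))"
  have \<rho>: "0 < \<rho>" "\<rho> \<le> 1" "L * \<rho> \<le> \<delta>"
  proof -
    show "0 < \<rho>" "\<rho> \<le> 1" using \<delta> L by (auto simp: \<rho>_def)
    have "L * \<rho> \<le> (L + 1) * (\<delta> / (L + 1))" using L \<delta> by (intro mult_mono) (auto simp: \<rho>_def)
    then show "L * \<rho> \<le> \<delta>" using L by simp
  qed
  obtain X where X: "finite X" "cball (0 :: real^'n) R \<subseteq> (\<Union>x\<in>X. ball x \<rho>)"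
    using compact_cball[of "0 :: real^'n" R] \<rho>(1) unfolding compact_eq_totally_bounded by blast
  obtain Z where Z: "finite Z" "cball (0 :: complex) (1 / c * D * C) \<subseteq> (\<Union>z\<in>Z. ball z \<delta>)"
    using compact_cball[of "0 :: complex" "1 / c * D * C"] \<delta> unfolding compact_eq_totally_bounded by blast
  obtain cs where cs: "set cs = {x \<in> X. norm x \<le> R + 1}" using finite_list[of "{x \<in> X. norm x \<le> R + 1}"] X by auto
  \<comment> \<open>Taking the first centre near \<open>x\<close> makes the selection measurable.\<close>
  define idx where "idx x = (LEAST i. dist (cs ! i) x < \<rho>)" for x
  have idx [measurable]: "idx \<in> measurable borel (count_space UNIV)" unfolding idx_def by measurable
  have idx_less: "idx x < length cs \<and> dist (cs ! idx x) x < \<rho>" if "norm x \<le> R" for x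
  proof -
    from that X obtain y where y: "y \<in> X" "dist y x < \<rho>" by (auto simp: subset_iff)
    have "norm y \<le> norm x + dist y x" by (metis add.commute dist_commute dist_norm norm_triangle_sub)
    then have "y \<in> set cs" using y that \<rho> cs by auto
    then obtain i where i: "i < length cs" "cs ! i = y" by (auto simp: in_set_conv_nth)
    then have *: "dist (cs ! i) x < \<rho>" using y by simp
    have "idx x \<le> i" unfolding idx_def by (rule Least_le) (rule *)
    moreover have "dist (cs ! idx x) x < \<rho>" unfolding idx_def by (rule LeastI) (rule *)
    ultimately show ?thesis using i by simp
  qed
  define step where "step zs x = g x * zs ! idx x" for zs and x :: "real^'n"
  have mstep [measurable]: "step zs \<in> borel_measurable borel" for zs
  proof -
    have "(\<lambda>x. zs ! idx x) \<in> borel_measurable borel"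
      by (rule measurable_compose[OF idx]) simp
    then show ?thesis unfolding step_def by (intro borel_measurable_times g)
  qed
  define F where "F = (\<lambda>zs. class_L0 (step zs)) ` {zs. set zs \<subseteq> Z \<and> length zs = length cs}"
  have fin: "emeasure lborel (cball (0 :: real^'n) (R + 2)) < top"
    using emeasure_bounded_finite[of "cball (0 :: real^'n) (R + 2)"] by simp
  have FLp: "F \<subseteq> Lp q"
  proof -
    have "class_L0 (step zs) \<in> Lp q" if zs: "set zs \<subseteq> Z" "length zs = length cs" for zs
    proof -
      define m where "m = (\<Sum>z\<in>Z. cmod z)"
      have m: "cmod z \<le> m" if "z \<in> Z" for z using that Z(1) unfolding m_def by (intro member_le_sum) auto
      have m0: "0 \<le> m" by (simp add: m_def sum_nonneg)
      have "cmod (step zs x) \<le> (B * m) * indicator (cball 0 (R + 2)) x" for x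
      proof (cases "norm x \<le> R")
        case True
        have "zs ! idx x \<in> Z" using idx_less[OF True] zs by (auto simp: subset_iff)
        then have "cmod (step zs x) \<le> B * m" unfolding step_def norm_mult by (intro mult_mono B m B0) auto
        then show ?thesis using True by simp
      qed (use supp B0 m0 in \<open>simp add: step_def\<close>)
      then show ?thesis using B0 m0
        by (intro Lp_le_imp_Lp(1)[OF q Lp_le_of_indicator_bound[OF q _ fin mstep, where a="B * m"]]) auto
    qed
    then show ?thesis by (auto simp: F_def)
  qed
  have finF: "finite F" unfolding F_def by (intro finite_imageI finite_lists_length_eq Z)
  have "\<exists>f\<in>F. Lp_norm q (class_L0 g * conv (moll j) \<Phi> - f) \<le> \<epsilon>" if \<Phi>: "\<Phi> \<in> Lp q" "Lp_norm q \<Phi> \<le> C" for \<Phi>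
  proof -
    from Lp_cases[OF q \<Phi>(1)] obtain \<phi> where \<phi>: "\<Phi> = class_L0 \<phi>" "Lp_le q \<phi> (Lp_norm q \<Phi>)" "\<phi> \<in> borel_measurable borel" .
    note [measurable] = \<phi>(3)
    have \<phi>C: "Lp_le q \<phi> C" by (rule Lp_le_mono_bound[OF q \<phi>(2) \<Phi>(2)])
    define E where "E = convolve (mollifier j) \<phi>"
    have [measurable]: "E \<in> borel_measurable borel" unfolding E_def by measurable
    define near where "near w = (SOME z. z \<in> Z \<and> dist z (E w) < \<delta>)" for w
    have near: "near w \<in> Z \<and> dist (near w) (E w) < \<delta>" if "norm w \<le> R + 1" for w
      unfolding near_def
    proof (rule someI_ex)
      have "E w \<in> cball 0 (1 / c * D * C)"
        using mollified_bounds(1)[OF pq \<phi>C that that, of j] by (simp add: E_def c_def D_def)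
      then show "\<exists>z. z \<in> Z \<and> dist z (E w) < \<delta>" using Z(2) by (auto simp: subset_iff)
    qed
    define zs where "zs = map near cs"
    have csR: "norm (cs ! i) \<le> R + 1" if "i < length cs" for i using that cs nth_mem by blast
    have "class_L0 (step zs) \<in> F" unfolding F_def zs_def by (rule imageI) (use near cs in auto)
    moreover have "Lp_norm q (class_L0 g * conv (moll j) \<Phi> - class_L0 (step zs)) \<le> \<epsilon>"
    proof -
      have "cmod (g x * E x - step zs x) \<le> (2 * \<delta> * B) * indicator (cball 0 (R + 2)) x" for x
      proof (cases "norm x \<le> R")
        case True
        define w where "w = cs ! idx x"
        have w: "norm w \<le> R + 1" "dist w x < \<rho>" "zs ! idx x = near w"
          using idx_less[OF True] csR by (auto simp: w_def zs_def)
        have "cmod (E x - E w) \<le> L * norm (x - w)"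
          using mollified_bounds(2)[OF pq \<phi>C, of x R w j] True w by (simp add: E_def c_def D_def L_def ac_simps)
        also have "\<dots> \<le> L * \<rho>" using w(2) L by (intro mult_left_mono) (auto simp: dist_norm norm_minus_commute)
        also have "\<dots> \<le> \<delta>" by (rule \<rho>(3))
        finally have 1: "cmod (E x - E w) \<le> \<delta>" .
        have 2: "cmod (E w - near w) \<le> \<delta>" using near[OF w(1)] by (simp add: dist_norm norm_minus_commute)
        have "cmod (E x - near w) \<le> 2 * \<delta>" using norm_triangle_mono[OF 1 2] by simp
        then have "cmod (g x) * cmod (E x - near w) \<le> B * (2 * \<delta>)" by (intro mult_mono B B0) auto
        moreover have "cmod (g x * E x - step zs x) = cmod (g x) * cmod (E x - near w)"
          by (simp only: step_def w(3) right_diff_distrib[symmetric] norm_mult)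
        ultimately show ?thesis using True by (simp add: ac_simps)
      qed (use supp B0 \<delta> in \<open>simp add: step_def\<close>)
      then have "Lp_le q (\<lambda>x. g x * E x - step zs x) (2 * \<delta> * B * D)"
        unfolding D_def using B0 \<delta> by (intro Lp_le_of_indicator_bound[OF q _ fin]) auto
      moreover have "2 * \<delta> * B * D \<le> \<epsilon>" 
      proof -
        have "2 * \<delta> * B * D \<le> 2 * \<delta> * (B + 1) * D" using \<delta> D B0 by (intro mult_right_mono mult_left_mono) auto
        also have "\<dots> = \<delta> * (2 * (B + 1) * D)" by (simp add: ac_simps)
        also have "\<dots> = \<epsilon>"
        proof -
          have "2 * (B + 1) * D \<noteq> 0" using B0 D by simp
          then show ?thesis unfolding \<delta>_def by (rule nonzero_eq_divide_eq[THEN iffD1]) simp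
        qed
        finally show ?thesis .
      qed
      ultimately have "Lp_le q (\<lambda>x. g x * E x - step zs x) \<epsilon>" by (rule Lp_le_mono_bound[OF q])
      moreover have "class_L0 g * conv (moll j) \<Phi> - class_L0 (step zs) = class_L0 (\<lambda>x. g x * E x - step zs x)"
        by (simp add: \<phi>(1) moll_def class_L0_conv class_L0_times class_L0_minus E_def[symmetric])
      ultimately show ?thesis using Lp_le_imp_Lp(2)[OF q] by simp
    qed
    ultimately show ?thesis by blast
  qed
  then show "\<exists>F\<subseteq>Lp q. finite F \<and>
      (\<forall>s\<in>(\<lambda>\<Phi>. class_L0 g * conv (moll j) \<Phi>) ` {\<Phi> \<in> Lp q. Lp_norm q \<Phi> \<le> C}. \<exists>f\<in>F. Lp_norm q (s - f) \<le> \<epsilon>)"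
    using FLp finF by (intro exI[of _ F]) auto
qed

lemma C0_measurable: "g \<in> C0 \<Longrightarrow> g \<in> borel_measurable borel"
  by (auto simp: C0_def intro: borel_measurable_continuous_onI)

lemma C0_small: 
  assumes "g \<in> C0" "0 < \<eta>" obtains R where "\<And>x. R < norm x \<Longrightarrow> cmod (g x) \<le> \<eta>"
proof -
  have "\<forall>\<^sub>F x in at_infinity. dist (g x) 0 < \<eta>"
    using assms by (auto simp: C0_def dest: tendstoD)
  then obtain R where "\<And>x. R \<le> norm x \<Longrightarrow> dist (g x) 0 < \<eta>" by (auto simp: eventually_at_infinity)
  then show ?thesis by (intro that[of R]) (auto simp: less_imp_le)
qed

lemma C0_bounded:
  assumes "g \<in> C0" obtains B where "\<And>x. cmod (g x) \<le> B"
proof -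
  from C0_small[OF assms, of 1] obtain R where R: "\<And>x. R < norm x \<Longrightarrow> cmod (g x) \<le> 1" by auto
  have "compact (g ` cball 0 R)"
    using assms by (intro compact_continuous_image compact_cball) (auto simp: C0_def intro: continuous_on_subset)
  then obtain b where b: "\<And>x. norm x \<le> R \<Longrightarrow> cmod (g x) \<le> b" using compact_imp_bounded bounded_iff by (metis imageI mem_cball_0)
  show ?thesis by (rule that[of "max 1 b"]) (meson R b le_max_iff_disj not_le)
qed

text \<open>The image of the unit ball under \<open>\<Phi> \<mapsto> g (H * \<Phi>)\<close>. Replacing \<open>g\<close> by its restriction to a large ball and
\<open>H\<close> by \<open>e\<^sub>j * H\<close> changes the operator by little in norm, and the modified operator is covered by
\<open>relcompact_localised_mollification\<close>.\<close>

lemma relcompact_conv_mult: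
  fixes H :: "'n::finite L0"
  assumes pq: "conjugate p q" and g: "g \<in> C0" and H: "H \<in> Lp 1"
  shows "relcompact q ((\<lambda>\<Phi>. class_L0 g * conv H \<Phi>) ` {\<Phi> \<in> Lp q. Lp_norm q \<Phi> \<le> 1})"
proof -
  note q = conjugate_ge1(2)[OF pq]
  note gm [measurable] = C0_measurable[OF g]
  from C0_bounded[OF g] obtain B where B: "\<And>x. cmod (g x) \<le> B" by blast
  have B0: "0 \<le> B" using B[of 0] norm_ge_zero order_trans by blast
  let ?S = "(\<lambda>\<Phi>. class_L0 g * conv H \<Phi>) ` {\<Phi> \<in> Lp q. Lp_norm q \<Phi> \<le> 1}"
  show ?thesis
  proof (rule relcompact_approx[OF q])
    show "?S \<subseteq> Lp q" by (auto intro!: Lp_mult_bounded[OF q gm B] Lp_conv q H)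
    fix \<epsilon> :: real assume "0 < \<epsilon>"
    define \<eta> where "\<eta> = \<epsilon> / 2 / (Lp_norm 1 H + 1)"
    have \<eta>: "0 < \<eta>" "\<eta> * Lp_norm 1 H \<le> \<epsilon> / 2" 
      using \<open>0 < \<epsilon>\<close> Lp_norm_nonneg[of 1 H] by (auto simp: \<eta>_def field_simps add_pos_nonneg)
    from C0_small[OF g \<eta>(1)] obtain R where R: "\<And>x. R < norm x \<Longrightarrow> cmod (g x) \<le> \<eta>" by blast
    define gR where "gR x = indicator (cball 0 R) x * g x" for x
    have gRm [measurable]: "gR \<in> borel_measurable borel"
      unfolding gR_def by (intro borel_measurable_times borel_measurable_indicator gm) auto
    have gRB: "cmod (gR x) \<le> B" for x using B[of x] B0 by (auto simp: gR_def norm_mult split: split_indicator)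
    have gR: "cmod (g x - gR x) \<le> \<eta>" for x using R[of x] \<eta>(1) by (auto simp: gR_def split: split_indicator)
    have "0 < \<epsilon> / 2 / (B + 1)" using \<open>0 < \<epsilon>\<close> B0 by simp
    then have "\<forall>\<^sub>F j in sequentially. Lp_norm (ennreal 1) (conv (moll j) H - H) \<le> \<epsilon> / 2 / (B + 1)"
      using H by (intro conv_moll_tendsto) auto
    then obtain j where j: "Lp_norm 1 (conv (moll j) H - H) \<le> \<epsilon> / 2 / (B + 1)"
      by (auto simp: eventually_sequentially)
    have HH: "conv (moll j) H \<in> Lp 1" by (rule Lp_conv_moll[OF order_refl H])
    let ?T = "(\<lambda>\<Psi>. class_L0 gR * conv (moll j) \<Psi>) ` {\<Psi> \<in> Lp q. Lp_norm q \<Psi> \<le> Lp_norm 1 H}"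
    have "relcompact q ?T"
      by (rule relcompact_localised_mollification[OF pq gRm gRB, where R=R]) (auto simp: gR_def)
    moreover have "\<exists>t\<in>?T. Lp_norm q (s - t) \<le> \<epsilon>" if "s \<in> ?S" for s
    proof -
      from that obtain \<Phi> where \<Phi>: "\<Phi> \<in> Lp q" "Lp_norm q \<Phi> \<le> 1" "s = class_L0 g * conv H \<Phi>" by auto
      define \<Psi> where "\<Psi> = conv H \<Phi>"
      have \<Psi>: "\<Psi> \<in> Lp q" unfolding \<Psi>_def by (rule Lp_conv(1)[OF q H \<Phi>(1)])
      have "Lp_norm q \<Psi> \<le> Lp_norm 1 H * Lp_norm q \<Phi>" unfolding \<Psi>_def by (rule Lp_conv(2)[OF q H \<Phi>(1)])
      also have "\<dots> \<le> Lp_norm 1 H * 1" by (intro mult_left_mono \<Phi>) auto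
      finally have \<Psi>n: "Lp_norm q \<Psi> \<le> Lp_norm 1 H" by simp
      have e\<Psi>: "conv (moll j) \<Psi> \<in> Lp q" by (rule Lp_conv_moll[OF q \<Psi>])
      have "\<Psi> - conv (moll j) \<Psi> = conv (H - conv (moll j) H) \<Phi>"
        unfolding \<Psi>_def conv_diff_left[OF q H HH \<Phi>(1)] conv_assoc[OF q moll_Lp(1) H \<Phi>(1)] ..
      then have "Lp_norm q (\<Psi> - conv (moll j) \<Psi>) \<le> Lp_norm 1 (H - conv (moll j) H) * Lp_norm q \<Phi>"
        using Lp_conv(2)[OF q Lp_diff(1)[OF order_refl H HH] \<Phi>(1)] by simp
      also have "\<dots> \<le> Lp_norm 1 (H - conv (moll j) H) * 1" by (intro mult_left_mono \<Phi>) auto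
      also have "\<dots> \<le> \<epsilon> / 2 / (B + 1)" using j Lp_norm_minus_commute[of 1 H] by simp
      finally have d\<Psi>: "Lp_norm q (\<Psi> - conv (moll j) \<Psi>) \<le> \<epsilon> / 2 / (B + 1)" .
      have split: "s - class_L0 gR * conv (moll j) \<Psi> = class_L0 (\<lambda>x. g x - gR x) * \<Psi> + class_L0 gR * (\<Psi> - conv (moll j) \<Psi>)"
      proof -
        have "class_L0 g - class_L0 gR = class_L0 (\<lambda>x. g x - gR x)" by (rule class_L0_minus) measurable
        then show ?thesis by (simp add: \<Phi>(3) \<Psi>_def[symmetric] algebra_simps flip: \<open>class_L0 g - class_L0 gR = _\<close>)
      qed
      have 1: "class_L0 (\<lambda>x. g x - gR x) * \<Psi> \<in> Lp q" "Lp_norm q (class_L0 (\<lambda>x. g x - gR x) * \<Psi>) \<le> \<eta> * Lp_norm q \<Psi>"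
        by (rule Lp_mult_bounded[OF q _ gR \<Psi>]; measurable)+
      have 2: "class_L0 gR * (\<Psi> - conv (moll j) \<Psi>) \<in> Lp q" 
        "Lp_norm q (class_L0 gR * (\<Psi> - conv (moll j) \<Psi>)) \<le> B * Lp_norm q (\<Psi> - conv (moll j) \<Psi>)"
        by (rule Lp_mult_bounded[OF q _ gRB Lp_diff(1)[OF q \<Psi> e\<Psi>]]; measurable)+
      have "Lp_norm q (s - class_L0 gR * conv (moll j) \<Psi>) \<le> \<eta> * Lp_norm q \<Psi> + B * Lp_norm q (\<Psi> - conv (moll j) \<Psi>)"
        unfolding split using Lp_add(2)[OF q 1(1) 2(1)] 1(2) 2(2) by linarith
      also have "\<dots> \<le> \<eta> * Lp_norm 1 H + B * (\<epsilon> / 2 / (B + 1))"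
        using \<eta>(1) B0 by (intro add_mono mult_left_mono \<Psi>n d\<Psi>) auto
      also have "\<dots> \<le> \<epsilon> / 2 + \<epsilon> / 2"
        using \<eta>(2) B0 \<open>0 < \<epsilon>\<close> by (intro add_mono) (auto simp: field_simps)
      finally have "Lp_norm q (s - class_L0 gR * conv (moll j) \<Psi>) \<le> \<epsilon>" by simp
      then show ?thesis using \<Psi> \<Psi>n by blast
    qed
    ultimately show "\<exists>T. relcompact q T \<and> (\<forall>s\<in>?S. \<exists>t\<in>T. Lp_norm q (s - t) \<le> \<epsilon>)" by blast
  qed
qed

lemma compactin_Lp_bounded:
  assumes q: "1 \<le> q" and K: "compactin (Lp_topology q) K"
  obtains M where "0 \<le> M" "\<And>k. k \<in> K \<Longrightarrow> k \<in> Lp q \<and> Lp_norm q k \<le> M"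
proof -
  interpret M: Metric_space "Lp q" "\<lambda>f g. Lp_norm q (f - g)" by (rule Metric_space_Lp[OF q])
  have K: "compactin M.mtopology K" using K by (simp add: Lp_topology_def)
  then have "M.mbounded K" by (rule M.compactin_imp_mbounded)
  then obtain x r where xr: "K \<subseteq> M.mcball x r" unfolding M.mbounded_def by blast
  have "k \<in> Lp q \<and> Lp_norm q k \<le> \<bar>Lp_norm q x + r\<bar>" if "k \<in> K" for k
  proof -
    have k: "x \<in> Lp q" "k \<in> Lp q" "Lp_norm q (x - k) \<le> r" using xr that by (auto simp: M.in_mcball)
    have "Lp_norm q (x - (x - k)) \<le> Lp_norm q x + Lp_norm q (x - k)"
      by (rule Lp_diff(2)[OF q k(1) Lp_diff(1)[OF q k(1,2)]])
    then show ?thesis using k by simp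
  qed
  then show ?thesis using that[of "\<bar>Lp_norm q x + r\<bar>"] by simp
qed

text \<open>The suprema in the polar seminorms are suprema of sets of reals, hence meaningful only once they are
known to be bounded.\<close>

lemma bdd_above_pairing:
  assumes pq: "conjugate p q" and K: "compactin (Lp_topology q) K" and F: "F \<in> Lp p"
  shows "bdd_above ((\<lambda>k. cmod (pairing F k)) ` K)"
proof -
  from compactin_Lp_bounded[OF conjugate_ge1(2)[OF pq] K] 
  obtain M where M: "\<And>k. k \<in> K \<Longrightarrow> k \<in> Lp q \<and> Lp_norm q k \<le> M" by metis
  have "cmod (pairing F k) \<le> Lp_norm p F * M" if "k \<in> K" for k
  proof -
    have "cmod (pairing F k) \<le> Lp_norm p F * Lp_norm q k" using M that by (intro cmod_pairing_le[OF pq F]) auto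
    also have "\<dots> \<le> Lp_norm p F * M" using M that by (intro mult_left_mono) auto
    finally show ?thesis .
  qed
  then show ?thesis by (rule bdd_aboveI2)
qed

text \<open>By duality \<open>h * (g f)\<close> is tested against the unit ball of \<open>L\<^sup>q\<close>, and moving \<open>h\<close> and \<open>g\<close> to the other
side turns the unit ball into a relatively compact, absolutely convex set. Its closure is compact since
\<open>L\<^sup>q\<close> is complete.\<close>

proposition conv_mult_seminorm_le_polar:
  fixes h :: "'n::finite L0"
  assumes pq: "conjugate p q" "1 < p" and r: "q = ennreal r" "1 \<le> r" and g: "g \<in> C0" and h: "h \<in> Lp 1"
  shows "\<exists>K. K \<noteq> {} \<and> abs_convex K \<and> compactin (Lp_topology q) K \<and>
    (\<forall>f\<in>Lp p. Lp_norm p (conv h (class_L0 g * f)) \<le> (SUP k\<in>K. cmod (pairing f k)))"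
proof -
  note p = conjugate_ge1(1)[OF pq(1)] and q = conjugate_ge1(2)[OF pq(1)]
  note gm = C0_measurable[OF g]
  from C0_bounded[OF g] obtain B where B: "\<And>x. cmod (g x) \<le> B" by blast
  from pairing_conv_ex[OF h] obtain h' where h': "h' \<in> Lp 1" 
    and adj: "\<And>F K. F \<in> Lp p \<Longrightarrow> K \<in> Lp q \<Longrightarrow> pairing (conv h F) K = pairing F (conv h' K)"
    using pq(1) by blast
  define S where "S = (\<lambda>\<Phi>. class_L0 g * conv h' \<Phi>) ` {\<Phi> \<in> Lp q. Lp_norm q \<Phi> \<le> 1}"
  interpret M: Metric_space "Lp q :: 'n L0 set" "\<lambda>f g. Lp_norm q (f - g)" by (rule Metric_space_Lp[OF q])
  have S: "relcompact q S" unfolding S_def by (rule relcompact_conv_mult[OF pq(1) g h'])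
  define K where "K = M.mtopology closure_of S"
  have SLp: "S \<subseteq> Lp q" using S by (simp add: relcompact_def)
  have "M.mtotally_bounded S" using S mtotally_bounded_Lp[OF q] by blast
  then have comp: "compactin (Lp_topology q) K"
    using M.mtotally_bounded_eq_compact_closure_of[of S] mcomplete_Lp[OF r(2), where 'n='n]
    by (simp add: K_def Lp_topology_def r(1))
  have SK: "S \<subseteq> K" unfolding K_def by (rule closure_of_subset) (simp add: SLp)
  have "class_L0 g * conv h' 0 \<in> S" unfolding S_def by (rule imageI) (simp add: Lp_norm_0[OF q])
  then have ne: "K \<noteq> {}" using SK by blast
  have Kiff: "k \<in> K \<longleftrightarrow> k \<in> Lp q \<and> (\<forall>r>0. \<exists>s\<in>S. Lp_norm q (k - s) < r)" for k
    using SLp by (auto simp: K_def M.metric_closure_of M.in_mball subset_iff)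
  have convS: "a *\<^sub>C s + b *\<^sub>C t \<in> S" if st: "s \<in> S" "t \<in> S" and ab: "cmod a + cmod b \<le> 1" for s t a b
  proof -
    from st obtain \<Phi> \<Psi> where s: "\<Phi> \<in> Lp q" "Lp_norm q \<Phi> \<le> 1" "s = class_L0 g * conv h' \<Phi>"
      and t: "\<Psi> \<in> Lp q" "Lp_norm q \<Psi> \<le> 1" "t = class_L0 g * conv h' \<Psi>" unfolding S_def by auto
    have \<Phi>: "a *\<^sub>C \<Phi> \<in> Lp q" "Lp_norm q (a *\<^sub>C \<Phi>) = cmod a * Lp_norm q \<Phi>" using Lp_scaleC[OF q s(1)] by auto
    have \<Psi>: "b *\<^sub>C \<Psi> \<in> Lp q" "Lp_norm q (b *\<^sub>C \<Psi>) = cmod b * Lp_norm q \<Psi>" using Lp_scaleC[OF q t(1)] by auto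
    have "a *\<^sub>C s + b *\<^sub>C t = class_L0 g * conv h' (a *\<^sub>C \<Phi> + b *\<^sub>C \<Psi>)"
      by (simp add: s t conv_add_right[OF q h' \<Phi>(1) \<Psi>(1)] conv_scaleC_right distrib_left times_scaleC)
    moreover have "Lp_norm q (a *\<^sub>C \<Phi> + b *\<^sub>C \<Psi>) \<le> cmod a * Lp_norm q \<Phi> + cmod b * Lp_norm q \<Psi>"
      using Lp_add(2)[OF q \<Phi>(1) \<Psi>(1)] \<Phi> \<Psi> by simp
    moreover have "\<dots> \<le> cmod a * 1 + cmod b * 1" by (intro add_mono mult_left_mono s t) auto
    ultimately show ?thesis unfolding S_def using ab Lp_add(1)[OF q \<Phi>(1) \<Psi>(1)] by (intro image_eqI) auto
  qed
  have "abs_convex K"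
    unfolding abs_convex_def
  proof (intro ballI allI impI)
    fix x y a b assume xy: "x \<in> K" "y \<in> K" and ab: "cmod a + cmod b \<le> 1"
    have x: "x \<in> Lp q" and y: "y \<in> Lp q" using xy Kiff by auto
    have ab1: "cmod a \<le> 1" "cmod b \<le> 1" using ab norm_ge_zero[of a] norm_ge_zero[of b] by linarith+
    have "\<exists>s\<in>S. Lp_norm q (a *\<^sub>C x + b *\<^sub>C y - s) < e" if "0 < e" for e
    proof -
      have e: "0 < e / 2" using that by simp
      from xy(1) e obtain s where s: "s \<in> S" "Lp_norm q (x - s) < e / 2" unfolding Kiff by blast
      from xy(2) e obtain t where t: "t \<in> S" "Lp_norm q (y - t) < e / 2" unfolding Kiff by blast
      have dx: "x - s \<in> Lp q" and dy: "y - t \<in> Lp q" using x y s t SLp by (auto intro!: Lp_diff q)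
      have "a *\<^sub>C x + b *\<^sub>C y - (a *\<^sub>C s + b *\<^sub>C t) = a *\<^sub>C (x - s) + b *\<^sub>C (y - t)"
      proof -
        have "a *\<^sub>C x = a *\<^sub>C (x - s) + a *\<^sub>C s" "b *\<^sub>C y = b *\<^sub>C (y - t) + b *\<^sub>C t"
          by (simp_all flip: scaleC_add)
        then show ?thesis by simp
      qed
      then have "Lp_norm q (a *\<^sub>C x + b *\<^sub>C y - (a *\<^sub>C s + b *\<^sub>C t)) \<le> cmod a * Lp_norm q (x - s) + cmod b * Lp_norm q (y - t)"
        using Lp_add(2)[OF q Lp_scaleC(1)[OF q dx] Lp_scaleC(1)[OF q dy], of a b] Lp_scaleC(2)[OF q dx] Lp_scaleC(2)[OF q dy] by simp
      also have "\<dots> \<le> 1 * Lp_norm q (x - s) + 1 * Lp_norm q (y - t)" by (intro add_mono mult_right_mono ab1) auto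
      also have "\<dots> < e" using s t by simp
      finally show ?thesis using convS[OF s(1) t(1) ab] by blast
    qed
    then show "a *\<^sub>C x + b *\<^sub>C y \<in> K" unfolding Kiff using x y by (auto intro!: Lp_add Lp_scaleC q)
  qed
  moreover have "Lp_norm p (conv h (class_L0 g * f)) \<le> (SUP k\<in>K. cmod (pairing f k))" if f: "f \<in> Lp p" for f
  proof (rule Lp_norm_le_of_pairing[OF pq])
    have gf: "class_L0 g * f \<in> Lp p" by (rule Lp_mult_bounded(1)[OF p gm B f])
    show "conv h (class_L0 g * f) \<in> Lp p" by (rule Lp_conv(1)[OF p h gf])
    note bdd = bdd_above_pairing[OF pq(1) comp f]
    obtain k where "k \<in> K" using ne by blast
    then show "0 \<le> (SUP k\<in>K. cmod (pairing f k))" using bdd by (intro cSUP_upper2[where x=k]) auto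
    fix \<Phi> :: "'n L0" assume \<Phi>: "\<Phi> \<in> Lp q" "Lp_norm q \<Phi> \<le> 1"
    have "pairing (conv h (class_L0 g * f)) \<Phi> = pairing f (class_L0 g * conv h' \<Phi>)"
      by (simp add: adj[OF gf \<Phi>(1)] pairing_mult)
    moreover have "class_L0 g * conv h' \<Phi> \<in> K" using SK \<Phi> by (auto simp: S_def)
    ultimately show "cmod (pairing (conv h (class_L0 g * f)) \<Phi>) \<le> (SUP k\<in>K. cmod (pairing f k))"
      using bdd by (auto intro: cSUP_upper)
  qed
  ultimately show ?thesis using ne comp by blast
qed

section \<open>Cohen factorisation for compact sets\<close>

lemma relcompact_bounded:
  assumes q: "1 \<le> q" and K: "relcompact q K"
  obtains M where "0 \<le> M" "\<And>k. k \<in> K \<Longrightarrow> Lp_norm q k \<le> M"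
proof -
  from K obtain F where F: "F \<subseteq> Lp q" "finite F" "\<And>k. k \<in> K \<Longrightarrow> \<exists>f\<in>F. Lp_norm q (k - f) \<le> 1"
    unfolding relcompact_def by (meson zero_less_one)
  have "Lp_norm q k \<le> 1 + (\<Sum>f\<in>F. Lp_norm q f)" if k: "k \<in> K" for k
  proof -
    from F(3)[OF k] obtain f where f: "f \<in> F" "Lp_norm q (k - f) \<le> 1" by blast
    have "k - f \<in> Lp q" "f \<in> Lp q" using F f K k by (auto simp: relcompact_def intro!: Lp_diff q)
    then have "Lp_norm q k \<le> Lp_norm q (k - f) + Lp_norm q f" using Lp_add(2)[OF q, of "k - f" f] by simp
    also have "\<dots> \<le> 1 + (\<Sum>f\<in>F. Lp_norm q f)" using F f by (intro add_mono member_le_sum) auto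
    finally show ?thesis .
  qed
  then show ?thesis by (intro that[of "1 + (\<Sum>f\<in>F. Lp_norm q f)"]) (auto intro!: add_nonneg_nonneg sum_nonneg)
qed

text \<open>Equibounded linear operators that converge to \<open>0\<close> pointwise do so uniformly on relatively compact sets.\<close>

lemma relcompact_uniform:
  fixes T :: "nat \<Rightarrow> 'n::finite L0 \<Rightarrow> 'n L0"
  assumes q: "1 \<le> q" and K: "relcompact q K" and c: "0 \<le> c"
    and T: "\<And>n f. f \<in> Lp q \<Longrightarrow> T n f \<in> Lp q" "\<And>n f. f \<in> Lp q \<Longrightarrow> Lp_norm q (T n f) \<le> c * Lp_norm q f"
      "\<And>n f g. f \<in> Lp q \<Longrightarrow> g \<in> Lp q \<Longrightarrow> T n (f - g) = T n f - T n g"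
    and lim: "\<And>f \<epsilon>. f \<in> Lp q \<Longrightarrow> 0 < \<epsilon> \<Longrightarrow> \<forall>\<^sub>F n in sequentially. Lp_norm q (T n f) \<le> \<epsilon>"
    and e: "0 < \<epsilon>"
  shows "\<forall>\<^sub>F n in sequentially. \<forall>k\<in>K. Lp_norm q (T n k) \<le> \<epsilon>"
proof -
  define \<delta> where "\<delta> = \<epsilon> / 2 / (c + 1)"
  have \<delta>: "0 < \<delta>" "c * \<delta> \<le> \<epsilon> / 2" using e c by (auto simp: \<delta>_def field_simps)
  from K \<delta>(1) obtain F where F: "F \<subseteq> Lp q" "finite F" "\<And>k. k \<in> K \<Longrightarrow> \<exists>f\<in>F. Lp_norm q (k - f) \<le> \<delta>"
    unfolding relcompact_def by meson
  have "\<forall>\<^sub>F n in sequentially. \<forall>f\<in>F. Lp_norm q (T n f) \<le> \<epsilon> / 2"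
    using F e by (intro eventually_ball_finite ballI lim) auto
  then show ?thesis
  proof eventually_elim
    case (elim n)
    show ?case
    proof
      fix k assume k: "k \<in> K"
      from F(3)[OF k] obtain f where f: "f \<in> F" "Lp_norm q (k - f) \<le> \<delta>" by blast
      have kf: "k \<in> Lp q" "f \<in> Lp q" "k - f \<in> Lp q" using F f K k by (auto simp: relcompact_def intro!: Lp_diff q)
      have "Lp_norm q (T n k) \<le> Lp_norm q (T n (k - f)) + Lp_norm q (T n f)"
        using Lp_add(2)[OF q T(1)[OF kf(3), of n] T(1)[OF kf(2), of n]] by (simp add: T(3)[OF kf(1,2)])
      also have "\<dots> \<le> c * \<delta> + \<epsilon> / 2"
        using T(2)[OF kf(3), of n] mult_left_mono[OF f(2) c] elim f by (intro add_mono) auto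
      finally show "Lp_norm q (T n k) \<le> \<epsilon>" using \<delta> by simp
    qed
  qed
qed

lemma relcompact_image:
  assumes q: "1 \<le> q" and K: "relcompact q K" and c: "0 \<le> c"
    and T: "\<And>f. f \<in> Lp q \<Longrightarrow> T f \<in> Lp q" "\<And>f. f \<in> Lp q \<Longrightarrow> Lp_norm q (T f) \<le> c * Lp_norm q f"
      "\<And>f g. f \<in> Lp q \<Longrightarrow> g \<in> Lp q \<Longrightarrow> T (f - g) = T f - T g"
  shows "relcompact q (T ` K)"
  unfolding relcompact_def
proof (intro conjI allI impI)
  have KL: "K \<subseteq> Lp q" using K by (simp add: relcompact_def)
  then show "T ` K \<subseteq> Lp q" using T by auto
  fix \<epsilon> :: real assume "0 < \<epsilon>"
  then have \<delta>: "0 < \<epsilon> / (c + 1)" "c * (\<epsilon> / (c + 1)) \<le> \<epsilon>" using c by (auto simp: field_simps)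
  from K \<delta>(1) obtain F where F: "F \<subseteq> Lp q" "finite F" "\<And>k. k \<in> K \<Longrightarrow> \<exists>f\<in>F. Lp_norm q (k - f) \<le> \<epsilon> / (c + 1)"
    unfolding relcompact_def by meson
  have "\<exists>f\<in>T ` F. Lp_norm q (T k - f) \<le> \<epsilon>" if k: "k \<in> K" for k
  proof -
    from F(3)[OF k] obtain f where f: "f \<in> F" "Lp_norm q (k - f) \<le> \<epsilon> / (c + 1)" by blast
    have kf: "k \<in> Lp q" "f \<in> Lp q" "k - f \<in> Lp q" using F f KL k by (auto intro!: Lp_diff q)
    have "Lp_norm q (T k - T f) \<le> c * Lp_norm q (k - f)" using T(2)[OF kf(3)] T(3)[OF kf(1,2)] by simp
    also have "\<dots> \<le> \<epsilon>" using mult_left_mono[OF f(2) c] \<delta>(2) by simp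
    finally show ?thesis using f by blast
  qed
  then show "\<exists>F\<subseteq>Lp q. finite F \<and> (\<forall>s\<in>T ` K. \<exists>f\<in>F. Lp_norm q (s - f) \<le> \<epsilon>)"
    using F T by (intro exI[of _ "T ` F"]) auto
qed

lemma Lp_tail:
  fixes F :: "'n::finite L0"
  assumes r: "1 \<le> r" and F: "F \<in> Lp (ennreal r)" and e: "0 < \<epsilon>"
  shows "\<forall>\<^sub>F n in sequentially. Lp_norm (ennreal r) (class_L0 (indicator (- cball 0 (real n))) * F) \<le> \<epsilon>"
proof -
  have p: "1 \<le> ennreal r" using r by simp
  from Lp_cases[OF p F] obtain f where f: "F = class_L0 f" "Lp_le (ennreal r) f (Lp_norm (ennreal r) F)" "f \<in> borel_measurable borel" .
  have "\<forall>\<^sub>F n in sequentially. x \<notin> - cball 0 (real n)" for x :: "real^'n"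
  proof -
    obtain N where "norm x \<le> real N" using real_arch_simple by blast
    then have "x \<notin> - cball 0 (real n)" if "N \<le> n" for n using that by auto
    then show ?thesis unfolding eventually_sequentially by blast
  qed
  then have "\<forall>\<^sub>F n in sequentially. Lp_le (ennreal r) (\<lambda>x. indicator (- cball 0 (real n)) x * f x) \<epsilon>"
    by (intro Lp_le_vanishing[OF r f(2) _ _ e]) auto
  then show ?thesis
  proof eventually_elim
    case (elim n)
    have "class_L0 (indicator (- cball 0 (real n))) * F = class_L0 (\<lambda>x. indicator (- cball 0 (real n)) x * f x)"
      unfolding f(1) by (intro class_L0_times f(3) borel_measurable_indicator) auto
    then show ?case using Lp_le_imp_Lp(2)[OF p elim] by simp
  qed
qed

text \<open>The norms of the tails of all elements of \<open>K\<close> outside the ball of radius \<open>R\<^sub>j\<close> are at most \<open>2\<^sup>-\<^sup>j\<close>. The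
weight \<open>G = 1 + \<Sum>w\<^sub>j\<close>, where \<open>w\<^sub>j\<close> grows from \<open>0\<close> to \<open>1\<close> just outside that ball, therefore increases
the norms only by a convergent series. It tends to infinity, so \<open>g = 1/G\<close> vanishes at infinity.
The set \<open>G K\<close> is relatively compact because multiplication by the bounded partial sums of \<open>G\<close>
approximates multiplication by \<open>G\<close> uniformly on \<open>K\<close>.\<close>

lemma C0_factorisation:
  fixes K :: "'n::finite L0 set"
  assumes r: "1 \<le> r" and K: "relcompact (ennreal r) K"
  shows "\<exists>g\<in>C0. \<exists>K1. relcompact (ennreal r) K1 \<and> (\<forall>k\<in>K. \<exists>k1\<in>K1. k = class_L0 g * k1)"
proof -
  define q where "q = ennreal r"
  have q: "1 \<le> q" using r by (simp add: q_def)
  have KL: "K \<subseteq> Lp q" using K by (simp add: relcompact_def q_def)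
  let ?tail = "\<lambda>n. indicator (- cball 0 (real n)) :: real^'n \<Rightarrow> complex"
  have mtail: "?tail n \<in> borel_measurable borel" and btail: "cmod (?tail n x) \<le> 1" for n x
    by (auto split: split_indicator)
  have "\<forall>\<^sub>F n in sequentially. \<forall>k\<in>K. Lp_norm q (class_L0 (?tail n) * k) \<le> (1/2)^j" for j
  proof (rule relcompact_uniform[where c=1])
    show "relcompact q K" using K by (simp add: q_def)
    show "\<forall>\<^sub>F n in sequentially. Lp_norm q (class_L0 (?tail n) * f) \<le> \<epsilon>" if "f \<in> Lp q" "0 < \<epsilon>" for f \<epsilon>
      unfolding q_def by (rule Lp_tail[OF r]) (use that in \<open>auto simp: q_def\<close>)
  qed (use q Lp_mult_bounded[OF q mtail btail] in \<open>auto simp: right_diff_distrib\<close>)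
  then have "\<forall>\<^sub>F n in sequentially. j \<le> n \<and> (\<forall>k\<in>K. Lp_norm q (class_L0 (?tail n) * k) \<le> (1/2)^j)" for j
    by (intro eventually_conj eventually_ge_at_top)
  \<comment> \<open>The radii are at least \<open>j\<close>, so that only finitely many weights are nonzero on a given ball.\<close>
  then have "\<exists>n. j \<le> n \<and> (\<forall>k\<in>K. Lp_norm q (class_L0 (?tail n) * k) \<le> (1/2)^j)" for j
    by (rule eventually_happens'[OF sequentially_bot])
  then obtain R where R: "\<And>j. j \<le> R j" "\<And>j k. k \<in> K \<Longrightarrow> Lp_norm q (class_L0 (?tail (R j)) * k) \<le> (1/2)^j"
    by metis
  define w where "w j x = min 1 (max 0 (norm x - real (R j)))" for j and x :: "real^'n"
  have w01: "0 \<le> w j x" "w j x \<le> 1" for j x by (auto simp: w_def)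
  have w0: "w j x = 0" if "norm x \<le> real (R j)" for j x using that by (simp add: w_def)
  have w1: "w j x = 1" if "real (R j) + 1 \<le> norm x" for j x using that by (simp add: w_def)
  have wcont: "continuous_on A (w j)" for A j unfolding w_def by (intro continuous_intros)
  have [measurable]: "w j \<in> borel_measurable borel" for j by (intro borel_measurable_continuous_onI wcont)
  have w0': "w j x = 0" if "norm x \<le> real N" "N \<le> j" for j N x
    by (rule w0) (use that R(1)[of j] in linarith)
  have wsums: "(\<lambda>j. w j x) sums (\<Sum>j<N. w j x)" if "norm x \<le> real N" for N x
    by (rule sums_finite) (use w0'[OF that] in auto)
  define G where "G x = 1 + (\<Sum>j. w j x)" for x
  have Gfin: "G x = 1 + (\<Sum>j<N. w j x)" if "norm x \<le> real N" for N x
    using sums_unique[OF wsums[OF that]] by (simp add: G_def)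
  have wsummable: "summable (\<lambda>j. w j x)" for x
    using wsums real_arch_simple sums_summable by metis
  have G1: "1 \<le> G x" for x unfolding G_def using wsummable w01 by (simp add: suminf_nonneg)
  have Gcont: "continuous_on UNIV G"
    unfolding continuous_on_eq_continuous_at[OF open_UNIV]
  proof
    fix x :: "real^'n"
    obtain N where N: "norm x < real N" using reals_Archimedean2 by blast
    have "continuous_on (ball 0 (real N)) (\<lambda>x. 1 + (\<Sum>j<N. w j x))" by (intro continuous_intros wcont)
    then have "continuous_on (ball 0 (real N)) G" 
      by (rule continuous_on_eq) (rule Gfin[symmetric], simp add: less_imp_le)
    moreover have "x \<in> ball 0 (real N)" using N by simp
    ultimately show "isCont G x" using continuous_on_eq_continuous_at[OF open_ball] by blast
  qed
  have Gbig: "1 + real m \<le> G x" if "real (\<Sum>j<m. R j + 1) \<le> norm x" for m x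
  proof -
    have "w j x = 1" if "j < m" for j
    proof (rule w1)
      have "R j + 1 \<le> (\<Sum>j<m. R j + 1)" by (rule member_le_sum) (use that in auto)
      then have "real (R j + 1) \<le> real (\<Sum>j<m. R j + 1)" by (simp only: of_nat_le_iff)
      also have "\<dots> \<le> norm x" by fact
      finally show "real (R j) + 1 \<le> norm x" by simp
    qed
    then have "real m = (\<Sum>j<m. w j x)" by simp
    also have "\<dots> \<le> (\<Sum>j. w j x)" by (intro sum_le_suminf wsummable) (auto simp: w01)
    finally show ?thesis by (simp add: G_def)
  qed
  define g where "g x = complex_of_real (1 / G x)" for x
  have Gpos: "0 < G x" for x using G1[of x] by simp
  have "g \<in> C0"
    unfolding C0_def
  proof (intro CollectI conjI)
    show "continuous_on UNIV g"
      unfolding g_def using Gpos by (intro continuous_intros Gcont) (auto simp: less_imp_neq[symmetric])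
    show "(g \<longlongrightarrow> 0) at_infinity"
    proof (rule tendstoI)
      fix e :: real assume "0 < e"
      then obtain m where m: "inverse (real (Suc m)) < e" using reals_Archimedean by blast
      have "dist (g x) 0 < e" if "real (\<Sum>j<m. R j + 1) \<le> norm x" for x
      proof -
        have "1 / G x \<le> inverse (real (Suc m))"
          using Gbig[OF that] by (simp add: inverse_eq_divide frac_le)
        then show ?thesis using m Gpos[of x] by (simp add: g_def norm_divide)
      qed
      then show "\<forall>\<^sub>F x in at_infinity. dist (g x) 0 < e" unfolding eventually_at_infinity by blast
    qed
  qed
  define Gc where "Gc x = complex_of_real (G x)" for x
  define Gm where "Gm m x = complex_of_real (1 + (\<Sum>j<m. w j x))" for m x
  have mG [measurable]: "Gc \<in> borel_measurable borel"
    unfolding Gc_def by (intro borel_measurable_continuous_onI continuous_intros Gcont)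
  have mGm: "Gm m \<in> borel_measurable borel" for m unfolding Gm_def by measurable
  have bGm: "cmod (Gm m x) \<le> 1 + real m" for m x
  proof -
    have "0 \<le> 1 + (\<Sum>j<m. w j x)" by (simp add: w01 sum_nonneg add_nonneg_nonneg)
    then have "cmod (Gm m x) = 1 + (\<Sum>j<m. w j x)" unfolding Gm_def norm_of_real by simp
    also have "\<dots> \<le> 1 + (\<Sum>j<m. 1)" by (intro add_mono sum_mono w01) auto
    finally show ?thesis by simp
  qed
  have tail: "class_L0 Gc * k \<in> Lp q \<and> Lp_norm q (class_L0 Gc * k - class_L0 (Gm m) * k) \<le> (\<Sum>j. (1/2)^(j + m))" 
    if k: "k \<in> K" for k m
  proof -
    from Lp_cases[OF q, of k] k KL obtain \<kappa> where \<kappa>: "k = class_L0 \<kappa>" "Lp_le q \<kappa> (Lp_norm q k)" "\<kappa> \<in> borel_measurable borel" by blast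
    note [measurable] = \<kappa>(3) mGm
    have wk: "Lp_le q (\<lambda>x. complex_of_real (w j x) * \<kappa> x) ((1/2)^j)" for j
    proof -
      have kt: "class_L0 (?tail (R j)) * k = class_L0 (\<lambda>x. ?tail (R j) x * \<kappa> x)"
        unfolding \<kappa>(1) by (rule class_L0_times[OF mtail \<kappa>(3)])
      have "class_L0 (?tail (R j)) * k \<in> Lp q" using Lp_mult_bounded(1)[OF q mtail btail] k KL by blast
      then have t: "Lp_le q (\<lambda>x. ?tail (R j) x * \<kappa> x) ((1/2)^j)"
        unfolding kt using R(2)[OF k, of j] unfolding kt 
        by (subst Lp_class_iff[OF q, symmetric]) (auto intro!: borel_measurable_times mtail \<kappa>(3))
      show ?thesis
      proof (rule Lp_le_AE_mono[OF q t], measurable, rule AE_I2)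
        fix x
        have "w j x \<le> cmod (?tail (R j) x)" using w0[of x j] w01[of j x] by (auto split: split_indicator)
        then show "cmod (complex_of_real (w j x) * \<kappa> x) \<le> cmod (?tail (R j) x * \<kappa> x)"
          unfolding norm_mult using w01[of j x] by (intro mult_right_mono) auto
      qed
    qed
    have "summable (\<lambda>j. (1/2 :: real)^j)" by simp
    note tl = Lp_le_suminf(2)[OF r wk[unfolded q_def] this, folded q_def]
    have pt: "(\<Sum>j. complex_of_real (w j x) * \<kappa> x) = complex_of_real (\<Sum>j. w j x) * \<kappa> x" for x
    proof -
      have "(\<Sum>j. complex_of_real (w j x) * \<kappa> x) = (\<Sum>j. complex_of_real (w j x)) * \<kappa> x"
        by (rule suminf_mult2[symmetric]) (intro summable_of_real wsummable)
      also have "(\<Sum>j. complex_of_real (w j x)) = complex_of_real (\<Sum>j. w j x)"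
        by (rule suminf_of_real[OF wsummable, symmetric])
      finally show ?thesis .
    qed
    have "Gc x * \<kappa> x - Gm m x * \<kappa> x = (\<Sum>j. complex_of_real (w j x) * \<kappa> x) - (\<Sum>j<m. complex_of_real (w j x) * \<kappa> x)" for x m
      unfolding pt sum_distrib_right[symmetric] by (simp add: Gc_def Gm_def G_def algebra_simps)
    then have d: "Lp_le q (\<lambda>x. Gc x * \<kappa> x - Gm m x * \<kappa> x) (\<Sum>j. (1/2)^(j + m))" for m
      using tl[of m] by simp
    have cd: "class_L0 Gc * k - class_L0 (Gm m) * k = class_L0 (\<lambda>x. Gc x * \<kappa> x - Gm m x * \<kappa> x)" for m
      by (simp add: \<kappa>(1) class_L0_times class_L0_minus)
    have "class_L0 Gc * k - class_L0 (Gm 0) * k \<in> Lp q" unfolding cd by (rule Lp_le_imp_Lp(1)[OF q d])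
    moreover have "class_L0 (Gm 0) * k \<in> Lp q" using Lp_mult_bounded(1)[OF q mGm bGm] k KL by blast
    ultimately have "(class_L0 Gc * k - class_L0 (Gm 0) * k) + class_L0 (Gm 0) * k \<in> Lp q" by (rule Lp_add(1)[OF q])
    then have "class_L0 Gc * k \<in> Lp q" by simp
    then show ?thesis using Lp_le_imp_Lp(2)[OF q d[of m]] by (simp only: cd simp_thms)
  qed
  define K1 where "K1 = (\<lambda>k. class_L0 Gc * k) ` K"
  have "relcompact q K1"
  proof (rule relcompact_approx[OF q])
    show "K1 \<subseteq> Lp q" unfolding K1_def using tail by auto
    fix \<epsilon> :: real assume "0 < \<epsilon>"
    have "(\<lambda>m. \<Sum>j. (1/2 :: real)^(j + m)) \<longlonglongrightarrow> 0" by (rule suminf_exist_split2) simp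
    then have "\<forall>\<^sub>F m in sequentially. (\<Sum>j. (1/2 :: real)^(j + m)) < \<epsilon>" by (rule order_tendstoD) fact
    then obtain m where m: "(\<Sum>j. (1/2 :: real)^(j + m)) < \<epsilon>" unfolding eventually_sequentially by blast
    have "relcompact q ((\<lambda>k. class_L0 (Gm m) * k) ` K)"
      by (rule relcompact_image[OF q _ _ Lp_mult_bounded[OF q mGm bGm]])
        (use K in \<open>auto simp: q_def right_diff_distrib\<close>)
    moreover have "\<exists>t\<in>(\<lambda>k. class_L0 (Gm m) * k) ` K. Lp_norm q (s - t) \<le> \<epsilon>" if s: "s \<in> K1" for s
    proof -
      from s obtain k where k: "k \<in> K" "s = class_L0 Gc * k" unfolding K1_def by blast
      have "Lp_norm q (s - class_L0 (Gm m) * k) \<le> (\<Sum>j. (1/2)^(j + m))" using tail[OF k(1), of m] k(2) by simp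
      then have "Lp_norm q (s - class_L0 (Gm m) * k) \<le> \<epsilon>" using m by linarith
      then show ?thesis using k(1) by blast
    qed
    ultimately show "\<exists>T. relcompact q T \<and> (\<forall>s\<in>K1. \<exists>t\<in>T. Lp_norm q (s - t) \<le> \<epsilon>)" by blast
  qed
  moreover have "\<exists>k1\<in>K1. k = class_L0 g * k1" if k: "k \<in> K" for k
  proof -
    have "class_L0 g * (class_L0 Gc * k) = k"
    proof (cases k rule: L0_cases)
      case (rep \<kappa>)
      note [measurable] = rep(1) C0_measurable[OF \<open>g \<in> C0\<close>]
      have "g x * (Gc x * \<kappa> x) = \<kappa> x" for x using Gpos[of x] by (simp add: g_def Gc_def)
      then have "(\<lambda>x. g x * (Gc x * \<kappa> x)) = \<kappa>" by (rule ext)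
      moreover have "class_L0 g * (class_L0 Gc * class_L0 \<kappa>) = class_L0 (\<lambda>x. g x * (Gc x * \<kappa> x))"
        by (simp add: class_L0_times)
      ultimately show ?thesis unfolding rep(2) by simp
    qed
    then show ?thesis using k unfolding K1_def by (metis imageI)
  qed
  ultimately show ?thesis using \<open>g \<in> C0\<close> unfolding q_def by blast
qed

text \<open>The convolution half of Cohen's factorisation theorem, reduced to an inequality. The operators \<open>A n\<close>
are boundedly invertible, and Cohen's proof applies the inverse of their product to the elements of \<open>K\<close>.
Estimating \<open>\<langle>u, k\<rangle>\<close> by the product \<open>\<Phi> n u\<close> instead requires only the lower bound \<open>Abelow\<close>, and no
inverse operator has to be constructed.\<close>

proposition Cohen_domination:
  fixes K :: "'n::finite L0 set"
  assumes pq: "conjugate p q" and r: "q = ennreal r" "1 \<le> r" and K: "relcompact q K"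
  shows "\<exists>h\<in>Lp 1. \<exists>M>0. \<forall>u\<in>Lp p. \<forall>k\<in>K. cmod (pairing u k) \<le> M * Lp_norm p (conv h u)"
proof -
  note p = conjugate_ge1(1)[OF pq] and q = conjugate_ge1(2)[OF pq]
  have KL: "K \<subseteq> Lp q" using K by (simp add: relcompact_def)
  define good where "good H n j \<longleftrightarrow> (\<forall>k\<in>K. Lp_norm q (conv (moll j) k - k) \<le> (1/4)^n) \<and>
     Lp_norm 1 (conv (moll j) H - H) \<le> (1/2)^n" for H :: "'n L0" and n j
  have ex_good: "\<exists>j. good H n j" if H: "H \<in> Lp 1" for H n
  proof -
    \<comment> \<open>The rate has to beat the bound \<open>2^n\<close> in the estimate \<open>\<Phi>below\<close>.\<close>
    have "\<forall>\<^sub>F j in sequentially. \<forall>k\<in>K. Lp_norm q (conv (moll j) k - k) \<le> (1/4)^n"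
    proof (rule relcompact_uniform[OF q K, where c=2])
      fix f g :: "'n L0" and j :: nat assume f: "f \<in> Lp q"
      show "conv (moll j) f - f \<in> Lp q" by (intro Lp_diff q Lp_conv_moll f)
      show "Lp_norm q (conv (moll j) f - f) \<le> 2 * Lp_norm q f"
        using Lp_diff(2)[OF q Lp_conv_moll(1)[OF q f] f, of j] Lp_conv_moll(2)[OF q f, of j] by simp
      show "\<forall>\<^sub>F n in sequentially. Lp_norm q (conv (moll n) f - f) \<le> \<epsilon>" if "0 < \<epsilon>" for \<epsilon>
        using conv_moll_tendsto[OF r(2) _ that] f r(1) by simp
      assume g: "g \<in> Lp q"
      show "conv (moll j) (f - g) - (f - g) = conv (moll j) f - f - (conv (moll j) g - g)"
        by (simp add: conv_diff_right[OF q moll_Lp(1) f g])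
    qed auto
    moreover have "\<forall>\<^sub>F j in sequentially. Lp_norm 1 (conv (moll j) H - H) \<le> (1/2)^n"
      using conv_moll_tendsto[of 1 H "(1/2)^n"] H by simp
    ultimately have "\<forall>\<^sub>F j in sequentially. good H n j" unfolding good_def by (rule eventually_conj)
    then show ?thesis by (rule eventually_happens'[OF sequentially_bot])
  qed
  define pick where "pick H n = (SOME j. good H n j)" for H n
  have pick: "good H n (pick H n)" if "H \<in> Lp 1" for H n
    unfolding pick_def by (rule someI_ex[OF ex_good[OF that]])
  \<comment> \<open>The recursion is read off from \<open>\<Phi>S\<close> below; the choice of the \<open>n\<close>-th mollifier depends on \<open>H n\<close>.\<close>
  define H where "H = rec_nat (0 :: 'n L0) (\<lambda>n H. (3/4) *\<^sub>C H + ((1/4) * (3/4)^n) *\<^sub>C moll (pick H n) +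
     (1/4) *\<^sub>C conv H (moll (pick H n)))"
  define E where "E n = (moll (pick (H n) n) :: 'n L0)" for n
  have H0: "H 0 = 0" by (simp add: H_def)
  have HS: "H (Suc n) = (3/4) *\<^sub>C H n + ((1/4) * (3/4)^n) *\<^sub>C E n + (1/4) *\<^sub>C conv (H n) (E n)" for n
    by (simp add: H_def E_def)
  have E: "E n \<in> Lp 1" "Lp_norm 1 (E n) \<le> 1" for n unfolding E_def by (rule moll_Lp)+
  have HL: "H n \<in> Lp 1" for n
    by (induction n) (auto simp: H0 HS Lp_norm_0 intro!: Lp_add Lp_scaleC Lp_conv E)
  have goodE: "k \<in> K \<Longrightarrow> Lp_norm q (conv (E n) k - k) \<le> (1/4)^n" 
    "Lp_norm 1 (conv (E n) (H n) - H n) \<le> (1/2)^n" for k n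
    using pick[OF HL, of n n] by (auto simp: good_def E_def)
  define A where "A n u = (3/4) *\<^sub>C u + (1/4) *\<^sub>C conv (E n) u" for n and u :: "'n L0"
  define \<Phi> where "\<Phi> n u = ((3/4)^n) *\<^sub>C u + conv (H n) u" for n and u :: "'n L0"
  have Eu: "conv (E n) u \<in> Lp p" "Lp_norm p (conv (E n) u) \<le> Lp_norm p u" if "u \<in> Lp p" for n u
    unfolding E_def using Lp_conv_moll[OF p that] by auto
  have AL: "A n u \<in> Lp p" if "u \<in> Lp p" for n u
    unfolding A_def by (intro Lp_add Lp_scaleC p Eu that)
  have \<Phi>L: "\<Phi> n u \<in> Lp p" if "u \<in> Lp p" for n u
    unfolding \<Phi>_def by (intro Lp_add Lp_scaleC Lp_conv HL p that)
  have \<Phi>0: "\<Phi> 0 u = u" for u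
  proof -
    have "conv 0 u = 0 *\<^sub>C conv 0 u" using conv_scaleC_left[of 0 0 u] by (simp add: scaleC_zero)
    then show ?thesis by (simp add: \<Phi>_def H0 scaleC_one scaleC_zero)
  qed
  have \<Phi>S: "\<Phi> (Suc n) u = \<Phi> n (A n u)" if u: "u \<in> Lp p" for n u
  proof -
    have 1: "(3/4) *\<^sub>C u \<in> Lp p" "(1/4) *\<^sub>C conv (E n) u \<in> Lp p" by (intro Lp_scaleC p u Eu)+
    have 2: "(3/4) *\<^sub>C H n \<in> Lp 1" "((1/4) * (3/4)^n) *\<^sub>C E n \<in> Lp 1" "(1/4) *\<^sub>C conv (H n) (E n) \<in> Lp 1"
      by (intro Lp_scaleC order_refl HL E Lp_conv)+
    have L: "conv (H n) (A n u) = (3/4) *\<^sub>C conv (H n) u + (1/4) *\<^sub>C conv (conv (H n) (E n)) u"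
      unfolding A_def conv_add_right[OF p HL 1] conv_scaleC_right conv_assoc[OF p HL E(1) u] ..
    have R: "conv (H (Suc n)) u = (3/4) *\<^sub>C conv (H n) u + ((1/4) * (3/4)^n) *\<^sub>C conv (E n) u + (1/4) *\<^sub>C conv (conv (H n) (E n)) u"
      unfolding HS conv_add_left[OF p Lp_add(1)[OF order_refl 2(1,2)] 2(3) u] conv_add_left[OF p 2(1,2) u] conv_scaleC_left ..
    show ?thesis
      unfolding \<Phi>_def L R unfolding A_def scaleC_add scaleC_scaleC by (simp add: ac_simps)
  qed
  have Abelow: "Lp_norm p u \<le> 2 * Lp_norm p (A n u)" if u: "u \<in> Lp p" for n u
  proof -
    have "(3/4) *\<^sub>C u = A n u - (1/4) *\<^sub>C conv (E n) u" by (simp add: A_def)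
    then have "3/4 * Lp_norm p u = Lp_norm p (A n u - (1/4) *\<^sub>C conv (E n) u)"
      using Lp_scaleC(2)[OF p u, of "3/4"] by (simp add: norm_divide)
    also have "\<dots> \<le> Lp_norm p (A n u) + Lp_norm p ((1/4) *\<^sub>C conv (E n) u)"
      by (intro Lp_diff(2) p AL u Lp_scaleC Eu)
    also have "Lp_norm p ((1/4) *\<^sub>C conv (E n) u) \<le> 1/4 * Lp_norm p u"
      using Lp_scaleC(2)[OF p Eu(1)[OF u], of "1/4" n] Eu(2)[OF u, of n] by (simp add: norm_divide)
    finally show ?thesis by simp
  qed
  have \<Phi>below: "Lp_norm p u \<le> 2^n * Lp_norm p (\<Phi> n u)" if "u \<in> Lp p" for n u
    using that
  proof (induction n arbitrary: u)
    case (Suc n)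
    have "Lp_norm p u \<le> 2 * Lp_norm p (A n u)" by (rule Abelow[OF Suc.prems])
    also have "\<dots> \<le> 2 * (2^n * Lp_norm p (\<Phi> n (A n u)))" using Suc.IH[OF AL[OF Suc.prems]] by simp
    finally show ?case by (simp add: \<Phi>S[OF Suc.prems])
  qed (simp add: \<Phi>0)
  from relcompact_bounded[OF q K] obtain M0 where M0: "0 \<le> M0" "\<And>k. k \<in> K \<Longrightarrow> Lp_norm q k \<le> M0" by blast
  \<comment> \<open>The constants increase with \<open>n\<close> but stay below \<open>M0 + 1\<close>. In the induction step \<open>u\<close> is replaced by
    \<open>A n u\<close>; the error is controlled by transposing \<open>E n\<close>, which fixes \<open>k\<close> up to \<open>(1/4)^n\<close>.\<close>
  have main: "cmod (pairing u k) \<le> (M0 + 1 - (1/2)^n) * Lp_norm p (\<Phi> n u)" if "u \<in> Lp p" and k: "k \<in> K" for n u k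
    using that(1)
  proof (induction n arbitrary: u)
    case 0
    have "cmod (pairing u k) \<le> Lp_norm p u * Lp_norm q k" using 0 k KL by (intro cmod_pairing_le[OF pq]) auto
    also have "\<dots> \<le> Lp_norm p u * M0" by (intro mult_left_mono M0 k) simp
    finally show ?case by (simp add: \<Phi>0 mult.commute)
  next
    case (Suc n)
    note u = Suc.prems
    have kL: "k \<in> Lp q" using k KL by blast
    have Ek: "conv (E n) k \<in> Lp q" unfolding E_def by (rule Lp_conv_moll(1)[OF q kL])
    have uE: "u - conv (E n) u \<in> Lp p" by (rule Lp_diff(1)[OF p u Eu(1)[OF u]])
    have split: "u = A n u + (1/4) *\<^sub>C (u - conv (E n) u)"
    proof -
      have "(1/4) *\<^sub>C (u - conv (E n) u) + (1/4) *\<^sub>C conv (E n) u = (1/4) *\<^sub>C u" by (simp flip: scaleC_add)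
      moreover have "(3/4) *\<^sub>C u + (1/4) *\<^sub>C u = u" by (simp add: scaleC_one flip: scaleC_add_left)
      ultimately show ?thesis by (simp add: A_def algebra_simps)
    qed
    have "pairing (u - conv (E n) u) k = pairing u (k - conv (E n) k)"
      unfolding pairing_diff[OF pq u Eu(1)[OF u] kL] pairing_diff_right[OF pq u kL Ek]
      unfolding E_def pairing_conv_moll[OF pq u kL] ..
    then have "cmod (pairing (u - conv (E n) u) k) \<le> Lp_norm p u * Lp_norm q (k - conv (E n) k)"
      using cmod_pairing_le[OF pq u Lp_diff(1)[OF q kL Ek]] by simp
    also have "\<dots> \<le> Lp_norm p u * (1/4)^n"
      using goodE(1)[OF k, of n] by (intro mult_left_mono) (auto simp: Lp_norm_minus_commute[of q k])
    also have "\<dots> \<le> 2^Suc n * Lp_norm p (\<Phi> (Suc n) u) * (1/4)^n"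
      by (intro mult_right_mono \<Phi>below u) auto
    also have "\<dots> = 4 * (1/2)^Suc n * Lp_norm p (\<Phi> (Suc n) u)"
    proof -
      have "(4 :: real)^n = 2^n * 2^n" by (simp flip: power_mult_distrib)
      then show ?thesis by (simp add: power_divide)
    qed
    finally have err: "cmod (pairing (u - conv (E n) u) k) \<le> 4 * (1/2)^Suc n * Lp_norm p (\<Phi> (Suc n) u)" .
    have "pairing u k = pairing (A n u) k + (1/4) * pairing (u - conv (E n) u) k"
    proof -
      have "pairing u k = pairing (A n u + (1/4) *\<^sub>C (u - conv (E n) u)) k" using split by simp
      also have "\<dots> = pairing (A n u) k + pairing ((1/4) *\<^sub>C (u - conv (E n) u)) k"
        by (rule pairing_add[OF pq AL[OF u] Lp_scaleC(1)[OF p uE] kL])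
      finally show ?thesis by (simp add: pairing_scaleC)
    qed
    then have "cmod (pairing u k) \<le> cmod (pairing (A n u) k) + 1/4 * cmod (pairing (u - conv (E n) u) k)"
      using norm_triangle_ineq[of "pairing (A n u) k" "(1/4) * pairing (u - conv (E n) u) k"] by (simp add: norm_mult norm_divide)
    also have "\<dots> \<le> (M0 + 1 - (1/2)^n) * Lp_norm p (\<Phi> (Suc n) u) + (1/2)^Suc n * Lp_norm p (\<Phi> (Suc n) u)"
      using Suc.IH[OF AL[OF u]] err unfolding \<Phi>S[OF u] by (intro add_mono) auto
    also have "\<dots> = (M0 + 1 - (1/2)^Suc n) * Lp_norm p (\<Phi> (Suc n) u)"
      by (simp add: algebra_simps)
    finally show ?case .
  qed
  define a where "a n = (1/4) * (1/2)^n + (1/4) * (3/4 :: real)^n" for n :: nat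
  define D where "D n = H (Suc n) - H n" for n
  have D: "D n \<in> Lp 1" "Lp_norm 1 (D n) \<le> a n" for n
  proof -
    show "D n \<in> Lp 1" unfolding D_def by (intro Lp_diff order_refl HL)
    have cE: "conv (E n) (H n) - H n \<in> Lp 1" by (intro Lp_diff order_refl HL Lp_conv E)
    have 1: "(3/4) *\<^sub>C H n + (1/4) *\<^sub>C H n = H n" by (simp add: scaleC_one flip: scaleC_add_left)
    have 2: "(1/4) *\<^sub>C (conv (E n) (H n) - H n) + (1/4) *\<^sub>C H n = (1/4) *\<^sub>C conv (E n) (H n)"
      by (simp flip: scaleC_add)
    have 3: "x + v + (d + y) - (x + y) = d + v" for x y d v :: "'n L0" by (simp add: algebra_simps)
    have "D n = (3/4) *\<^sub>C H n + ((1/4) * (3/4)^n) *\<^sub>C E n +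
        ((1/4) *\<^sub>C (conv (E n) (H n) - H n) + (1/4) *\<^sub>C H n) - ((3/4) *\<^sub>C H n + (1/4) *\<^sub>C H n)"
      unfolding 1 2 D_def HS conv_commute[of "H n" "E n"] ..
    also have "\<dots> = (1/4) *\<^sub>C (conv (E n) (H n) - H n) + ((1/4) * (3/4)^n) *\<^sub>C E n" by (rule 3)
    finally have "D n = (1/4) *\<^sub>C (conv (E n) (H n) - H n) + ((1/4) * (3/4)^n) *\<^sub>C E n" .
    then have "Lp_norm 1 (D n) \<le> Lp_norm 1 ((1/4) *\<^sub>C (conv (E n) (H n) - H n)) + Lp_norm 1 (((1/4) * (3/4)^n) *\<^sub>C E n)"
      using Lp_add(2)[OF order_refl Lp_scaleC(1)[OF order_refl cE] Lp_scaleC(1)[OF order_refl E(1)]] by simp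
    also have "\<dots> = 1/4 * Lp_norm 1 (conv (E n) (H n) - H n) + (1/4) * (3/4)^n * Lp_norm 1 (E n)"
      using Lp_scaleC(2)[OF order_refl cE] Lp_scaleC(2)[OF order_refl E(1)] by (simp add: norm_mult norm_divide norm_power)
    also have "\<dots> \<le> 1/4 * (1/2)^n + (1/4) * (3/4)^n * 1"
      by (intro add_mono mult_left_mono goodE E) auto
    finally show "Lp_norm 1 (D n) \<le> a n" by (simp add: a_def)
  qed
  have "summable a" unfolding a_def by (intro summable_add summable_mult summable_geometric) auto
  with Lp_series_converges[of 1 D a] D obtain h where h: "h \<in> Lp 1" 
    "(\<lambda>m. Lp_norm 1 (h - (\<Sum>k<m. D k))) \<longlonglongrightarrow> 0" by auto
  have "(\<Sum>k<m. D k) = H m" for m unfolding D_def by (simp add: sum_lessThan_telescope H0)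
  with h(2) have lim: "(\<lambda>m. Lp_norm 1 (h - H m)) \<longlonglongrightarrow> 0" by simp
  have "cmod (pairing u k) \<le> (M0 + 1) * Lp_norm p (conv h u)" if u: "u \<in> Lp p" and k: "k \<in> K" for u k
  proof (rule LIMSEQ_le_const)
    let ?b = "\<lambda>n. (M0 + 1) * ((3/4)^n * Lp_norm p u + (Lp_norm 1 (h - H n) * Lp_norm p u + Lp_norm p (conv h u)))"
    have "?b \<longlonglongrightarrow>
       (M0 + 1) * (0 * Lp_norm p u + (0 * Lp_norm p u + Lp_norm p (conv h u)))"
      by (intro tendsto_intros lim LIMSEQ_power_zero) auto
    then show "?b \<longlonglongrightarrow>
       (M0 + 1) * Lp_norm p (conv h u)" by simp
    show "\<exists>N. \<forall>n\<ge>N. cmod (pairing u k) \<le> ?b n"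
    proof (intro exI allI impI)
      fix n :: nat
      have hu: "conv h u \<in> Lp p" "conv (H n) u \<in> Lp p" by (intro Lp_conv p h(1) HL u)+
      have "Lp_norm p (conv (H n) u) \<le> Lp_norm p (conv (H n) u - conv h u) + Lp_norm p (conv h u)"
        using Lp_add(2)[OF p Lp_diff(1)[OF p hu(2,1)] hu(1)] by simp
      also have "Lp_norm p (conv (H n) u - conv h u) = Lp_norm p (conv (h - H n) u)"
        unfolding conv_diff_left[OF p h(1) HL u] by (rule Lp_norm_minus_commute)
      also have "\<dots> \<le> Lp_norm 1 (h - H n) * Lp_norm p u"
        by (rule Lp_conv(2)[OF p Lp_diff(1)[OF order_refl h(1) HL] u])
      finally have "Lp_norm p (conv (H n) u) \<le> Lp_norm 1 (h - H n) * Lp_norm p u + Lp_norm p (conv h u)" by simp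
      moreover have "Lp_norm p (\<Phi> n u) \<le> (3/4)^n * Lp_norm p u + Lp_norm p (conv (H n) u)"
        unfolding \<Phi>_def using Lp_add(2)[OF p Lp_scaleC(1)[OF p u, of "(3/4)^n"] hu(2)] Lp_scaleC(2)[OF p u, of "(3/4)^n"]
        by (simp add: norm_divide norm_power)
      ultimately have \<Phi>n: "Lp_norm p (\<Phi> n u) \<le> (3/4)^n * Lp_norm p u + (Lp_norm 1 (h - H n) * Lp_norm p u + Lp_norm p (conv h u))"
        by linarith
      have "cmod (pairing u k) \<le> (M0 + 1 - (1/2)^n) * Lp_norm p (\<Phi> n u)" by (rule main[OF u k])
      also have "\<dots> \<le> (M0 + 1) * Lp_norm p (\<Phi> n u)" by (intro mult_right_mono) auto
      also have "\<dots> \<le> ?b n"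
        using M0(1) by (intro mult_left_mono \<Phi>n) auto
      finally show "cmod (pairing u k) \<le> ?b n" .
    qed
  qed
  moreover have "0 < M0 + 1" using M0(1) by simp
  ultimately show ?thesis using h(1) by blast
qed

text \<open>If \<open>k = g k\<^sub>1\<close>, then \<open>\<langle>f, k\<rangle> = \<langle>g f, k\<^sub>1\<rangle>\<close>, and the \<open>k\<^sub>1\<close> run through a relatively compact set.\<close>

proposition polar_le_conv_mult_seminorm:
  fixes K :: "'n::finite L0 set"
  assumes pq: "conjugate p q" and r: "q = ennreal r" "1 \<le> r" 
    and K: "K \<noteq> {}" "compactin (Lp_topology q) K"
  shows "\<exists>g\<in>C0. \<exists>h\<in>Lp 1. \<exists>M>0. \<forall>f\<in>Lp p.
    (SUP k\<in>K. cmod (pairing f k)) \<le> M * Lp_norm p (conv h (class_L0 g * f))"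
proof -
  note p = conjugate_ge1(1)[OF pq] and q = conjugate_ge1(2)[OF pq]
  interpret M: Metric_space "Lp q :: 'n L0 set" "\<lambda>f g. Lp_norm q (f - g)" by (rule Metric_space_Lp[OF q])
  have "M.mtotally_bounded K"
    using K(2) by (intro M.compactin_imp_mtotally_bounded) (simp add: Lp_topology_def)
  then have "relcompact q K" using mtotally_bounded_Lp[OF q] by blast
  then obtain g K1 where g: "g \<in> C0" and K1: "relcompact q K1" "\<And>k. k \<in> K \<Longrightarrow> \<exists>k1\<in>K1. k = class_L0 g * k1"
    using C0_factorisation[OF r(2), of K] r(1) by blast
  from Cohen_domination[OF pq r K1(1)] obtain h M where h: "h \<in> Lp 1" "0 < M"
    and dom: "\<And>u k. u \<in> Lp p \<Longrightarrow> k \<in> K1 \<Longrightarrow> cmod (pairing u k) \<le> M * Lp_norm p (conv h u)" by blast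
  from C0_bounded[OF g] obtain B where B: "\<And>x. cmod (g x) \<le> B" by blast
  have "(SUP k\<in>K. cmod (pairing f k)) \<le> M * Lp_norm p (conv h (class_L0 g * f))" if f: "f \<in> Lp p" for f
  proof (rule cSUP_least[OF K(1)])
    fix k assume "k \<in> K"
    from K1(2)[OF this] obtain k1 where k1: "k1 \<in> K1" "k = class_L0 g * k1" by blast
    have "pairing f k = pairing (class_L0 g * f) k1" unfolding k1(2) by (rule pairing_mult[symmetric])
    then show "cmod (pairing f k) \<le> M * Lp_norm p (conv h (class_L0 g * f))"
      using dom[OF Lp_mult_bounded(1)[OF p C0_measurable[OF g] B f] k1(1)] by simp
  qed
  then show ?thesis using g h by blast
qed

section \<open>Comparison of seminorm topologies\<close>

text \<open>If a seminorm of \<open>S\<close> is at most \<open>C\<close> times a seminorm of \<open>T\<close>, then around each point of one of its balls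
the other has a ball that is contained in it. Domination by a single seminorm is a special case of the
usual criterion with finitely many.\<close>

lemma seminorm_topology_mono:
  fixes V :: "'a::ab_group_add set"
  assumes V: "\<And>f g. f \<in> V \<Longrightarrow> g \<in> V \<Longrightarrow> f - g \<in> V"
    and sub: "\<And>s f g. s \<in> S \<Longrightarrow> f \<in> V \<Longrightarrow> g \<in> V \<Longrightarrow> s (f + g) \<le> s f + s g"
    and zero: "\<And>t. t \<in> T \<Longrightarrow> t 0 = 0"
    and dom: "\<And>s. s \<in> S \<Longrightarrow> \<exists>t\<in>T. \<exists>C>0. \<forall>f\<in>V. s f \<le> C * t f"
    and U: "openin (seminorm_topology V S) U"
  shows "openin (seminorm_topology V T) U"
proof (rule generate_topology_on_coarsest)
  show "istopology (openin (seminorm_topology V T))" by (rule istopology_openin)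
  show "generate_topology_on (insert V {{y \<in> V. s (y - x) < e} |s x e. s \<in> S \<and> x \<in> V \<and> 0 < e}) U"
    using U by (simp add: seminorm_topology_def openin_topology_generated_by_iff)
  fix B assume "B \<in> insert V {{y \<in> V. s (y - x) < e} |s x e. s \<in> S \<and> x \<in> V \<and> 0 < e}"
  then consider "B = V" | s x e where "s \<in> S" "x \<in> V" "B = {y \<in> V. s (y - x) < e}" by blast
  then show "openin (seminorm_topology V T) B"
  proof cases
    case 1
    then show ?thesis unfolding seminorm_topology_def by (auto intro: topology_generated_by_Basis)
  next
    case 2
    from dom[OF 2(1)] obtain t C where t: "t \<in> T" "0 < C" "\<And>f. f \<in> V \<Longrightarrow> s f \<le> C * t f" by blast
    show ?thesis
    proof (subst openin_subopen, intro ballI)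
      fix y assume y: "y \<in> B"
      \<comment> \<open>The distance of \<open>y\<close> to the boundary of the ball, measured by the dominating seminorm.\<close>
      define d where "d = (e - s (y - x)) / C"
      have yV: "y \<in> V" and d: "0 < d" using y 2 t(2) by (auto simp: d_def)
      have "openin (seminorm_topology V T) {z \<in> V. t (z - y) < d}"
        unfolding seminorm_topology_def using t(1) yV d by (intro topology_generated_by_Basis) blast
      moreover have "y \<in> {z \<in> V. t (z - y) < d}" using yV d zero[OF t(1)] by simp
      moreover have "{z \<in> V. t (z - y) < d} \<subseteq> B"
      proof
        fix z assume z: "z \<in> {z \<in> V. t (z - y) < d}"
        have "s ((z - y) + (y - x)) \<le> s (z - y) + s (y - x)"
          using z yV 2 by (intro sub V) auto
        also have "s (z - y) \<le> C * t (z - y)" using z yV by (intro t(3) V) auto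
        also have "C * t (z - y) < C * d" using z t(2) by simp
        also have "C * d + s (y - x) = e" using t(2) by (simp add: d_def)
        finally have "s (z - x) < e" by simp
        then show "z \<in> B" using z 2 by simp
      qed
      ultimately show "\<exists>W. openin (seminorm_topology V T) W \<and> y \<in> W \<and> W \<subseteq> B" by blast
    qed
  qed
qed

text \<open>The reciprocals are taken in the extended nonnegative reals, where \<open>1/0 = \<infinity>\<close> and \<open>1/\<infinity> = 0\<close>.\<close>

lemma conjugate_of_reciprocals:
  fixes p q :: ennreal
  assumes "1 < p" "1 / p + 1 / q = 1"
  shows "conjugate p q" "\<exists>r\<ge>1. q = ennreal r"
proof -
  have "conjugate p q \<and> (\<exists>r\<ge>1. q = ennreal r)"
  proof (cases p)
    case (real P)
    then have P: "1 < P" using assms(1) by (simp flip: ennreal_1 add: ennreal_less_iff)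
    have iP: "1 / p = ennreal (1 / P)" using real P by (simp add: divide_ennreal flip: ennreal_1)
    show ?thesis
    proof (cases q)
      case (real Q)
      show ?thesis
      proof (cases "Q = 0")
        case True
        then show ?thesis using assms(2) real by (simp add: ennreal_divide_zero)
      next
        case False
        then have Q: "0 < Q" using real by simp
        have iQ: "1 / q = ennreal (1 / Q)" using real Q by (simp add: divide_ennreal flip: ennreal_1)
        have "ennreal (1 / P + 1 / Q) = ennreal 1" using assms(2) P Q by (simp add: iP iQ flip: ennreal_plus)
        then have PQ: "1 / P + 1 / Q = 1" using P Q by (subst (asm) ennreal_inj) auto
        have "0 < 1 / P" using P by simp
        then have "1 / Q < 1" using PQ by linarith
        then have "1 < Q" using Q by simp
        then have "conjugate p q" unfolding conjugate_def using P PQ \<open>p = ennreal P\<close> real(2) by blast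
        then show ?thesis using \<open>1 < Q\<close> real by (intro conjI exI[of _ Q]) auto
      qed
    next
      case top
      then have "ennreal (1 / P) = ennreal 1" using assms(2) iP by simp
      then show ?thesis using P by (subst (asm) ennreal_inj) auto
    qed
  next
    case top
    then have q1: "1 / q = 1" using assms(2) by simp
    have "q = 1"
    proof (cases q)
      case (real Q)
      then show ?thesis using q1 
        by (cases "Q = 0") (auto simp: ennreal_divide_zero divide_ennreal simp flip: ennreal_1)
    qed (use q1 in simp)
    then show ?thesis using top by (auto simp: conjugate_def intro!: exI[of _ 1])
  qed
  then show "conjugate p q" "\<exists>r\<ge>1. q = ennreal r" by auto
qed

lemma seminorm_conv_mult:
  fixes h :: "'n::finite L0"
  assumes p: "1 \<le> p" and g: "g \<in> C0" and h: "h \<in> Lp 1"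
  shows "\<And>f. f \<in> Lp p \<Longrightarrow> conv h (class_L0 g * f) \<in> Lp p"
    and "seminorm_on (Lp p) (\<lambda>f. Lp_norm p (conv h (class_L0 g * f)))"
proof -
  from C0_bounded[OF g] obtain B where B: "\<And>x. cmod (g x) \<le> B" by blast
  have gf: "class_L0 g * f \<in> Lp p" if "f \<in> Lp p" for f
    by (rule Lp_mult_bounded(1)[OF p C0_measurable[OF g] B that])
  show hgf: "conv h (class_L0 g * f) \<in> Lp p" if "f \<in> Lp p" for f
    by (rule Lp_conv(1)[OF p h gf[OF that]])
  show "seminorm_on (Lp p) (\<lambda>f. Lp_norm p (conv h (class_L0 g * f)))"
    unfolding seminorm_on_def
  proof (intro conjI ballI allI)
    fix u v :: "'n L0" assume u: "u \<in> Lp p" and v: "v \<in> Lp p"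
    show "Lp_norm p (conv h (class_L0 g * (u + v))) \<le> Lp_norm p (conv h (class_L0 g * u)) + Lp_norm p (conv h (class_L0 g * v))"
      unfolding distrib_left conv_add_right[OF p h gf[OF u] gf[OF v]] by (rule Lp_add(2)[OF p hgf[OF u] hgf[OF v]])
  next
    fix c and u :: "'n L0" assume u: "u \<in> Lp p"
    show "Lp_norm p (conv h (class_L0 g * (c *\<^sub>C u))) = cmod c * Lp_norm p (conv h (class_L0 g * u))"
      unfolding times_scaleC conv_scaleC_right by (rule Lp_scaleC(2)[OF p hgf[OF u]])
  qed simp
qed

lemma polar_subadditive:
  assumes pq: "conjugate p q" and K: "K \<noteq> {}" "compactin (Lp_topology q) K" and f: "f \<in> Lp p" "g \<in> Lp p"
  shows "(SUP k\<in>K. cmod (pairing (f + g) k)) \<le> (SUP k\<in>K. cmod (pairing f k)) + (SUP k\<in>K. cmod (pairing g k))"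
proof (rule cSUP_least[OF K(1)])
  fix k assume k: "k \<in> K"
  then have kL: "k \<in> Lp q" using compactin_Lp_bounded[OF conjugate_ge1(2)[OF pq] K(2)] by metis
  have "cmod (pairing (f + g) k) \<le> cmod (pairing f k) + cmod (pairing g k)"
    unfolding pairing_add[OF pq f kL] by (rule norm_triangle_ineq)
  also have "\<dots> \<le> (SUP k\<in>K. cmod (pairing f k)) + (SUP k\<in>K. cmod (pairing g k))"
    by (intro add_mono cSUP_upper k bdd_above_pairing[OF pq K(2)] f)
  finally show "cmod (pairing (f + g) k) \<le> (SUP k\<in>K. cmod (pairing f k)) + (SUP k\<in>K. cmod (pairing g k))" .
qed

theorem proposition16:
  fixes p q :: ennreal
  assumes "1 < p" and "1 / p + 1 / q = 1"
  shows "(\<forall>g\<in>C0. \<forall>h\<in>Lp 1. \<forall>f\<in>Lp p. conv h (class_L0 g * f) \<in> (Lp p :: 'n::finite L0 set)) \<and>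
    (\<forall>g\<in>C0. \<forall>h\<in>Lp 1. seminorm_on (Lp p :: 'n L0 set) (\<lambda>f. Lp_norm p (conv h (class_L0 g * f)))) \<and>
    (kappa p q :: 'n L0 topology) =
      seminorm_topology (Lp p)
        {\<lambda>f. Lp_norm p (conv h (class_L0 g * f)) |g h. g \<in> C0 \<and> h \<in> Lp 1}"
proof -
  note pq = conjugate_of_reciprocals(1)[OF assms]
  obtain r where r: "q = ennreal r" "1 \<le> r" using conjugate_of_reciprocals(2)[OF assms] by blast
  note p = conjugate_ge1(1)[OF pq]
  let ?P = "{\<lambda>f. SUP k\<in>K. cmod (pairing f k) |K :: 'n L0 set. K \<noteq> {} \<and> abs_convex K \<and> compactin (Lp_topology q) K}"
  let ?C = "{\<lambda>f :: 'n L0. Lp_norm p (conv h (class_L0 g * f)) |g h. g \<in> C0 \<and> h \<in> Lp 1}"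
  have diff: "f - g \<in> Lp p" if "f \<in> Lp p" "g \<in> Lp p" for f g :: "'n L0" by (rule Lp_diff(1)[OF p that])
  have pairing0: "pairing 0 k = 0" for k :: "'n L0"
    using pairing_scaleC[of 0 0 k] by (simp add: scaleC_zero)
  have polar0: "t 0 = 0" if "t \<in> ?P" for t
  proof -
    from that obtain K :: "'n L0 set" where "K \<noteq> {}" "t = (\<lambda>f. SUP k\<in>K. cmod (pairing f k))" by blast
    then show ?thesis by (simp add: pairing0)
  qed
  have conv0: "t 0 = 0" if "t \<in> ?C" for t
  proof -
    from that obtain g h where gh: "g \<in> C0" "h \<in> Lp 1" "t = (\<lambda>f. Lp_norm p (conv h (class_L0 g * f)))" by blast
    have "t (0 *\<^sub>C 0) = cmod 0 * t 0"
      using seminorm_conv_mult(2)[OF p gh(1,2)] Lp_norm_0(1)[OF p] unfolding seminorm_on_def gh(3) by blast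
    then show ?thesis by (simp add: scaleC_zero)
  qed
  have "openin (seminorm_topology (Lp p) ?P) U = openin (seminorm_topology (Lp p) ?C) U" for U
  proof
    assume "openin (seminorm_topology (Lp p) ?P) U"
    then show "openin (seminorm_topology (Lp p) ?C) U"
    proof (rule seminorm_topology_mono[where V="Lp p" and S="?P" and T="?C", rotated -1])
      show "f - g \<in> Lp p" if "f \<in> Lp p" "g \<in> Lp p" for f g :: "'n L0" by (rule diff[OF that])
      show "t 0 = 0" if "t \<in> ?C" for t by (rule conv0[OF that])
    next
      fix s and f g :: "'n L0" assume "s \<in> ?P" and fg: "f \<in> Lp p" "g \<in> Lp p"
      then show "s (f + g) \<le> s f + s g" using polar_subadditive[OF pq _ _ fg] by auto
    next
      fix s assume "s \<in> ?P"
      then obtain K :: "'n L0 set" where K: "K \<noteq> {}" "compactin (Lp_topology q) K"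
        and s: "s = (\<lambda>f. SUP k\<in>K. cmod (pairing f k))" by blast
      from polar_le_conv_mult_seminorm[OF pq r K] obtain g h M where gh: "g \<in> C0" "h \<in> Lp 1"
        and M: "0 < M" "\<forall>f\<in>Lp p. s f \<le> M * Lp_norm p (conv h (class_L0 g * f))" unfolding s by blast
      show "\<exists>t\<in>?C. \<exists>C>0. \<forall>f\<in>Lp p. s f \<le> C * t f"
      proof
        show "(\<lambda>f. Lp_norm p (conv h (class_L0 g * f))) \<in> ?C" using gh by blast
        show "\<exists>C>0. \<forall>f\<in>Lp p. s f \<le> C * Lp_norm p (conv h (class_L0 g * f))" using M by blast
      qed
    qed
  next
    assume "openin (seminorm_topology (Lp p) ?C) U"
    then show "openin (seminorm_topology (Lp p) ?P) U"
    proof (rule seminorm_topology_mono[where V="Lp p" and S="?C" and T="?P", rotated -1])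
      show "f - g \<in> Lp p" if "f \<in> Lp p" "g \<in> Lp p" for f g :: "'n L0" by (rule diff[OF that])
      show "t 0 = 0" if "t \<in> ?P" for t by (rule polar0[OF that])
    next
      fix s and f g :: "'n L0" assume "s \<in> ?C" and fg: "f \<in> Lp p" "g \<in> Lp p"
      then show "s (f + g) \<le> s f + s g" using seminorm_conv_mult(2)[OF p] unfolding seminorm_on_def by blast
    next
      fix s assume "s \<in> ?C"
      then obtain g h where "g \<in> C0" "h \<in> Lp 1" and s: "s = (\<lambda>f. Lp_norm p (conv h (class_L0 g * f)))" by blast
      from conv_mult_seminorm_le_polar[OF pq assms(1) r this(1,2)] obtain K where
        K: "K \<noteq> {}" "abs_convex K" "compactin (Lp_topology q) K"
        and le: "\<forall>f\<in>Lp p. s f \<le> (SUP k\<in>K. cmod (pairing f k))" unfolding s by blast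
      show "\<exists>t\<in>?P. \<exists>C>0. \<forall>f\<in>Lp p. s f \<le> C * t f"
      proof
        show "(\<lambda>f. SUP k\<in>K. cmod (pairing f k)) \<in> ?P" using K by blast
        show "\<exists>C>0. \<forall>f\<in>Lp p. s f \<le> C * (SUP k\<in>K. cmod (pairing f k))"
          using le by (intro exI[of _ 1]) simp
      qed
    qed
  qed
  then have "(kappa p q :: 'n L0 topology) = seminorm_topology (Lp p) ?C"
    unfolding kappa_def by (simp add: topology_eq)
  then show ?thesis using seminorm_conv_mult[OF p] by blast
qed

end
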